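(* There exists a continuous, non-decreasing surjection $\mathfrak{r}\colon[0,1]\to[0,\tfrac12]$ such that for each $\alpha\in[0,1]$, $\mathfrak{r}(\alpha)$ is the unique optimal $1$-ratio of $\mathsf{A}_\alpha$. For each $\alpha\in[0,1]$, every element of $X_{\mathfrak{r}(\alpha)}$ is strongly extremal for $\mathsf{A}_\alpha$. Moreover, for every compact set $K\subset(0,1]$ there exists a constant $C_K>1$ such that \[ C_K^{-1}\le\frac{\rho\left(\mathcal{A}^{(\alpha)}(x,n)\right)}{\varrho(\alpha)^n}\le\frac{\left\|\mathcal{A}^{(\alpha)}(x,n)\right\|_2}{\varrho(\alpha)^n}\le C_K \] whenever $\alpha\in K$, $x\in X_{\mathfrak{r}(\alpha)}$ and $n\ge1$. Conversely, for every $\alpha\in[0,1]$: if $x\in\Sigma$ is a recurrent infinite word which is strongly extremal for $\mathsf{A}_\alpha$ then $x\in X_{\mathfrak{r}(\alpha)}$; and if $x\in\Sigma$ is any infinite word which is weakly extremal for $\mathsf{A}_\alpha$ then $\frac1n\sum_{k=0}^{n-1}\mathrm{dist}(T^kx,X_{\mathfrak{r}(\alpha)})\to0$ as $n\to\infty$.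
   Context: Matrices: $A_0:=\begin{pmatrix}1&1\\0&1\end{pmatrix}$, $A_1:=\begin{pmatrix}1&0\\1&1\end{pmatrix}$; for $\alpha\in[0,1]$, $A_0^{(\alpha)}:=A_0$, $A_1^{(\alpha)}:=\alpha A_1$, $\mathsf{A}_\alpha:=\{A_0^{(\alpha)},A_1^{(\alpha)}\}$. $\rho$ denotes spectral radius and $\|\cdot\|_2$ the operator norm on real $2\times2$ matrices induced by the Euclidean norm. The joint spectral radius is $\varrho(\alpha):=\limsup_{n\to\infty}\max\{\|A^{(\alpha)}_{i_1}\cdots A^{(\alpha)}_{i_n}\|_2^{1/n}\colon i_j\in\{0,1\}\}$. Words: a finite word is $u=(u_i)_{i=1}^n\in\{0,1\}^n$, with length $|u|=n$ and $|u|_1$ the number of its terms equal to $1$; if $u$ is nonempty its $1$-ratio is $\varsigma(u)=|u|_1/|u|$. $\Sigma=\{0,1\}^{\mathbb{N}}$ is the set of infinite words $x=(x_i)_{i=1}^\infty$, with metric $d(x,y)=2^{-\mathfrak{n}(x,y)}$, $\mathfrak{n}(x,y)=\inf\{i\ge1\colon x_i\ne y_i\}$ ($2^{-\infty}=0$); $\mathrm{dist}(x,Y)=\inf_{y\in Y}d(x,y)$. $T\colon\Sigma\to\Sigma$ is the shift $T[(x_i)_{i\ge1}]=(x_{i+1})_{i\ge1}$ and $\pi_n(x)=(x_i)_{i=1}^n$. For $x\in\Sigma$, $n\ge1$, $\mathcal{A}^{(\alpha)}(x,n):=A^{(\alpha)}_{x_n}A^{(\alpha)}_{x_{n-1}}\cdots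 A^{(\alpha)}_{x_1}$. A subword is a nonempty finite block of consecutive terms. An infinite word is recurrent if each of its finite subwords occurs in it infinitely often. A finite or infinite word is balanced if $\big||u|_1-|v|_1\big|\le1$ for all its finite subwords $u,v$ with $|u|=|v|$. For balanced $x\in\Sigma$ the limit $\varsigma(x):=\lim_n\varsigma(\pi_n(x))$ exists. For $\gamma\in[0,1]$, $X_\gamma$ is the set of all recurrent balanced $x\in\Sigma$ with $\varsigma(x)=\gamma$. $x\in\Sigma$ is strongly extremal for $\mathsf{A}_\alpha$ if there is $\delta>0$ with $\|\mathcal{A}^{(\alpha)}(x,n)\|_2\ge\delta\varrho(\alpha)^n$ for all $n\ge1$; it is weakly extremal for $\mathsf{A}_\alpha$ if $\lim_{n\to\infty}\|\mathcal{A}^{(\alpha)}(x,n)\|_2^{1/n}=\varrho(\alpha)$. A number $r\in[0,1]$ is the unique optimal $1$-ratio of $\mathsf{A}_\alpha$ if $\varsigma(\pi_n(x))\to r$ for every $x\in\Sigma$ which is weakly extremal for $\mathsf{A}_\alpha$. *)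

theory Defs
  imports "Jordan_Normal_Form.Spectral_Radius" "HOL-Analysis.Analysis"
begin

text \<open>Letters are booleans (\<open>True\<close> stands for \<open>1\<close>). Infinite words are indexed from \<open>0\<close>,
  so the term usually written \<open>x\<^sub>i\<close> with \<open>i \<ge> 1\<close> is \<open>x (i - 1)\<close>.\<close>

type_synonym fin_word = "bool list"
type_synonym inf_word = "nat \<Rightarrow> bool"
type_synonym mat2 = "real^2^2"

definition A0 :: mat2 where
  "A0 = vector [vector [1, 1], vector [0, 1]]"

definition A1 :: mat2 where
  "A1 = vector [vector [1, 0], vector [1, 1]]"

definition A_alpha :: "real \<Rightarrow> bool \<Rightarrow> mat2" where
  "A_alpha \<alpha> b = (if b then \<alpha> *\<^sub>R A1 else A0)"

definition op_norm :: "mat2 \<Rightarrow> real" where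
  "op_norm M = onorm ((*v) M)"

text \<open>Largest modulus of a complex eigenvalue, via \<open>spectral_radius\<close> on complex matrices.\<close>

definition spec_rad :: "mat2 \<Rightarrow> real" where
  "spec_rad M = spectral_radius (mat_of_rows_list 2
     [[complex_of_real (M $ 1 $ 1), complex_of_real (M $ 1 $ 2)],
      [complex_of_real (M $ 2 $ 1), complex_of_real (M $ 2 $ 2)]])"

text \<open>\<open>A\<^bsub>i\<^sub>1\<^esub> \<cdots> A\<^bsub>i\<^sub>n\<^esub>\<close>, in this order. The operation \<open>(*)\<close> on \<^typ>\<open>mat2\<close> is componentwise,
  hence the fold of \<open>(**)\<close>.\<close>

definition word_prod :: "real \<Rightarrow> fin_word \<Rightarrow> mat2" where
  "word_prod \<alpha> w = foldr (\<lambda>b M. A_alpha \<alpha> b ** M) w (mat 1)"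

text \<open>The \<open>limsup\<close> is taken in \<^typ>\<open>ereal\<close>; the sequence is bounded, so it is finite.\<close>

definition jsr :: "real \<Rightarrow> real" where
  "jsr \<alpha> = real_of_ereal (limsup (\<lambda>n. ereal
     (Max {root n (op_norm (word_prod \<alpha> w)) | w. length w = n})))"

text \<open>\<open>A\<^bsub>x\<^sub>n\<^esub> \<cdots> A\<^bsub>x\<^sub>1\<^esub>\<close>: later letters multiply on the left.\<close>

primrec cocycle :: "real \<Rightarrow> inf_word \<Rightarrow> nat \<Rightarrow> mat2" where
  "cocycle \<alpha> x 0 = mat 1"
| "cocycle \<alpha> x (Suc n) = A_alpha \<alpha> (x n) ** cocycle \<alpha> x n"

definition ones :: "fin_word \<Rightarrow> nat" where
  "ones u = count_list u True"

definition one_ratio :: "fin_word \<Rightarrow> real" where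
  "one_ratio u = real (ones u) / real (length u)"

definition word_prefix :: "nat \<Rightarrow> inf_word \<Rightarrow> fin_word" where
  "word_prefix n x = map x [0..<n]"

definition shift :: "inf_word \<Rightarrow> inf_word" where
  "shift x = (\<lambda>i. x (Suc i))"

text \<open>With indices starting at \<open>0\<close>, the first position (counted from \<open>1\<close>) at which two
  distinct words differ is \<open>Suc (LEAST i. x i \<noteq> y i)\<close>.\<close>

definition word_dist :: "inf_word \<Rightarrow> inf_word \<Rightarrow> real" where
  "word_dist x y = (if x = y then 0 else (1/2) ^ Suc (LEAST i. x i \<noteq> y i))"

definition word_setdist :: "inf_word \<Rightarrow> inf_word set \<Rightarrow> real" where
  "word_setdist x Y = (INF y\<in>Y. word_dist x y)"

definition occurs_at :: "fin_word \<Rightarrow> inf_word \<Rightarrow> nat \<Rightarrow> bool" where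
  "occurs_at u x i \<longleftrightarrow> map x [i..<i + length u] = u"

definition subwords :: "inf_word \<Rightarrow> fin_word set" where
  "subwords x = {u. u \<noteq> [] \<and> (\<exists>i. occurs_at u x i)}"

definition recurrent :: "inf_word \<Rightarrow> bool" where
  "recurrent x \<longleftrightarrow> (\<forall>u\<in>subwords x. infinite {i. occurs_at u x i})"

definition balanced :: "inf_word \<Rightarrow> bool" where
  "balanced x \<longleftrightarrow> (\<forall>u\<in>subwords x. \<forall>v\<in>subwords x. length u = length v \<longrightarrow>
     \<bar>int (ones u) - int (ones v)\<bar> \<le> 1)"

definition X_words :: "real \<Rightarrow> inf_word set" where
  "X_words \<gamma> = {x. recurrent x \<and> balanced x \<and> (\<lambda>n. one_ratio (word_prefix n x)) \<longlonglongrightarrow> \<gamma>}"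

definition strongly_extremal :: "real \<Rightarrow> inf_word \<Rightarrow> bool" where
  "strongly_extremal \<alpha> x \<longleftrightarrow>
     (\<exists>\<delta>>0. \<forall>n\<ge>1. op_norm (cocycle \<alpha> x n) \<ge> \<delta> * jsr \<alpha> ^ n)"

definition weakly_extremal :: "real \<Rightarrow> inf_word \<Rightarrow> bool" where
  "weakly_extremal \<alpha> x \<longleftrightarrow> (\<lambda>n. root n (op_norm (cocycle \<alpha> x n))) \<longlonglongrightarrow> jsr \<alpha>"

definition unique_optimal_one_ratio :: "real \<Rightarrow> real \<Rightarrow> bool" where
  "unique_optimal_one_ratio \<alpha> r \<longleftrightarrow> r \<in> {0..1} \<and>
     (\<forall>x. weakly_extremal \<alpha> x \<longrightarrow> (\<lambda>n. one_ratio (word_prefix n x)) \<longlonglongrightarrow> r)"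

end

theory Submission
  imports Defs "HOL-Library.Sublist" "HOL-Real_Asymp.Real_Asymp"
begin

text \<open>
  Everything rests on one inequality for products of the two matrices. Exchanging the diagonal
  entries of a matrix is an anti-automorphism that fixes \<open>A0\<close> and \<open>A1\<close>, hence it turns the
  product along a word into the product along the reversed word. If \<open>p\<close> is a palindrome and a
  word contains first \<open>0p0\<close> and later \<open>1p1\<close>, then reversing the factor between the outer
  letters \<open>0\<close> and \<open>1\<close> produces a word with the same letters whose product is larger, in no
  entry smaller (\<open>word_prod_reverse_factor\<close>); the same holds with the roles of the letters
  exchanged. When the surroundings contain both letters, the gain is a fixed factor larger than
  one, and disjoint pairs of such occurrences multiply their gains
  (\<open>conflicting_gain_iterated\<close>). On the other hand a word that is not balanced contains \<open>0p0\<close>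
  and \<open>1p1\<close> for some palindrome \<open>p\<close> (\<open>unbalanced_palindrome\<close>). As no product of \<open>n\<close> matrices
  exceeds a constant times \<open>jsr \<alpha> ^ n\<close>, near-maximal growth forces balancedness.

  The size of a product is measured by the sum of its entries, called \<open>mass\<close>. It is
  submultiplicative, invariant under reversal, and satisfies a reverse inequality
  \<open>mass (u01v) \<ge> \<alpha> * mass u * mass v\<close>, so that \<open>mass\<close> is bounded by a multiple of
  \<open>jsr \<alpha> ^ n\<close> (\<open>mass_le_jsr\<close>), and near-extremal words can be concatenated.

  The quantitative form of this principle is \<open>typical_windows\<close>: in a long word with almost maximal
  growth all but a small proportion of the windows of a given length come from one set of words any
  two of which are balanced against each other. In particular their numbers of ones take two
  consecutive values only. Applied to the concatenation of powers of two near-extremal words it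
  shows that their ratios of ones are close, which yields the optimal ratio
  \<open>opt_ratio \<alpha>\<close> (\<open>optimal_ratio_exists\<close>). Since near-extremality for one parameter persists, with
  a small loss, for nearby parameters, \<open>opt_ratio\<close> is continuous; comparing extremal words of two
  parameters makes it monotone, and exchanging the letters gives the value \<open>1/2\<close> at \<open>1\<close>.

  Write \<open>r\<close> for \<open>opt_ratio \<alpha>\<close>. The set \<open>X_words r\<close> consists of the words all of whose windows of
  length \<open>n\<close> contain strictly between \<open>r * n - 1\<close> and \<open>r * n + 1\<close> ones (\<open>X_words_eq_regular\<close>),
  and any two such words have the same finite factors (\<open>window_occurs_in_regular\<close>). In a weakly
  extremal word the windows violating this condition have density zero, which after a compactness
  argument is the statement on the mean distance. Conversely, extremal finite words
  of growing length produce an infinite word whose factors all have the largest possible growth,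
  up to a constant; almost all its windows satisfy the condition, so another limit gives an
  element of \<open>X_words r\<close> with this property. As all elements share their factors, all of them are
  strongly extremal, with constants depending only on a lower bound for \<open>\<alpha>\<close>.
\<close>

section \<open>Matrix products along words\<close>

(* Here the symbol denotes the components of vectors in real^2 only. *)
no_notation Matrix.vec_index (infixl "$" 100)

lemma mat2_mult_entries:
  fixes M N :: mat2
  shows "(M ** N) $ 1 $ 1 = M$1$1 * N$1$1 + M$1$2 * N$2$1"
    "(M ** N) $ 1 $ 2 = M$1$1 * N$1$2 + M$1$2 * N$2$2"
    "(M ** N) $ 2 $ 1 = M$2$1 * N$1$1 + M$2$2 * N$2$1"
    "(M ** N) $ 2 $ 2 = M$2$1 * N$1$2 + M$2$2 * N$2$2"
  by (simp_all add: matrix_matrix_mult_def sum_2)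

lemma A_entries:
  "A0$1$1 = 1" "A0$1$2 = 1" "A0$2$1 = 0" "A0$2$2 = 1"
  "A1$1$1 = 1" "A1$1$2 = 0" "A1$2$1 = 1" "A1$2$2 = 1"
  by (simp_all add: A0_def A1_def)

lemma mat2_eqI:
  fixes M N :: mat2
  assumes "M$1$1 = N$1$1" "M$1$2 = N$1$2" "M$2$1 = N$2$1" "M$2$2 = N$2$2"
  shows "M = N"
  using assms by (simp add: vec_eq_iff forall_2)

lemma word_prod_Nil [simp]: "word_prod \<alpha> [] = mat 1"
  and word_prod_Cons: "word_prod \<alpha> (b # w) = A_alpha \<alpha> b ** word_prod \<alpha> w"
  by (simp_all add: word_prod_def)

lemma word_prod_append: "word_prod \<alpha> (u @ v) = word_prod \<alpha> u ** word_prod \<alpha> v"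
  by (induction u) (simp_all add: word_prod_Cons matrix_mul_assoc)

lemma cocycle_eq_word_prod: "cocycle \<alpha> x n = word_prod \<alpha> (rev (word_prefix n x))"
  by (induction n) (simp_all add: word_prefix_def word_prod_Cons)

lemma ones_simps [simp]:
  "ones [] = 0" "ones (b # w) = (if b then Suc (ones w) else ones w)"
  "ones (u @ v) = ones u + ones v" "ones (rev w) = ones w"
  by (simp_all add: ones_def)

lemma ones_le_length: "ones w \<le> length w"
  by (simp add: ones_def count_le_length)

lemma ones_replicate [simp]: "ones (replicate k b) = (if b then k else 0)"
  by (induction k) auto

lemma ones_map_Not: "ones (map Not w) + ones w = length w"
  by (induction w) auto

lemma word_prod_scale: "word_prod \<alpha> w = \<alpha> ^ ones w *\<^sub>R word_prod 1 w"
  by (induction w)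
    (auto simp: word_prod_Cons A_alpha_def mat2_mult_entries algebra_simps intro!: mat2_eqI)

definition mat_nonneg :: "mat2 \<Rightarrow> bool" where
  "mat_nonneg M \<longleftrightarrow> 0 \<le> M$1$1 \<and> 0 \<le> M$1$2 \<and> 0 \<le> M$2$1 \<and> 0 \<le> M$2$2"

definition entry_sum :: "mat2 \<Rightarrow> real" where
  "entry_sum M = M$1$1 + M$1$2 + M$2$1 + M$2$2"

definition mass :: "real \<Rightarrow> fin_word \<Rightarrow> real" where
  "mass \<alpha> w = entry_sum (word_prod \<alpha> w)"

lemma mat_one_entries: "(mat 1 :: mat2)$1$1 = 1" "(mat 1 :: mat2)$1$2 = 0"
  "(mat 1 :: mat2)$2$1 = 0" "(mat 1 :: mat2)$2$2 = 1"
  by (simp_all add: mat_def)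

text \<open>Each factor has determinant one and dominates the identity entrywise, and both properties
  pass to products.\<close>

lemma word_prod_one_entries:
  shows "word_prod 1 w $1$1 \<ge> 1" "word_prod 1 w $2$2 \<ge> 1"
    "word_prod 1 w $1$2 \<ge> 0" "word_prod 1 w $2$1 \<ge> 0"
    "word_prod 1 w $1$1 * word_prod 1 w $2$2 - word_prod 1 w $1$2 * word_prod 1 w $2$1 = 1"
  by (induction w)
    (auto simp: word_prod_Cons A_alpha_def mat2_mult_entries A_entries mat_one_entries algebra_simps)

lemma word_prod_nonneg: "\<alpha> \<ge> 0 \<Longrightarrow> mat_nonneg (word_prod \<alpha> w)"
  using word_prod_one_entries[of w] by (subst word_prod_scale) (simp add: mat_nonneg_def)

lemma mass_scale: "mass \<alpha> w = \<alpha> ^ ones w * mass 1 w"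
  by (simp add: mass_def entry_sum_def word_prod_scale[of \<alpha>] algebra_simps)

lemma mass_one_ge_2: "mass 1 w \<ge> 2"
  using word_prod_one_entries[of w] by (simp add: mass_def entry_sum_def)

lemma mass_pos: "\<alpha> > 0 \<Longrightarrow> mass \<alpha> w > 0"
  using mass_one_ge_2[of w] by (subst mass_scale) (simp add: zero_less_mult_iff)

lemma mass_nonneg: "\<alpha> \<ge> 0 \<Longrightarrow> mass \<alpha> w \<ge> 0"
  using mass_one_ge_2[of w] by (subst mass_scale) simp

lemma mass_Nil [simp]: "mass \<alpha> [] = 2"
  by (simp add: mass_def entry_sum_def mat_one_entries)

lemma entry_sum_mult_le:
  assumes "mat_nonneg M" "mat_nonneg N"
  shows "entry_sum (M ** N) \<le> entry_sum M * entry_sum N"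
proof -
  have "entry_sum M * entry_sum N - entry_sum (M ** N) =
     (M$1$1 + M$2$1) * (N$2$1 + N$2$2) + (M$1$2 + M$2$2) * (N$1$1 + N$1$2)"
    by (simp add: entry_sum_def mat2_mult_entries algebra_simps)
  also have "\<dots> \<ge> 0" using assms by (simp add: mat_nonneg_def)
  finally show ?thesis by simp
qed

lemma mass_append_le: "\<alpha> \<ge> 0 \<Longrightarrow> mass \<alpha> (u @ v) \<le> mass \<alpha> u * mass \<alpha> v"
  unfolding mass_def word_prod_append by (intro entry_sum_mult_le word_prod_nonneg)

text \<open>A middle factor with entries bounded below decouples its two neighbours: the matrix with all
  entries \<open>1\<close> has rank one, and \<open>entry_sum\<close> is multiplicative across it.\<close>

lemma entry_sum_decouple:
  fixes M N P :: mat2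
  assumes "mat_nonneg M" "mat_nonneg N" "c \<ge> 0"
    and "P$1$1 \<ge> c" "P$1$2 \<ge> c" "P$2$1 \<ge> c" "P$2$2 \<ge> c"
  shows "entry_sum (M ** P ** N) \<ge> c * entry_sum M * entry_sum N"
proof -
  have "entry_sum (M ** P ** N) - c * entry_sum M * entry_sum N =
     (M$1$1 + M$2$1) * (P$1$1 - c) * (N$1$1 + N$1$2) + (M$1$1 + M$2$1) * (P$1$2 - c) * (N$2$1 + N$2$2)
   + (M$1$2 + M$2$2) * (P$2$1 - c) * (N$1$1 + N$1$2) + (M$1$2 + M$2$2) * (P$2$2 - c) * (N$2$1 + N$2$2)"
    by (simp add: entry_sum_def mat2_mult_entries algebra_simps)
  also have "\<dots> \<ge> 0" using assms by (simp add: mat_nonneg_def)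
  finally show ?thesis by simp
qed

text \<open>The factor \<open>A0 ** (\<alpha> *\<^sub>R A1)\<close> has all entries at least \<open>\<alpha>\<close>, so inserting \<open>01\<close> turns
  the submultiplicative bound around.\<close>

lemma mass_bridge:
  assumes "\<alpha> \<ge> 0"
  shows "mass \<alpha> (u @ [False, True] @ v) \<ge> \<alpha> * mass \<alpha> u * mass \<alpha> v"
proof -
  have *: "word_prod \<alpha> [False, True] = A0 ** (\<alpha> *\<^sub>R A1)"
    by (simp add: word_prod_Cons A_alpha_def)
  have "entry_sum (word_prod \<alpha> u ** word_prod \<alpha> [False, True] ** word_prod \<alpha> v)
    \<ge> \<alpha> * entry_sum (word_prod \<alpha> u) * entry_sum (word_prod \<alpha> v)"
    using assms by (intro entry_sum_decouple word_prod_nonneg)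
      (simp_all add: * mat2_mult_entries A_entries)
  thus ?thesis by (simp only: mass_def word_prod_append matrix_mul_assoc)
qed

text \<open>Exchanging the two diagonal entries is the anti-automorphism \<open>M \<mapsto> J M\<^sup>T J\<close>, where \<open>J\<close> is
  the coordinate flip. It fixes both \<open>A0\<close> and \<open>A1\<close>, so it realises the reversal of words.\<close>

lemma word_prod_rev_entries:
  "word_prod \<alpha> (rev w) $1$1 = word_prod \<alpha> w $2$2" "word_prod \<alpha> (rev w) $1$2 = word_prod \<alpha> w $1$2"
  "word_prod \<alpha> (rev w) $2$1 = word_prod \<alpha> w $2$1" "word_prod \<alpha> (rev w) $2$2 = word_prod \<alpha> w $1$1"
  by (induction w)
    (auto simp: word_prod_Cons word_prod_append A_alpha_def mat2_mult_entries A_entries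
      mat_one_entries algebra_simps)

lemma mass_rev: "mass \<alpha> (rev w) = mass \<alpha> w"
  by (simp add: mass_def entry_sum_def word_prod_rev_entries)

text \<open>Conjugation by \<open>J\<close> exchanges \<open>A0\<close> and \<open>A1\<close>, so it realises the exchange of letters.\<close>

lemma word_prod_Not_entries:
  "word_prod 1 (map Not w) $1$1 = word_prod 1 w $2$2" "word_prod 1 (map Not w) $1$2 = word_prod 1 w $2$1"
  "word_prod 1 (map Not w) $2$1 = word_prod 1 w $1$2" "word_prod 1 (map Not w) $2$2 = word_prod 1 w $1$1"
  by (induction w)
    (auto simp: word_prod_Cons A_alpha_def mat2_mult_entries A_entries mat_one_entries algebra_simps)

lemma mass_one_Not: "mass 1 (map Not w) = mass 1 w"
  by (simp add: mass_def entry_sum_def word_prod_Not_entries)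

lemma mass_one_le: "mass 1 w \<le> 2 * 2 ^ length w"
proof (induction w)
  case (Cons b w)
  have "mass 1 (b # w) \<le> 2 * mass 1 w"
    using word_prod_one_entries[of w]
    by (auto simp: mass_def entry_sum_def word_prod_Cons A_alpha_def mat2_mult_entries A_entries)
  with Cons.IH show ?case by simp
qed simp

lemma mass_replicate: "mass \<alpha> (replicate k b) = (if b then \<alpha> ^ k else 1) * (real k + 2)"
proof -
  have "word_prod 1 (replicate k b) $1$1 = 1 \<and> word_prod 1 (replicate k b) $2$2 = 1
    \<and> word_prod 1 (replicate k b) $1$2 = (if b then 0 else real k)
    \<and> word_prod 1 (replicate k b) $2$1 = (if b then real k else 0)"
    by (induction k) (auto simp: word_prod_Cons A_alpha_def mat2_mult_entries A_entries mat_one_entries)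
  thus ?thesis by (subst mass_scale) (auto simp: mass_def entry_sum_def)
qed

section \<open>Operator norm and spectral radius\<close>

lemma entry_le_op_norm: "\<bar>M $ i $ j\<bar> \<le> op_norm M"
proof -
  have "\<bar>M $ i $ j\<bar> = \<bar>(M *v axis j 1) $ i\<bar>"
    by (simp add: matrix_vector_mult_basis column_def)
  also have "\<dots> \<le> norm (M *v axis j 1)" by (rule component_le_norm_cart)
  also have "\<dots> \<le> onorm ((*v) M) * norm (axis j 1 :: real^2)"
    by (rule onorm) (simp add: matrix_vector_mul_bounded_linear)
  also have "\<dots> = op_norm M" by (simp add: op_norm_def)
  finally show ?thesis .
qed

lemma entry_sum_le_op_norm: "entry_sum M \<le> 4 * op_norm M"
  using entry_le_op_norm[of M 1 1] entry_le_op_norm[of M 1 2]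
    entry_le_op_norm[of M 2 1] entry_le_op_norm[of M 2 2]
  by (simp add: entry_sum_def)

lemma op_norm_le_entry_sum:
  assumes "mat_nonneg M" shows "op_norm M \<le> entry_sum M"
  unfolding op_norm_def
proof (rule onorm_le)
  fix v :: "real^2"
  have v: "\<bar>v $ 1\<bar> \<le> norm v" "\<bar>v $ 2\<bar> \<le> norm v" by (rule component_le_norm_cart)+
  have le: "\<bar>p * v $ 1 + q * v $ 2\<bar> \<le> (p + q) * norm v" if "p \<ge> 0" "q \<ge> 0" for p q
  proof -
    have "\<bar>p * v $ 1 + q * v $ 2\<bar> \<le> p * \<bar>v $ 1\<bar> + q * \<bar>v $ 2\<bar>"
      using that abs_triangle_ineq[of "p * v $ 1" "q * v $ 2"] by (simp add: abs_mult)
    also have "\<dots> \<le> p * norm v + q * norm v"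
      using that v by (intro add_mono mult_left_mono) auto
    finally show ?thesis by (simp add: algebra_simps)
  qed
  have "norm (M *v v) \<le> (\<Sum>i\<in>UNIV. \<bar>(M *v v) $ i\<bar>)" by (rule norm_le_l1_cart)
  also have "\<dots> = \<bar>M$1$1 * v$1 + M$1$2 * v$2\<bar> + \<bar>M$2$1 * v$1 + M$2$2 * v$2\<bar>"
    by (simp add: sum_2 matrix_vector_mult_def)
  also have "\<dots> \<le> (M$1$1 + M$1$2) * norm v + (M$2$1 + M$2$2) * norm v"
    using assms by (intro add_mono le) (auto simp: mat_nonneg_def)
  finally show "norm (M *v v) \<le> entry_sum M * norm v"
    by (simp add: entry_sum_def algebra_simps)
qed

lemma op_norm_mult_le: "op_norm (M ** N) \<le> op_norm M * op_norm N"
proof -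
  have "op_norm (M ** N) = onorm ((*v) M \<circ> (*v) N)"
    unfolding op_norm_def by (intro arg_cong[where f = onorm]) (auto simp: matrix_vector_mul_assoc)
  also have "\<dots> \<le> onorm ((*v) M) * onorm ((*v) N)"
    by (intro onorm_compose) (simp_all add: matrix_vector_mul_bounded_linear)
  finally show ?thesis by (simp add: op_norm_def)
qed

lemma op_norm_nonneg: "op_norm M \<ge> 0"
  unfolding op_norm_def by (intro onorm_pos_le) (simp add: matrix_vector_mul_bounded_linear)

text \<open>A cocycle multiplies along the reversed prefix, which has the same mass as the prefix.\<close>

lemma mass_cocycle:
  assumes "\<alpha> \<ge> 0"
  shows "mass \<alpha> (word_prefix n x) \<le> 4 * op_norm (cocycle \<alpha> x n)"
    "op_norm (cocycle \<alpha> x n) \<le> mass \<alpha> (word_prefix n x)"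
proof -
  have *: "mass \<alpha> (word_prefix n x) = entry_sum (cocycle \<alpha> x n)"
    by (simp add: cocycle_eq_word_prod flip: mass_def) (simp add: mass_rev)
  show "mass \<alpha> (word_prefix n x) \<le> 4 * op_norm (cocycle \<alpha> x n)"
    unfolding * by (rule entry_sum_le_op_norm)
  show "op_norm (cocycle \<alpha> x n) \<le> mass \<alpha> (word_prefix n x)"
    unfolding * using assms by (intro op_norm_le_entry_sum)
      (simp add: cocycle_eq_word_prod word_prod_nonneg)
qed

lemma spectrum_mat2_iff:
  "k \<in> spectrum (mat_of_rows_list 2 [[a, b], [c, d]]) \<longleftrightarrow>
     (\<exists>p q. (p \<noteq> 0 \<or> q \<noteq> 0) \<and> a * p + b * q = k * p \<and> c * p + d * q = k * (q :: complex))"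
  (is "k \<in> spectrum ?A \<longleftrightarrow> _")
proof -
  have dim: "dim_row ?A = 2" "dim_col ?A = 2" by (auto simp: mat_of_rows_list_def)
  have all2: "(\<forall>i<2. P i) \<longleftrightarrow> P 0 \<and> P 1" for P :: "nat \<Rightarrow> bool"
    by (auto simp: less_2_cases_iff)
  have mult: "?A *\<^sub>v v = k \<cdot>\<^sub>v v \<longleftrightarrow> a * vec_index v 0 + b * vec_index v 1 = k * vec_index v 0
      \<and> c * vec_index v 0 + d * vec_index v 1 = k * vec_index v 1" if "v \<in> carrier_vec 2" for v
    using that
  proof -
    have "dim_vec v = 2" using that by auto
    hence "vec_index (?A *\<^sub>v v) 0 = a * vec_index v 0 + b * vec_index v 1"
      "vec_index (?A *\<^sub>v v) 1 = c * vec_index v 0 + d * vec_index v 1"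
      by (simp_all add: scalar_prod_def mat_of_rows_list_def numeral_2_eq_2)
    moreover have "?A *\<^sub>v v = k \<cdot>\<^sub>v v \<longleftrightarrow> vec_index (?A *\<^sub>v v) 0 = vec_index (k \<cdot>\<^sub>v v) 0
      \<and> vec_index (?A *\<^sub>v v) 1 = vec_index (k \<cdot>\<^sub>v v) 1"
      unfolding Matrix.vec_eq_iff using dim \<open>dim_vec v = 2\<close> by (simp del: index_mult_mat_vec add: all2)
    ultimately show ?thesis using \<open>dim_vec v = 2\<close> by (simp del: index_mult_mat_vec)
  qed
  show ?thesis
  proof
    assume "k \<in> spectrum ?A"
    then obtain v where v: "v \<in> carrier_vec 2" "v \<noteq> 0\<^sub>v 2" "?A *\<^sub>v v = k \<cdot>\<^sub>v v"
      unfolding spectrum_def eigenvalue_def eigenvector_def dim by auto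
    have "vec_index v 0 \<noteq> 0 \<or> vec_index v 1 \<noteq> 0"
    proof (rule ccontr)
      assume "\<not> (vec_index v 0 \<noteq> 0 \<or> vec_index v 1 \<noteq> 0)"
      hence "v = 0\<^sub>v 2" using v(1) by (intro eq_vecI) (auto simp: less_2_cases_iff)
      with v(2) show False by blast
    qed
    with v(3)[unfolded mult[OF v(1)]]
    show "\<exists>p q. (p \<noteq> 0 \<or> q \<noteq> 0) \<and> a * p + b * q = k * p \<and> c * p + d * q = k * q"
      by blast
  next
    assume "\<exists>p q. (p \<noteq> 0 \<or> q \<noteq> 0) \<and> a * p + b * q = k * p \<and> c * p + d * q = k * q"
    then obtain p q where pq: "p \<noteq> 0 \<or> q \<noteq> 0" "a * p + b * q = k * p" "c * p + d * q = k * q" by blast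
    define v where "v = Matrix.vec 2 (\<lambda>i. if i = 0 then p else q)"
    have v: "v \<in> carrier_vec 2" "vec_index v 0 = p" "vec_index v 1 = q"
      by (simp_all add: v_def)
    have nz: "v \<noteq> 0\<^sub>v 2"
    proof
      assume "v = 0\<^sub>v 2"
      hence "vec_index v 0 = 0" "vec_index v 1 = 0" by simp_all
      with v pq(1) show False by simp
    qed
    have "?A *\<^sub>v v = k \<cdot>\<^sub>v v" unfolding mult[OF v(1)] v(2,3) using pq(2,3) by blast
    with v(1) nz show "k \<in> spectrum ?A"
      unfolding spectrum_def eigenvalue_def eigenvector_def dim by blast
  qed
qed

lemma carrier_mat2: "mat_of_rows_list 2 [[a, b], [c, d]] \<in> carrier_mat 2 2"
  by (rule carrier_matI) (simp_all add: mat_of_rows_list_def)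

lemma spec_rad_attained:
  obtains k where "spec_rad M = norm k"
    "k \<in> spectrum (mat_of_rows_list 2
     [[complex_of_real (M $ 1 $ 1), complex_of_real (M $ 1 $ 2)],
      [complex_of_real (M $ 2 $ 1), complex_of_real (M $ 2 $ 2)]])"
  
  using spectral_radius_mem_max(1)[OF carrier_mat2, of "complex_of_real (M $ 1 $ 1)"
      "complex_of_real (M $ 1 $ 2)" "complex_of_real (M $ 2 $ 1)" "complex_of_real (M $ 2 $ 2)"]
    that unfolding spec_rad_def by fastforce

text \<open>Real and imaginary part of an eigenvector are real vectors whose images have squared norms
  adding up to the squared norm of the image of the eigenvector.\<close>

lemma spec_rad_le_op_norm: "spec_rad M \<le> op_norm M"
proof -
  obtain k where k: "spec_rad M = norm k" and s: "k \<in> spectrum (mat_of_rows_list 2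
     [[complex_of_real (M $ 1 $ 1), complex_of_real (M $ 1 $ 2)],
      [complex_of_real (M $ 2 $ 1), complex_of_real (M $ 2 $ 2)]])" by (rule spec_rad_attained)
  from s obtain p q :: complex where pq: "p \<noteq> 0 \<or> q \<noteq> 0"
    "M$1$1 * p + M$1$2 * q = k * p" "M$2$1 * p + M$2$2 * q = k * q"
    unfolding spectrum_mat2_iff by blast
  define x y :: "real^2" where "x = vector [Re p, Re q]" and "y = vector [Im p, Im q]"
  have bound: "(norm (M *v z))\<^sup>2 \<le> (op_norm M)\<^sup>2 * (norm z)\<^sup>2" for z :: "real^2"
  proof -
    have "norm (M *v z) \<le> op_norm M * norm z" unfolding op_norm_def
      by (rule onorm) (simp add: matrix_vector_mul_bounded_linear)
    from power_mono[OF this, of 2] show ?thesis by (simp add: power_mult_distrib)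
  qed
  have nrm: "(norm z)\<^sup>2 = (z$1)\<^sup>2 + (z$2)\<^sup>2" for z :: "real^2"
    by (simp add: norm_vec_def L2_set_def sum_2)
  have sum1: "(norm x)\<^sup>2 + (norm y)\<^sup>2 = (norm p)\<^sup>2 + (norm q)\<^sup>2"
    by (simp add: nrm x_def y_def cmod_power2)
  have "(norm (M *v x))\<^sup>2 + (norm (M *v y))\<^sup>2
    = (norm (M$1$1 * p + M$1$2 * q))\<^sup>2 + (norm (M$2$1 * p + M$2$2 * q))\<^sup>2"
    by (simp add: nrm x_def y_def cmod_power2 matrix_vector_mult_def sum_2)
  also have "\<dots> = (norm k)\<^sup>2 * ((norm p)\<^sup>2 + (norm q)\<^sup>2)"
    by (simp only: pq norm_mult power_mult_distrib ring_distribs)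
  finally have eq: "(norm (M *v x))\<^sup>2 + (norm (M *v y))\<^sup>2 = (norm k)\<^sup>2 * ((norm p)\<^sup>2 + (norm q)\<^sup>2)" .
  have "(norm k)\<^sup>2 * ((norm p)\<^sup>2 + (norm q)\<^sup>2) \<le> (op_norm M)\<^sup>2 * ((norm p)\<^sup>2 + (norm q)\<^sup>2)"
    using bound[of x] bound[of y] unfolding eq[symmetric] unfolding sum1[symmetric] distrib_left
    by linarith
  moreover have "(norm p)\<^sup>2 + (norm q)\<^sup>2 > 0"
    using pq(1) by (auto simp: sum_power2_gt_zero_iff)
  ultimately have "(norm k)\<^sup>2 \<le> (op_norm M)\<^sup>2" by simp
  thus ?thesis unfolding k using op_norm_nonneg by (rule power2_le_imp_le)
qed

text \<open>A nonnegative matrix of order two has real eigenvalues, and the larger one is at least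
  half of the trace.\<close>

lemma trace_le_spec_rad:
  assumes "mat_nonneg M" shows "(M$1$1 + M$2$2) / 2 \<le> spec_rad M"
proof -
  define a b c d where "a = M$1$1" and "b = M$1$2" and "c = M$2$1" and "d = M$2$2"
  note defs = a_def b_def c_def d_def
  have nn: "a \<ge> 0" "b \<ge> 0" "c \<ge> 0" "d \<ge> 0" using assms by (auto simp: mat_nonneg_def defs)
  define r where "r = sqrt ((a - d)\<^sup>2 + 4 * b * c)"
  have r2: "r\<^sup>2 = (a - d)\<^sup>2 + 4 * b * c" unfolding r_def using nn by (intro real_sqrt_pow2) auto
  have r0: "r \<ge> 0" unfolding r_def using nn by auto
  define l where "l = (a + d + r) / 2"
  have l0: "l \<ge> (a + d) / 2" using r0 by (simp add: l_def)
  have char: "(l - a) * (l - d) = b * c"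
    using r2 by (simp add: l_def field_simps power2_eq_square)
  have "\<exists>p q. (p \<noteq> 0 \<or> q \<noteq> 0) \<and> a * p + b * q = l * p \<and> c * p + d * q = l * (q :: real)"
  proof (cases "b = 0 \<and> l = a")
    case False
    thus ?thesis using char by (intro exI[of _ b] exI[of _ "l - a"]) (auto simp: algebra_simps)
  next
    case True
    show ?thesis
    proof (cases "c = 0 \<and> l = d")
      case False
      thus ?thesis using True by (intro exI[of _ "l - d"] exI[of _ c]) (auto simp: algebra_simps)
    next
      case True2: True
      thus ?thesis using True by (intro exI[of _ 1] exI[of _ 1]) auto
    qed
  qed
  then obtain p q where pq: "p \<noteq> 0 \<or> q \<noteq> 0" "a * p + b * q = l * p" "c * p + d * q = l * (q :: real)" by blast
  have "complex_of_real l \<in> spectrum (mat_of_rows_list 2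
     [[complex_of_real a, complex_of_real b], [complex_of_real c, complex_of_real d]])"
    unfolding spectrum_mat2_iff
    by (rule exI[of _ "complex_of_real p"], rule exI[of _ "complex_of_real q"])
      (use pq in \<open>simp flip: of_real_mult of_real_add\<close>)
  hence "norm (complex_of_real l) \<le> spec_rad M" unfolding spec_rad_def defs
    by (intro spectral_radius_mem_max(2)[OF carrier_mat2] imageI) simp_all
  with l0 show ?thesis by (simp add: defs)
qed

section \<open>The joint spectral radius\<close>

abbreviation best_root :: "real \<Rightarrow> nat \<Rightarrow> real" where
  "best_root \<alpha> n \<equiv> Max {root n (op_norm (word_prod \<alpha> w)) | w. length w = n}"

lemma finite_words: "finite {w :: bool list. length w = n}"
  using finite_lists_length_eq[of "UNIV :: bool set" n] by simp

lemma best_root_facts: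
  shows "length w = n \<Longrightarrow> root n (op_norm (word_prod \<alpha> w)) \<le> best_root \<alpha> n"
    and "\<exists>w. length w = n \<and> best_root \<alpha> n = root n (op_norm (word_prod \<alpha> w))"
proof -
  have eq: "{root n (op_norm (word_prod \<alpha> w)) | w. length w = n}
    = (\<lambda>w. root n (op_norm (word_prod \<alpha> w))) ` {w. length w = n}" by auto
  have fin: "finite {root n (op_norm (word_prod \<alpha> w)) | w. length w = n}"
    unfolding eq using finite_words by blast
  show "length w = n \<Longrightarrow> root n (op_norm (word_prod \<alpha> w)) \<le> best_root \<alpha> n"
    using fin by (intro Max_ge) auto
  have "replicate n True \<in> {w. length w = n}" by simp
  hence "{root n (op_norm (word_prod \<alpha> w)) | w. length w = n} \<noteq> {}" unfolding eq by blast
  from Max_in[OF fin this] show "\<exists>w. length w = n \<and> best_root \<alpha> n = root n (op_norm (word_prod \<alpha> w))"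
    by auto
qed

lemma op_norm_word_prod_append:
  "op_norm (word_prod \<alpha> (u @ v)) \<le> op_norm (word_prod \<alpha> u) * op_norm (word_prod \<alpha> v)"
  by (simp add: word_prod_append op_norm_mult_le)

lemma op_norm_word_prod_le:
  assumes "\<alpha> \<in> {0..1}" shows "op_norm (word_prod \<alpha> w) \<le> 3 ^ length w"
proof (induction w)
  case Nil
  have "op_norm (mat 1) = onorm (id :: real^2 \<Rightarrow> real^2)"
    unfolding op_norm_def by (intro arg_cong[where f = onorm]) auto
  also have "\<dots> \<le> 1" unfolding id_def by (rule onorm_id_le)
  finally show ?case by simp
next
  case (Cons b w)
  have "op_norm (A_alpha \<alpha> b) \<le> entry_sum (A_alpha \<alpha> b)"
    using assms by (intro op_norm_le_entry_sum) (auto simp: mat_nonneg_def A_alpha_def A_entries)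
  also have "\<dots> \<le> 3" using assms by (auto simp: entry_sum_def A_alpha_def A_entries)
  finally have "op_norm (A_alpha \<alpha> b) * op_norm (word_prod \<alpha> w) \<le> 3 * 3 ^ length w"
    using Cons.IH op_norm_nonneg by (intro mult_mono) auto
  with op_norm_mult_le[of "A_alpha \<alpha> b" "word_prod \<alpha> w"] show ?case
    by (simp add: word_prod_Cons)
qed

lemma best_root_bounds:
  assumes "\<alpha> \<in> {0..1}" shows "0 \<le> best_root \<alpha> n" "best_root \<alpha> n \<le> 3"
proof -
  obtain w where w: "length w = n" "best_root \<alpha> n = root n (op_norm (word_prod \<alpha> w))"
    using best_root_facts(2) by blast
  show "0 \<le> best_root \<alpha> n" unfolding w(2) using op_norm_nonneg by (simp add: real_root_ge_zero)
  show "best_root \<alpha> n \<le> 3"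
  proof (cases "n = 0")
    case False
    have "root n (op_norm (word_prod \<alpha> w)) \<le> root n (3 ^ n)"
      using op_norm_word_prod_le[OF assms, of w] False w(1) by (intro real_root_le_mono) auto
    thus ?thesis unfolding w(2) using False by (simp add: real_root_power_cancel)
  qed (simp add: w(2))
qed

text \<open>The roots lie between \<open>0\<close> and \<open>3\<close>, so the extended real limit superior is finite.\<close>

lemma ereal_jsr:
  assumes "\<alpha> \<in> {0..1}" shows "ereal (jsr \<alpha>) = limsup (\<lambda>n. ereal (best_root \<alpha> n))"
proof -
  have "limsup (\<lambda>n. ereal (best_root \<alpha> n)) \<le> ereal 3"
    using best_root_bounds[OF assms] by (intro Limsup_bounded) auto
  moreover have "ereal 0 \<le> limsup (\<lambda>n. ereal (best_root \<alpha> n))"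
    using best_root_bounds[OF assms] by (intro le_Limsup) auto
  ultimately have "\<bar>limsup (\<lambda>n. ereal (best_root \<alpha> n))\<bar> \<noteq> \<infinity>" by auto
  thus ?thesis unfolding jsr_def by (simp add: ereal_real')
qed

lemma jsr_le_lim:
  assumes "\<alpha> \<in> {0..1}" "eventually (\<lambda>n. best_root \<alpha> n \<le> u n) sequentially" "u \<longlonglongrightarrow> U"
  shows "jsr \<alpha> \<le> U"
proof -
  have "limsup (\<lambda>n. ereal (best_root \<alpha> n)) \<le> limsup (\<lambda>n. ereal (u n))"
    using assms(2) by (intro Limsup_mono) simp
  also have "\<dots> = ereal U" using assms(3) by (intro lim_imp_Limsup) auto
  finally show ?thesis by (simp flip: ereal_jsr[OF assms(1)])
qed

lemma lim_le_jsr: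
  assumes "\<alpha> \<in> {0..1}" "strict_mono f" "eventually (\<lambda>k. v k \<le> best_root \<alpha> (f k)) sequentially"
    "v \<longlonglongrightarrow> V"
  shows "V \<le> jsr \<alpha>"
proof -
  have "ereal V = limsup (\<lambda>k. ereal (v k))" using assms(4) by (intro lim_imp_Limsup[symmetric]) auto
  also have "\<dots> \<le> limsup ((\<lambda>n. ereal (best_root \<alpha> n)) \<circ> f)"
    using assms(3) by (intro Limsup_mono) simp
  also have "\<dots> \<le> limsup (\<lambda>n. ereal (best_root \<alpha> n))" by (rule limsup_subseq_mono[OF assms(2)])
  finally show ?thesis by (simp flip: ereal_jsr[OF assms(1)])
qed

text \<open>By submultiplicativity, cutting long words into blocks of length \<open>n\<close> shows that the largest
  norm \<open>V\<close> among the words of length \<open>n\<close> satisfies \<open>jsr \<alpha> \<le> V powr (1 / n)\<close>.\<close>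

lemma jsr_power_attained:
  assumes \<alpha>: "\<alpha> \<in> {0..1}"
  shows "\<exists>w. length w = n \<and> jsr \<alpha> ^ n \<le> mass \<alpha> w"
proof (cases "n = 0")
  case False
  define V where "V = Max ((\<lambda>w. op_norm (word_prod \<alpha> w)) ` {w. length w = n})"
  have fin: "finite ((\<lambda>w. op_norm (word_prod \<alpha> w)) ` {w. length w = n})" using finite_words by blast
  have rep: "replicate n False \<in> {w. length w = n}" by simp
  have V_ge: "op_norm (word_prod \<alpha> w) \<le> V" if "length w = n" for w
    unfolding V_def using that fin by (intro Max_ge) auto
  have "V \<in> (\<lambda>w. op_norm (word_prod \<alpha> w)) ` {w. length w = n}"
    unfolding V_def using rep by (intro Max_in fin) blast
  then obtain w0 where w0: "length w0 = n" "V = op_norm (word_prod \<alpha> w0)" by auto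
  have "1 \<le> word_prod \<alpha> (replicate n False) $ 1 $ 1"
    using word_prod_one_entries[of "replicate n False"] by (subst word_prod_scale) simp
  also have "\<dots> \<le> V" using V_ge[of "replicate n False"] entry_le_op_norm[of "word_prod \<alpha> (replicate n False)" 1 1] by simp
  finally have V1: "V \<ge> 1" .
  have blocks: "op_norm (word_prod \<alpha> w) \<le> V ^ k * 3 ^ n" if "length w = n * k + r" "r \<le> n" for w k r
    using that
  proof (induction k arbitrary: w)
    case 0
    have "op_norm (word_prod \<alpha> w) \<le> 3 ^ length w" by (rule op_norm_word_prod_le[OF \<alpha>])
    also have "\<dots> \<le> 3 ^ n" using 0 by (intro power_increasing) auto
    finally show ?case by simp
  next
    case (Suc k)
    have "op_norm (word_prod \<alpha> w) \<le> op_norm (word_prod \<alpha> (take n w)) * op_norm (word_prod \<alpha> (drop n w))"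
      using op_norm_word_prod_append[of \<alpha> "take n w" "drop n w"] by simp
    also have "\<dots> \<le> V * (V ^ k * 3 ^ n)"
      using Suc V1 by (intro mult_mono V_ge Suc.IH op_norm_nonneg) auto
    finally show ?case by simp
  qed
  define u where "u N = (V powr (1 / real n)) * (3 ^ n) powr (1 / real N)" for N
  have "jsr \<alpha> \<le> V powr (1 / real n)"
  proof (rule jsr_le_lim[OF \<alpha>])
    show "eventually (\<lambda>N. best_root \<alpha> N \<le> u N) sequentially"
      using eventually_gt_at_top[of 0]
    proof eventually_elim
      case (elim N)
      obtain w where w: "length w = N" "best_root \<alpha> N = root N (op_norm (word_prod \<alpha> w))"
        using best_root_facts(2) by blast
      define k where "k = N div n"
      have k: "real k \<le> real N / real n" unfolding k_def by (rule of_nat_div_le_of_nat)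
      have "op_norm (word_prod \<alpha> w) \<le> V ^ k * 3 ^ n"
        by (rule blocks[of w k "N mod n"]) (use w(1) False in \<open>auto simp: k_def\<close>)
      also have "V ^ k \<le> V powr (real N / real n)"
        using V1 k by (subst powr_realpow[symmetric]) (auto intro: powr_mono)
      finally have *: "op_norm (word_prod \<alpha> w) \<le> V powr (real N / real n) * 3 ^ n" by simp
      have "root N (op_norm (word_prod \<alpha> w)) = op_norm (word_prod \<alpha> w) powr (1 / real N)"
        using elim op_norm_nonneg by (rule root_powr_inverse)
      also have "\<dots> \<le> (V powr (real N / real n) * 3 ^ n) powr (1 / real N)"
        using * op_norm_nonneg by (intro powr_mono2) auto
      also have "\<dots> = u N" using elim V1 by (simp add: u_def powr_mult powr_powr)
      finally show ?case unfolding w(2) .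
    qed
    have "(\<lambda>N. 1 / real N) \<longlonglongrightarrow> 0" by (rule lim_1_over_n)
    hence "u \<longlonglongrightarrow> V powr (1 / real n) * (3 ^ n) powr 0" unfolding u_def
      by (intro tendsto_intros) auto
    thus "u \<longlonglongrightarrow> V powr (1 / real n)" by simp
  qed
  moreover have "0 \<le> jsr \<alpha>"
    by (rule lim_le_jsr[OF \<alpha> strict_mono_id, where v = "\<lambda>_. 0"])
      (use best_root_bounds[OF \<alpha>] in auto)
  ultimately have "jsr \<alpha> ^ n \<le> (V powr (1 / real n)) ^ n" by (intro power_mono)
  also have "\<dots> = V" using V1 False by (simp flip: powr_realpow add: powr_powr)
  also have "\<dots> \<le> mass \<alpha> w0" unfolding w0(2) mass_def
    using \<alpha> by (intro op_norm_le_entry_sum word_prod_nonneg) auto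
  finally show ?thesis using w0(1) by blast
qed (use \<alpha> in \<open>auto intro!: exI[of _ "[]"]\<close>)

text \<open>Repeating \<open>u01\<close> loses only a factor \<open>\<alpha>\<close> per repetition.\<close>

lemma mass_power_bridge:
  assumes "\<alpha> \<ge> 0"
  shows "mass \<alpha> (concat (replicate k (u @ [False, True])) @ v) \<ge> (\<alpha> * mass \<alpha> u) ^ k * mass \<alpha> v"
proof (induction k)
  case (Suc k)
  have "(\<alpha> * mass \<alpha> u) * ((\<alpha> * mass \<alpha> u) ^ k * mass \<alpha> v)
    \<le> (\<alpha> * mass \<alpha> u) * mass \<alpha> (concat (replicate k (u @ [False, True])) @ v)"
    using Suc.IH assms mass_nonneg by (intro mult_left_mono) auto
  also have "\<dots> \<le> mass \<alpha> (u @ [False, True] @ concat (replicate k (u @ [False, True])) @ v)"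
    by (rule mass_bridge[OF assms])
  finally show ?case by (simp add: mult_ac)
qed simp

text \<open>The powers of \<open>u01\<close> are words of length \<open>k * (length u + 2)\<close> with mass at least
  \<open>(\<alpha> * mass \<alpha> u) ^ k\<close>.\<close>

lemma mass_le_jsr_aux:
  assumes \<alpha>: "\<alpha> \<in> {0<..1}"
  shows "\<alpha> * mass \<alpha> u \<le> jsr \<alpha> ^ (length u + 2)"
proof -
  define N where "N = length u + 2"
  define s where "s = \<alpha> * mass \<alpha> u"
  have \<alpha>': "\<alpha> \<in> {0..1}" and s: "s > 0" using \<alpha> mass_pos[of \<alpha> u] by (auto simp: s_def)
  define v where "v k = s powr (1 / real N) * (1/2) powr (1 / real (N * Suc k))" for k
  have "s powr (1 / real N) \<le> jsr \<alpha>"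
  proof (rule lim_le_jsr[OF \<alpha>'])
    show "strict_mono (\<lambda>k. N * Suc k)" by (rule strict_monoI) (use N_def in \<open>simp only: mult_less_cancel1 Suc_less_eq\<close>, simp)
    have "v k \<le> best_root \<alpha> (N * Suc k)" for k
    proof -
      define w where "w = concat (replicate (Suc k) (u @ [False, True]))"
      have len: "length w = N * Suc k"
        by (simp add: w_def N_def length_concat sum_list_replicate)
      have "s ^ Suc k * 2 \<le> mass \<alpha> w"
        using mass_power_bridge[of \<alpha> u "Suc k" "[]"] \<alpha> unfolding s_def w_def by simp
      also have "\<dots> \<le> 4 * op_norm (word_prod \<alpha> w)" unfolding mass_def by (rule entry_sum_le_op_norm)
      finally have *: "s ^ Suc k * (1/2) \<le> op_norm (word_prod \<alpha> w)" by simp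
      have "v k = (s ^ Suc k * (1/2)) powr (1 / real (N * Suc k))"
      proof -
        have "(s ^ Suc k) powr (1 / real (N * Suc k)) = s powr (real (Suc k) * (1 / real (N * Suc k)))"
          using s by (simp only: powr_realpow[symmetric] powr_powr)
        also have "real (Suc k) * (1 / real (N * Suc k)) = 1 / real N"
          by (simp only: of_nat_mult) (simp add: field_simps del: of_nat_Suc)
        finally show ?thesis unfolding v_def powr_mult by simp
      qed
      also have "\<dots> \<le> op_norm (word_prod \<alpha> w) powr (1 / real (N * Suc k))"
        using * s by (intro powr_mono2) auto
      also have "\<dots> = root (N * Suc k) (op_norm (word_prod \<alpha> w))"
        using op_norm_nonneg by (subst root_powr_inverse) (auto simp: N_def)
      also have "\<dots> \<le> best_root \<alpha> (N * Suc k)" by (rule best_root_facts(1)[OF len])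
      finally show ?thesis .
    qed
    thus "eventually (\<lambda>k. v k \<le> best_root \<alpha> (N * Suc k)) sequentially" by simp
    have "(\<lambda>k. 1 / real (N * Suc k)) = (\<lambda>k. 1 / real N * inverse (real (Suc k)))"
      by (simp only: of_nat_mult) (simp add: divide_inverse del: of_nat_Suc)
    hence "(\<lambda>k. 1 / real (N * Suc k)) \<longlonglongrightarrow> 0"
      using tendsto_mult[OF tendsto_const[of "1 / real N"] LIMSEQ_inverse_real_of_nat] by simp
    hence "v \<longlonglongrightarrow> s powr (1 / real N) * (1/2) powr 0" unfolding v_def
      by (intro tendsto_intros) auto
    thus "v \<longlonglongrightarrow> s powr (1 / real N)" by simp
  qed
  hence "(s powr (1 / real N)) ^ N \<le> jsr \<alpha> ^ N" using s by (intro power_mono) auto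
  moreover have "(s powr (1 / real N)) ^ N = s"
    using s by (subst powr_realpow[symmetric]) (simp_all add: powr_powr N_def del: of_nat_Suc of_nat_add)
  ultimately show ?thesis by (simp add: s_def N_def)
qed

text \<open>Bounding the mass by this multiple of \<open>jsr \<alpha> ^ n\<close> is uniform as long as \<open>\<alpha>\<close> stays away
  from \<open>0\<close>.\<close>

definition upper_const :: "real \<Rightarrow> real" where
  "upper_const \<alpha> = jsr \<alpha> ^ 2 / \<alpha>"

lemma mass_le_jsr:
  assumes "\<alpha> \<in> {0<..1}" shows "mass \<alpha> w \<le> upper_const \<alpha> * jsr \<alpha> ^ length w"
  using mass_le_jsr_aux[OF assms, of w] assms
  by (simp add: upper_const_def field_simps power_add power2_eq_square)

lemma jsr_ge_1: assumes "\<alpha> \<in> {0..1}" shows "jsr \<alpha> \<ge> 1"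
proof (rule lim_le_jsr[OF assms strict_mono_id, where v = "\<lambda>_. 1"])
  show "eventually (\<lambda>n. 1 \<le> best_root \<alpha> (id n)) sequentially"
    using eventually_gt_at_top[of 0]
  proof eventually_elim
    case (elim n)
    have "1 \<le> word_prod \<alpha> (replicate n False) $ 1 $ 1"
      using word_prod_one_entries[of "replicate n False"] by (subst word_prod_scale) simp
    also have "\<dots> \<le> op_norm (word_prod \<alpha> (replicate n False))"
      using entry_le_op_norm[of "word_prod \<alpha> (replicate n False)" 1 1] by linarith
    finally have "1 \<le> root n (op_norm (word_prod \<alpha> (replicate n False)))"
      using elim by (simp add: real_root_ge_1_iff)
    also have "\<dots> \<le> best_root \<alpha> n" by (rule best_root_facts(1)) simp
    finally show ?case by simp
  qed
qed simp

text \<open>The mass of \<open>0\<^sup>k\<close> is \<open>k + 2\<close>, so \<open>\<alpha> * (k + 2) \<le> jsr \<alpha> ^ (k + 2)\<close> for all \<open>k\<close>.\<close>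

lemma jsr_gt_1: assumes "\<alpha> \<in> {0<..1}" shows "jsr \<alpha> > 1"
proof -
  obtain k :: nat where k: "real k > 1 / \<alpha>" using reals_Archimedean2 by blast
  have "1 < \<alpha> * mass \<alpha> (replicate k False)"
    using k assms by (simp add: mass_replicate field_simps)
  also have "\<dots> \<le> jsr \<alpha> ^ (k + 2)" using mass_le_jsr_aux[OF assms, of "replicate k False"] by simp
  finally have "jsr \<alpha> ^ (k + 2) > 1" .
  with jsr_ge_1[of \<alpha>] assms show ?thesis
    by (metis less_eq_real_def not_less_iff_gr_or_eq power_one atLeastAtMost_iff
        greaterThanAtMost_iff)
qed

lemma jsr_le_3: assumes "\<alpha> \<in> {0..1}" shows "jsr \<alpha> \<le> 3"
  using best_root_bounds[OF assms] by (intro jsr_le_lim[OF assms, where u = "\<lambda>_. 3"]) auto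

lemma upper_const_bounds:
  assumes "\<alpha> \<in> {0<..1}" shows "1 < upper_const \<alpha>" "upper_const \<alpha> \<le> 9 / \<alpha>"
proof -
  have "jsr \<alpha> ^ 2 > 1" using jsr_gt_1[OF assms] by (simp add: one_less_power)
  thus "1 < upper_const \<alpha>" using assms by (simp add: upper_const_def field_simps)
  have "jsr \<alpha> ^ 2 \<le> 3 ^ 2" using jsr_gt_1[OF assms] jsr_le_3[of \<alpha>] assms by (intro power_mono) auto
  thus "upper_const \<alpha> \<le> 9 / \<alpha>" using assms by (simp add: upper_const_def field_simps)
qed

lemma base_le_of_power_le:
  fixes a b C :: real
  assumes "a > 0" "b > 0" "\<And>n. a ^ n \<le> C * b ^ n"
  shows "a \<le> b"
proof (rule ccontr)
  assume "\<not> a \<le> b"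
  hence "a / b > 1" using assms by simp
  then obtain n where "C < (a / b) ^ n" using real_arch_pow by blast
  with assms(3)[of n] assms(1,2) show False by (simp add: power_divide field_simps)
qed

text \<open>Words that are optimal for one parameter are tested against the other parameter, here and in
  \<open>jsr_change_parameter\<close>.\<close>

lemma jsr_mono:
  assumes "0 < \<alpha>" "\<alpha> \<le> \<beta>" "\<beta> \<le> 1" shows "jsr \<alpha> \<le> jsr \<beta>"
proof (rule base_le_of_power_le)
  show "jsr \<alpha> > 0" "jsr \<beta> > 0" using jsr_gt_1[of \<alpha>] jsr_gt_1[of \<beta>] assms by auto
  fix n
  obtain w where w: "length w = n" "jsr \<alpha> ^ n \<le> mass \<alpha> w"
    using jsr_power_attained[of \<alpha> n] assms by auto
  have "mass \<alpha> w \<le> mass \<beta> w"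
    unfolding mass_scale[of \<alpha>] mass_scale[of \<beta>] using assms mass_one_ge_2[of w]
    by (intro mult_right_mono power_mono) auto
  also have "\<dots> \<le> upper_const \<beta> * jsr \<beta> ^ n" using mass_le_jsr[of \<beta> w] assms w(1) by auto
  finally show "jsr \<alpha> ^ n \<le> upper_const \<beta> * jsr \<beta> ^ n" using w(2) by linarith
qed

lemma mass_change_parameter:
  assumes "0 < \<alpha>" "\<alpha> \<le> \<beta>"
  shows "(\<alpha> / \<beta>) ^ length w * mass \<beta> w \<le> mass \<alpha> w"
proof -
  have "(\<alpha> / \<beta>) ^ length w \<le> (\<alpha> / \<beta>) ^ ones w"
    using assms ones_le_length by (intro power_decreasing) auto
  hence "(\<alpha> / \<beta>) ^ length w * mass \<beta> w \<le> (\<alpha> / \<beta>) ^ ones w * mass \<beta> w"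
    using assms mass_nonneg by (intro mult_right_mono) auto
  also have "\<dots> = mass \<alpha> w"
    using assms by (simp add: mass_scale[of \<alpha>] mass_scale[of \<beta>] power_divide)
  finally show ?thesis .
qed

lemma jsr_change_parameter:
  assumes "0 < \<alpha>" "\<alpha> \<le> \<beta>" "\<beta> \<le> 1" shows "\<alpha> / \<beta> * jsr \<beta> \<le> jsr \<alpha>"
proof (rule base_le_of_power_le)
  show "\<alpha> / \<beta> * jsr \<beta> > 0" "jsr \<alpha> > 0" using jsr_gt_1[of \<alpha>] jsr_gt_1[of \<beta>] assms by auto
  fix n
  obtain w where w: "length w = n" "jsr \<beta> ^ n \<le> mass \<beta> w"
    using jsr_power_attained[of \<beta> n] assms by auto
  have "(\<alpha> / \<beta> * jsr \<beta>) ^ n \<le> (\<alpha> / \<beta>) ^ n * mass \<beta> w"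
    unfolding power_mult_distrib using assms w by (intro mult_left_mono) auto
  also have "\<dots> \<le> mass \<alpha> w" using mass_change_parameter[of \<alpha> \<beta> w] assms w(1) by simp
  also have "\<dots> \<le> upper_const \<alpha> * jsr \<alpha> ^ n" using mass_le_jsr[of \<alpha> w] assms w(1) by auto
  finally show "(\<alpha> / \<beta> * jsr \<beta>) ^ n \<le> upper_const \<alpha> * jsr \<alpha> ^ n" .
qed

section \<open>Palindromes in unbalanced pairs of words\<close>

lemma first_difference:
  assumes "length s = length t" "s \<noteq> t"
  obtains q s' t' where "s = q @ [True] @ s'" "t = q @ [False] @ t'"
    | q s' t' where "s = q @ [False] @ s'" "t = q @ [True] @ t'"
proof -
  have "(\<exists>q s' t'. s = q @ [True] @ s' \<and> t = q @ [False] @ t')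
    \<or> (\<exists>q s' t'. s = q @ [False] @ s' \<and> t = q @ [True] @ t')"
    using assms
  proof (induction s t rule: list_induct2)
    case (Cons x xs y ys)
    show ?case
    proof (cases "x = y")
      case True
      with Cons.prems have "xs \<noteq> ys" by simp
      from Cons.IH[OF this] show ?thesis
      proof (elim disjE exE)
        fix q s' t' assume "xs = q @ [True] @ s' \<and> ys = q @ [False] @ t'"
        hence "x # xs = (x # q) @ [True] @ s' \<and> y # ys = (x # q) @ [False] @ t'" using True by simp
        thus ?thesis by blast
      next
        fix q s' t' assume "xs = q @ [False] @ s' \<and> ys = q @ [True] @ t'"
        hence "x # xs = (x # q) @ [False] @ s' \<and> y # ys = (x # q) @ [True] @ t'" using True by simp
        thus ?thesis by blast
      qed
    next
      case False
      show ?thesis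
      proof (cases x)
        case True
        hence "x # xs = [] @ [True] @ xs" "y # ys = [] @ [False] @ ys" using \<open>x \<noteq> y\<close> by auto
        thus ?thesis by blast
      next
        case False
        hence "x # xs = [] @ [False] @ xs" "y # ys = [] @ [True] @ ys" using \<open>x \<noteq> y\<close> by auto
        thus ?thesis by blast
      qed
    qed
  qed simp
  thus ?thesis using that by blast
qed

text \<open>Consider a pair of factors of \<open>u\<close> and \<open>v\<close> of minimal length that is unbalanced in this
  sense. By minimality it has the form \<open>0s0\<close>, \<open>1t1\<close> with as many ones in \<open>s\<close> as in \<open>t\<close>. If \<open>s\<close> and
  \<open>t\<close> differed, then at their first difference either the prefixes or the remaining suffixes would be
  a shorter unbalanced pair. If \<open>s\<close> were not a palindrome, the first difference of \<open>s\<close> and its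
  reversal would again give a shorter pair, made of a prefix and a suffix.\<close>

lemma unbalanced_palindrome:
  assumes "length u = length v" "ones u + 2 \<le> ones v"
  shows "\<exists>p. rev p = p \<and> sublist ([False] @ p @ [False]) u \<and> sublist ([True] @ p @ [True]) v"
  using assms
proof (induction "length u" arbitrary: u v rule: less_induct)
  case less
  show ?case
  proof (cases "\<exists>u' v'. length u' < length u \<and> sublist u' u \<and> sublist v' v \<and> length u' = length v'
      \<and> ones u' + 2 \<le> ones v'")
    case True
    then obtain u' v' where *: "length u' < length u" "sublist u' u" "sublist v' v" "length u' = length v'"
      "ones u' + 2 \<le> ones v'" by blast
    from less.hyps[OF *(1,4,5)] obtain p where "rev p = p" "sublist ([False] @ p @ [False]) u'"
      "sublist ([True] @ p @ [True]) v'" by blast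
    with *(2,3) show ?thesis by (meson sublist_order.order_trans)
  next
    case False
    \<comment> \<open>Otherwise \<open>u\<close>, \<open>v\<close> is itself a minimal unbalanced pair.\<close>
    hence minimal: "ones v' \<le> ones u' + 1"
      if "length u' < length u" "sublist u' u" "sublist v' v" "length u' = length v'" for u' v'
      using that by (metis add_2_eq_Suc' not_less_eq_eq Suc_eq_plus1)
    from less.prems(2) have "v \<noteq> []" by auto
    with less.prems(1) obtain x us y vs where uv: "u = x # us" "v = y # vs" "length us = length vs"
      by (cases u; cases v) auto
    have 1: "ones vs \<le> ones us + 1" by (rule minimal) (auto simp: uv sublist_Cons_right)
    with less.prems(2) uv have xy: "\<not> x" "y" "ones vs = ones us + 1" by (auto split: if_splits)
    hence "vs \<noteq> []" by auto
    with uv(3) obtain s x' t y' where st: "us = s @ [x']" "vs = t @ [y']" "length s = length t"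
      by (metis append_butlast_last_id length_0_conv length_append_singleton nat.inject)
    have "ones (y # t) \<le> ones (x # s) + 1"
      by (rule minimal) (auto simp: uv st sublist_def Cons_eq_append_conv)
    with xy st have xy': "\<not> x'" "y'" "ones s = ones t" by (auto split: if_splits)
    have u: "u = [False] @ s @ [False]" and v: "v = [True] @ t @ [True]" using uv xy st xy' by auto
    have no_pair: False if "sublist ([False] @ q @ [False]) u" "sublist ([True] @ q @ [True]) v"
      "length q < length s" for q
      using minimal[of "[False] @ q @ [False]" "[True] @ q @ [True]"] that u by auto
    have "s = t"
    proof (rule ccontr)
      assume "s \<noteq> t"
      with st(3) show False
      proof (cases rule: first_difference)
        case (1 q s' t')
        have "ones (t' @ [True]) \<le> ones (s' @ [False]) + 1"
        proof (rule minimal)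
          show "sublist (s' @ [False]) u" unfolding u 1 by (metis append_assoc sublist_appendI append_Nil2)
          show "sublist (t' @ [True]) v" unfolding v 1 by (metis append_assoc sublist_appendI append_Nil2)
        qed (use 1 st(3) u in auto)
        moreover have "ones s = ones t" by (rule xy')
        ultimately show False unfolding 1 by simp
      next
        case (2 q s' t')
        have "sublist ([False] @ q @ [False]) u" unfolding u 2
          by (metis append_assoc append_Nil sublist_appendI)
        moreover have "sublist ([True] @ q @ [True]) v" unfolding v 2
          by (metis append_assoc append_Nil sublist_appendI)
        ultimately show False by (rule no_pair) (simp add: 2)
      qed
    qed
    have "rev s = s"
    proof (rule ccontr)
      assume "rev s \<noteq> s"
      hence "length s = length (rev s)" "s \<noteq> rev s" by auto
      thus False
      proof (cases rule: first_difference)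
        case (1 q s' t')
        have s2: "s = rev t' @ [False] @ rev q" using arg_cong[OF 1(2), of rev] by simp
        have "sublist ([True] @ q @ [True]) v" unfolding v \<open>s = t\<close>[symmetric] 1(1)
          by (metis append_assoc append_Nil sublist_appendI)
        moreover have "sublist ([False] @ rev q @ [False]) u" unfolding u s2
          by (metis append_assoc append_Nil2 sublist_appendI)
        ultimately have "ones ([True] @ q @ [True]) \<le> ones ([False] @ rev q @ [False]) + 1"
          by (intro minimal) (use 1(1) u in auto)
        thus False by simp
      next
        case (2 q s' t')
        have s2: "s = rev t' @ [True] @ rev q" using arg_cong[OF 2(2), of rev] by simp
        have "sublist ([False] @ q @ [False]) u" unfolding u 2(1)
          by (metis append_assoc append_Nil sublist_appendI)
        moreover have "sublist ([True] @ rev q @ [True]) v" unfolding v \<open>s = t\<close>[symmetric] s2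
          by (metis append_assoc append_Nil2 sublist_appendI)
        ultimately have "ones ([True] @ rev q @ [True]) \<le> ones ([False] @ q @ [False]) + 1"
          by (intro minimal) (use 2(1) u in auto)
        thus False by simp
      qed
    qed
    with \<open>s = t\<close> u v show ?thesis by (metis sublist_order.order_refl)
  qed
qed

section \<open>Disjoint occurrences of a word\<close>

text \<open>Occurrences are exhibited as a decomposition of the word, which is the form in which factors
  get replaced later on; positions are only counted in \<open>disj_occ_of_card\<close>.\<close>

primrec disj_occ :: "nat \<Rightarrow> fin_word \<Rightarrow> fin_word \<Rightarrow> bool" where
  "disj_occ 0 a w \<longleftrightarrow> True"
| "disj_occ (Suc t) a w \<longleftrightarrow> (\<exists>g w'. w = g @ a @ w' \<and> disj_occ t a w')"

lemma disj_occ_prepend: "disj_occ t a w \<Longrightarrow> disj_occ t a (g @ w)"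
  by (cases t) (auto, metis append_assoc)

lemma disj_occ_mono: "disj_occ t a w \<Longrightarrow> s \<le> t \<Longrightarrow> disj_occ s a w"
proof (induction t arbitrary: w s)
  case (Suc t)
  then obtain h w' where *: "w = h @ a @ w'" "disj_occ t a w'" by auto
  show ?case
  proof (cases s)
    case (Suc s')
    with Suc.prems Suc.IH[OF *(2), of s'] * show ?thesis by auto
  qed simp
qed simp

lemma disj_occ_infix: "disj_occ t (x @ c @ y) w \<Longrightarrow> disj_occ t c w"
proof (induction t arbitrary: w)
  case (Suc t)
  then obtain h w' where "w = h @ (x @ c @ y) @ w'" "disj_occ t (x @ c @ y) w'" by auto
  hence "w = (h @ x) @ c @ (y @ w')" "disj_occ t c (y @ w')"
    using Suc.IH disj_occ_prepend by auto
  thus ?case unfolding disj_occ.simps by blast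
qed simp

lemma disj_occ_Suc_right: "disj_occ (Suc t) a w \<Longrightarrow> \<exists>w' g. w = w' @ a @ g \<and> disj_occ t a w'"
proof (induction t arbitrary: w)
  case (Suc t)
  then obtain h w1 where *: "w = h @ a @ w1" "disj_occ (Suc t) a w1"
    unfolding disj_occ.simps(2)[of "Suc t"] by blast
  from Suc.IH[OF *(2)] obtain w' g where "w1 = w' @ a @ g" "disj_occ t a w'" by blast
  with * have "w = (h @ a @ w') @ a @ g" "disj_occ (Suc t) a (h @ a @ w')" by auto
  thus ?case by blast
qed auto

lemma disj_occ_split:
  "disj_occ (s + t) a w \<Longrightarrow> \<exists>w1 w2. w = w1 @ w2 \<and> disj_occ s a w1 \<and> disj_occ t a w2"
proof (induction s arbitrary: w)
  case 0
  thus ?case by (intro exI[of _ "[]"] exI[of _ w]) auto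
next
  case (Suc s)
  then obtain h w' where *: "w = h @ a @ w'" "disj_occ (s + t) a w'" by auto
  from Suc.IH[OF *(2)] obtain w1 w2 where "w' = w1 @ w2" "disj_occ s a w1" "disj_occ t a w2" by blast
  with * have "w = (h @ a @ w1) @ w2" "disj_occ (Suc s) a (h @ a @ w1)" "disj_occ t a w2" by auto
  thus ?case by blast
qed

text \<open>At most one of the occurrences straddles the cut, hence the additional one.\<close>

lemma disj_occ_cut:
  "disj_occ (s + t + 1) a (w1 @ w2) \<Longrightarrow> disj_occ s a w1 \<or> disj_occ t a w2"
proof (induction s arbitrary: w1)
  case (Suc s)
  then obtain h w' where *: "w1 @ w2 = (h @ a) @ w'" "disj_occ (s + t + 1) a w'" by auto
  show ?case
  proof (cases "length (h @ a) \<le> length w1")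
    case True
    with *(1) obtain r where "w1 = (h @ a) @ r" "w' = r @ w2"
      by (auto simp: append_eq_append_conv2)
    with Suc.IH[of r] * show ?thesis by auto
  next
    case False
    have "w2 = (drop (length w1) h @ drop (length w1 - length h) a) @ w'"
      using arg_cong[OF *(1), of "drop (length w1)"] False by simp
    then obtain r where "w2 = r @ w'" by blast
    with disj_occ_prepend[OF disj_occ_mono[OF *(2), of t]] show ?thesis by auto
  qed
qed simp

text \<open>Among the starting positions of occurrences of a word, each one conflicts with fewer than its
  length many later ones.\<close>

lemma disj_occ_of_card:
  assumes "length a * t \<le> card {i. i + length a \<le> length w \<and> take (length a) (drop i w) = a}" "a \<noteq> []"
  shows "disj_occ t a w"
  using assms(1)
proof (induction t arbitrary: w)
  case (Suc t)
  define l where "l = length a"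
  define I where "I w = {i. i + l \<le> length w \<and> take l (drop i w) = a}" for w
  have fin: "finite (I w)" for w by (rule finite_subset[of _ "{..length w}"]) (auto simp: I_def)
  have l: "l > 0" using assms(2) by (simp add: l_def)
  have card: "l * Suc t \<le> card (I w)" using Suc.prems by (simp add: I_def l_def)
  with l have "I w \<noteq> {}" by (metis card.empty le_zero_eq mult_is_0 nat.distinct(1) neq0_conv)
  define i where "i = Min (I w)"
  have i: "i \<in> I w" unfolding i_def using fin \<open>I w \<noteq> {}\<close> by (rule Min_in)
  define w' where "w' = drop (i + l) w"
  have "I w \<subseteq> {i..<i+l} \<union> (\<lambda>j. j + (i + l)) ` I w'"
  proof
    fix j assume j: "j \<in> I w"
    have "i \<le> j" unfolding i_def using fin j by (rule Min_le)
    moreover have "j - (i + l) \<in> I w'" if "i + l \<le> j"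
      using that j by (auto simp: I_def w'_def)
    ultimately show "j \<in> {i..<i+l} \<union> (\<lambda>j. j + (i + l)) ` I w'"
      by (cases "i + l \<le> j") (auto intro!: image_eqI[of _ _ "j - (i + l)"])
  qed
  hence "card (I w) \<le> card ({i..<i+l} \<union> (\<lambda>j. j + (i + l)) ` I w')"
    by (intro card_mono) (use fin in auto)
  also have "\<dots> \<le> l + card (I w')"
    by (rule order_trans[OF card_Un_le]) (use card_image_le[OF fin, of _ w'] in auto)
  finally have "l * t \<le> card (I w')" using card by simp
  hence "disj_occ t a w'" using Suc.IH[of w'] by (simp add: I_def l_def)
  moreover have "w = take i w @ a @ w'"
  proof -
    have "take l (drop i w) @ drop l (drop i w) = drop i w" by (rule append_take_drop_id)
    hence "a @ w' = drop i w" using i by (simp add: I_def w'_def add.commute)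
    thus ?thesis by simp
  qed
  ultimately show ?case by auto
qed simp

section \<open>Reversing a factor\<close>

text \<open>A factor with both letters has a product without zero entries and hence decouples its
  neighbours.\<close>

definition mixed :: "fin_word \<Rightarrow> bool" where
  "mixed c \<longleftrightarrow> True \<in> set c \<and> False \<in> set c"

lemma mixed_entries:
  assumes "mixed c"
  shows "word_prod 1 c $1$1 \<ge> 1" "word_prod 1 c $1$2 \<ge> 1" "word_prod 1 c $2$1 \<ge> 1" "word_prod 1 c $2$2 \<ge> 1"
proof -
  have "word_prod 1 c $1$2 \<ge> 1" if "False \<in> set c"
    using that
  proof (induction c)
    case (Cons b c)
    thus ?case using word_prod_one_entries[of c]
      by (cases b) (auto simp: word_prod_Cons A_alpha_def mat2_mult_entries A_entries)
  qed simp
  moreover have "word_prod 1 c $2$1 \<ge> 1" if "True \<in> set c"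
    using that
  proof (induction c)
    case (Cons b c)
    thus ?case using word_prod_one_entries[of c]
      by (cases b) (auto simp: word_prod_Cons A_alpha_def mat2_mult_entries A_entries)
  qed simp
  ultimately show "word_prod 1 c $1$1 \<ge> 1" "word_prod 1 c $1$2 \<ge> 1" "word_prod 1 c $2$1 \<ge> 1"
    "word_prod 1 c $2$2 \<ge> 1"
    using assms word_prod_one_entries[of c] by (auto simp: mixed_def)
qed

text \<open>This is \<open>- A0 ** D ** A1\<close>, where \<open>D\<close> is the diagonal matrix with entries \<open>1\<close> and \<open>- 1\<close>.\<close>

definition swap_mat :: mat2 where
  "swap_mat = vector [vector [0, 1], vector [1, 1]]"

lemma swap_mat_entries:
  "swap_mat$1$1 = 0" "swap_mat$1$2 = 1" "swap_mat$2$1 = 1" "swap_mat$2$2 = 1"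
  by (simp_all add: swap_mat_def)

text \<open>Let \<open>Q\<close> be the product along \<open>p0m1p\<close>. Its reversal has the diagonal entries exchanged, so the
  two differ by \<open>d\<close> times the diagonal matrix with entries \<open>1\<close> and \<open>- 1\<close>, where \<open>d\<close> is the
  difference of the diagonal entries of \<open>Q\<close>. As the product along the palindrome \<open>p\<close> has equal
  diagonal entries and determinant one, \<open>d\<close> does not change when both copies of \<open>p\<close> are removed;
  for \<open>0m1\<close> it is the sum of three entries of the product along \<open>m\<close>.\<close>

lemma word_prod_reverse_factor:
  assumes "rev p = p"
  shows "word_prod 1 ([False] @ p @ [True] @ rev m @ [False] @ p @ [True]) =
    word_prod 1 ([False] @ p @ [False] @ m @ [True] @ p @ [True]) +
    (word_prod 1 m $1$1 + word_prod 1 m $1$2 + word_prod 1 m $2$1) *\<^sub>R swap_mat"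
proof -
  define w y z where "w = word_prod 1 p $1$1" and "y = word_prod 1 p $1$2" and "z = word_prod 1 p $2$1"
  have p: "word_prod 1 p $1$1 = w" "word_prod 1 p $1$2 = y" "word_prod 1 p $2$1 = z" "word_prod 1 p $2$2 = w"
    using word_prod_rev_entries(1)[of 1 p] assms by (simp_all add: w_def y_def z_def)
  have det: "w * w = 1 + y * z" using word_prod_one_entries(5)[of p] p by simp
  have det': "w * (w * x) = x + y * (z * x)" for x
    by (simp add: det flip: mult.assoc) (simp add: algebra_simps)
  show ?thesis
    by (rule mat2_eqI)
      (simp_all add: word_prod_append word_prod_Cons A_alpha_def mat2_mult_entries A_entries
        word_prod_rev_entries p swap_mat_entries algebra_simps det det')
qed

lemma mass_append3: "mass \<alpha> (u @ v @ w) = entry_sum (word_prod \<alpha> u ** word_prod \<alpha> v ** word_prod \<alpha> w)"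
  by (simp add: mass_def word_prod_append matrix_mul_assoc)

text \<open>The contexts \<open>c1\<close> and \<open>d2\<close> make \<open>swap_mat\<close> decouple \<open>x\<close> from \<open>y\<close>, and \<open>c2\<close> and \<open>d1\<close> bound
  the coefficient of \<open>swap_mat\<close> from below by the mass of \<open>m\<close>. Without them the relative gain could be
  arbitrarily small.\<close>

lemma mass_reverse_factor:
  assumes pal: "rev p = p" and mixed: "mixed c1" "mixed c2" "mixed d1" "mixed d2"
  shows "mass 1 (x @ (c1 @ [False] @ p @ [False] @ c2) @ m @ (d1 @ [True] @ p @ [True] @ d2) @ y)
      + mass 1 x * mass 1 m * mass 1 y
    \<le> mass 1 (x @ (c1 @ [False] @ p @ [True] @ rev (c2 @ m @ d1) @ [False] @ p @ [True] @ d2) @ y)"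
proof -
  define k where "k = word_prod 1 (c2 @ m @ d1) $1$1 + word_prod 1 (c2 @ m @ d1) $1$2
    + word_prod 1 (c2 @ m @ d1) $2$1"
  let ?B = "word_prod 1"
  define S where "S = ?B ([False] @ p @ [True] @ rev (c2 @ m @ d1) @ [False] @ p @ [True])"
  define R where "R = ?B ([False] @ p @ [False] @ (c2 @ m @ d1) @ [True] @ p @ [True])"
  have SR: "S = R + k *\<^sub>R swap_mat" unfolding S_def R_def k_def by (rule word_prod_reverse_factor[OF pal])
  have k: "k \<ge> mass 1 m"
  proof -
    note c = mixed_entries[OF mixed(2)] and d = mixed_entries[OF mixed(3)] and m = word_prod_one_entries[of m]
    have "entry_sum (?B m) \<le> (?B c2 ** ?B m ** ?B d1) $1$1"
    proof -
      have "(?B c2 ** ?B m ** ?B d1) $1$1 = ?B m $1$1 * (?B c2 $1$1 * ?B d1 $1$1)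
        + ?B m $1$2 * (?B c2 $1$1 * ?B d1 $2$1) + ?B m $2$1 * (?B c2 $1$2 * ?B d1 $1$1)
        + ?B m $2$2 * (?B c2 $1$2 * ?B d1 $2$1)"
        by (simp add: mat2_mult_entries algebra_simps)
      also have "\<dots> \<ge> ?B m $1$1 * (1 * 1) + ?B m $1$2 * (1 * 1) + ?B m $2$1 * (1 * 1) + ?B m $2$2 * (1 * 1)"
        using c d m by (intro add_mono mult_mono) auto
      finally show ?thesis by (simp add: entry_sum_def)
    qed
    moreover have "?B (c2 @ m @ d1) = ?B c2 ** ?B m ** ?B d1" by (simp add: word_prod_append matrix_mul_assoc)
    ultimately show ?thesis
      using word_prod_one_entries(3,4)[of "c2 @ m @ d1"] by (simp add: k_def mass_def)
  qed
  have dist: "entry_sum (X ** (R + k *\<^sub>R swap_mat) ** Y) = entry_sum (X ** R ** Y) + k * entry_sum (X ** swap_mat ** Y)"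
    for X Y by (simp add: entry_sum_def mat2_mult_entries algebra_simps)
  have old: "mass 1 (x @ (c1 @ [False] @ p @ [False] @ c2) @ m @ (d1 @ [True] @ p @ [True] @ d2) @ y)
    = entry_sum (?B (x @ c1) ** R ** ?B (d2 @ y))"
    using mass_append3[of 1 "x @ c1" "[False] @ p @ [False] @ (c2 @ m @ d1) @ [True] @ p @ [True]" "d2 @ y"]
    by (simp add: R_def)
  have new: "mass 1 (x @ (c1 @ [False] @ p @ [True] @ rev (c2 @ m @ d1) @ [False] @ p @ [True] @ d2) @ y)
    = entry_sum (?B (x @ c1) ** S ** ?B (d2 @ y))"
    using mass_append3[of 1 "x @ c1" "[False] @ p @ [True] @ rev (c2 @ m @ d1) @ [False] @ p @ [True]" "d2 @ y"]
    by (simp add: S_def)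
  have "mass 1 x * mass 1 y \<le> entry_sum (?B x ** (?B c1 ** swap_mat ** ?B d2) ** ?B y)"
    using entry_sum_decouple[of "?B x" "?B y" 1 "?B c1 ** swap_mat ** ?B d2"] mixed_entries[OF mixed(1)]
      mixed_entries[OF mixed(4)] word_prod_nonneg[of 1]
      mult_mono[of 1 "?B c1 $ 1 $ 2" 1 "?B d2 $ 1 $ 1"] mult_mono[of 1 "?B c1 $ 1 $ 2" 1 "?B d2 $ 1 $ 2"]
      mult_mono[of 1 "?B c1 $ 2 $ 2" 1 "?B d2 $ 1 $ 1"] mult_mono[of 1 "?B c1 $ 2 $ 2" 1 "?B d2 $ 1 $ 2"]
    by (simp add: mat2_mult_entries swap_mat_entries mass_def ring_distribs add_nonneg_nonneg
        add_increasing add_increasing2)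
  also have "\<dots> = entry_sum (?B (x @ c1) ** swap_mat ** ?B (d2 @ y))"
    by (simp add: matrix_mul_assoc word_prod_append)
  finally have "mass 1 m * (mass 1 x * mass 1 y) \<le> k * entry_sum (?B (x @ c1) ** swap_mat ** ?B (d2 @ y))"
    using k mass_nonneg[of 1 m] mass_nonneg[of 1 x] mass_nonneg[of 1 y] by (intro mult_mono) auto
  thus ?thesis unfolding old new SR dist by (simp add: mult_ac)
qed

text \<open>The letter \<open>e\<close> covers both orders of the two palindromic factors; the case \<open>e = True\<close> is
  obtained from the other one by exchanging the letters.\<close>

definition conflicting :: "fin_word \<Rightarrow> fin_word \<Rightarrow> bool" where
  "conflicting a b \<longleftrightarrow> (\<exists>e p c1 c2 d1 d2. rev p = p \<and> mixed c1 \<and> mixed c2 \<and> mixed d1 \<and> mixed d2 \<and>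
     a = c1 @ [e] @ p @ [e] @ c2 \<and> b = d1 @ [\<not> e] @ p @ [\<not> e] @ d2)"

lemma conflicting_sym: assumes "conflicting a b" shows "conflicting b a"
proof -
  from assms obtain e p c1 c2 d1 d2 where *: "rev p = p" "mixed c1" "mixed c2" "mixed d1" "mixed d2"
     "a = c1 @ [e] @ p @ [e] @ c2" "b = d1 @ [\<not> e] @ p @ [\<not> e] @ d2"
    unfolding conflicting_def by blast
  hence "b = d1 @ [\<not> e] @ p @ [\<not> e] @ d2 \<and> a = c1 @ [\<not> \<not> e] @ p @ [\<not> \<not> e] @ c2" by simp
  with *(1-5) show ?thesis unfolding conflicting_def by blast
qed

lemma mixed_map_Not: "mixed (map Not c) \<longleftrightarrow> mixed c"
  by (auto simp: mixed_def image_iff)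

lemma conflicting_gain_aux:
  fixes e :: bool
  assumes "rev p = p" "mixed c1" "mixed c2" "mixed d1" "mixed d2"
  defines "a \<equiv> c1 @ [e] @ p @ [e] @ c2" and "b \<equiv> d1 @ [\<not> e] @ p @ [\<not> e] @ d2"
  shows "\<exists>m'. length m' = length (a @ m @ b) \<and> ones m' = ones (a @ m @ b) \<and>
     mass 1 (x @ a @ m @ b @ y) + mass 1 x * mass 1 m * mass 1 y \<le> mass 1 (x @ m' @ y)"
proof -
  define m' where "m' = c1 @ [e] @ p @ [\<not> e] @ rev (c2 @ m @ d1) @ [e] @ p @ [\<not> e] @ d2"
  have "mass 1 (x @ a @ m @ b @ y) + mass 1 x * mass 1 m * mass 1 y \<le> mass 1 (x @ m' @ y)"
  proof (cases e)
    case False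
    thus ?thesis using mass_reverse_factor[OF assms(1-5), of x m y] by (simp add: a_def b_def m'_def)
  next
    case True
    let ?n = "map Not"
    have "rev (?n p) = ?n p" using assms(1) by (simp add: rev_map)
    from mass_reverse_factor[OF this, of "?n c1" "?n c2" "?n d1" "?n d2" "?n x" "?n m" "?n y"]
    have "mass 1 (?n (x @ a @ m @ b @ y)) + mass 1 (?n x) * mass 1 (?n m) * mass 1 (?n y)
      \<le> mass 1 (?n (x @ m' @ y))"
      using True assms(2-5) by (simp add: a_def b_def m'_def mixed_map_Not rev_map)
    thus ?thesis unfolding mass_one_Not .
  qed
  moreover have "length m' = length (a @ m @ b)" "ones m' = ones (a @ m @ b)"
    by (simp_all add: m'_def a_def b_def)
  ultimately show ?thesis by blast
qed

text \<open>The mass of a word containing \<open>a\<close> and \<open>b\<close> is at most \<open>mass a * mass b\<close> times the product of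
  the masses of the three remaining pieces, and a reversal gains at least that product.\<close>

definition gain :: "fin_word \<Rightarrow> fin_word \<Rightarrow> real" where
  "gain a b = 1 + 1 / (mass 1 a * mass 1 b)"

lemma gain_gt_1: "gain a b > 1"
  using mass_pos[of 1 a] mass_pos[of 1 b] by (simp add: gain_def)

lemma conflicting_gain:
  assumes "conflicting a b"
  shows "\<exists>m'. length m' = length (a @ m @ b) \<and> ones m' = ones (a @ m @ b) \<and>
     gain a b * mass 1 (x @ a @ m @ b @ y) \<le> mass 1 (x @ m' @ y)"
proof -
  obtain m' where m': "length m' = length (a @ m @ b)" "ones m' = ones (a @ m @ b)"
     "mass 1 (x @ a @ m @ b @ y) + mass 1 x * mass 1 m * mass 1 y \<le> mass 1 (x @ m' @ y)"
    using assms conflicting_gain_aux unfolding conflicting_def by metis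
  note nn = mass_nonneg[of 1, simplified]
  have "mass 1 (x @ a @ m @ b @ y) \<le> mass 1 x * (mass 1 a * (mass 1 m * (mass 1 b * mass 1 y)))"
    using nn by (intro order_trans[OF mass_append_le] mult_left_mono) auto
  hence "mass 1 (x @ a @ m @ b @ y) / (mass 1 a * mass 1 b) \<le> mass 1 x * mass 1 m * mass 1 y"
    using mass_pos[of 1 a] mass_pos[of 1 b] by (simp add: field_simps)
  hence "gain a b * mass 1 (x @ a @ m @ b @ y) \<le> mass 1 (x @ m' @ y)"
    using m'(3) by (simp add: gain_def algebra_simps)
  with m'(1,2) show ?thesis by blast
qed

text \<open>Reverse between the last \<open>a\<close> of \<open>u\<close> and the first \<open>b\<close> of \<open>v\<close>: this only affects the part
  in the middle and leaves the outer occurrences intact.\<close>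

lemma conflicting_gain_iterated:
  assumes "conflicting a b" "disj_occ t a u" "disj_occ t b v"
  shows "\<exists>z. length z = length (u @ m @ v) \<and> ones z = ones (u @ m @ v) \<and>
    gain a b ^ t * mass 1 (u @ m @ v) \<le> mass 1 z"
  using assms(2,3)
proof (induction t arbitrary: u m v)
  case 0
  show ?case by (rule exI[of _ "u @ m @ v"]) simp
next
  case (Suc t)
  from disj_occ_Suc_right[OF Suc.prems(1)] obtain u' g where u: "u = u' @ a @ g" "disj_occ t a u'" by blast
  from Suc.prems(2) obtain h v' where v: "v = h @ b @ v'" "disj_occ t b v'" by auto
  obtain m' where m': "length m' = length (a @ (g @ m @ h) @ b)" "ones m' = ones (a @ (g @ m @ h) @ b)"
    "gain a b * mass 1 (u' @ a @ (g @ m @ h) @ b @ v') \<le> mass 1 (u' @ m' @ v')"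
    using conflicting_gain[OF assms(1)] by blast
  obtain z where z: "length z = length (u' @ m' @ v')" "ones z = ones (u' @ m' @ v')"
    "gain a b ^ t * mass 1 (u' @ m' @ v') \<le> mass 1 z"
    using Suc.IH[OF u(2) v(2)] by blast
  have "gain a b ^ Suc t * mass 1 (u @ m @ v) = gain a b ^ t * (gain a b * mass 1 (u' @ a @ (g @ m @ h) @ b @ v'))"
    by (simp add: u v)
  also have "\<dots> \<le> gain a b ^ t * mass 1 (u' @ m' @ v')"
    using m'(3) gain_gt_1[of a b] by (intro mult_left_mono) auto
  also note z(3)
  finally show ?case using z(1,2) m'(1,2) by (intro exI[of _ z]) (simp add: u v)
qed

lemma conflicting_cost:
  assumes \<alpha>: "\<alpha> \<in> {0<..1}" and "conflicting a b" "disj_occ t a u" "disj_occ t b v"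
  shows "gain a b ^ t * mass \<alpha> (u @ v) \<le> upper_const \<alpha> * jsr \<alpha> ^ length (u @ v)"
proof -
  obtain z where z: "length z = length (u @ v)" "ones z = ones (u @ v)"
    "gain a b ^ t * mass 1 (u @ v) \<le> mass 1 z"
    using conflicting_gain_iterated[OF assms(2-4), of "[]"] by auto
  have "gain a b ^ t * mass \<alpha> (u @ v) = \<alpha> ^ ones (u @ v) * (gain a b ^ t * mass 1 (u @ v))"
    by (subst mass_scale) simp
  also have "\<dots> \<le> \<alpha> ^ ones (u @ v) * mass 1 z" using z(3) \<alpha> by (intro mult_left_mono) auto
  also have "\<dots> = mass \<alpha> z" by (subst (2) mass_scale) (simp add: z(2))
  also have "\<dots> \<le> upper_const \<alpha> * jsr \<alpha> ^ length (u @ v)"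
    using mass_le_jsr[OF \<alpha>, of z] z(1) by simp
  finally show ?thesis .
qed

text \<open>The mass of a run grows only linearly in its length, whereas \<open>jsr \<alpha> > 1\<close>. A run of suitable
  length therefore costs a factor two.\<close>

lemma run_cost:
  assumes \<alpha>: "\<alpha> \<in> {0<..1}"
  shows "\<exists>M\<ge>1. \<forall>b t w. disj_occ t (replicate M b) w \<longrightarrow> 2 ^ t * mass \<alpha> w \<le> upper_const \<alpha> * jsr \<alpha> ^ length w"
proof -
  define c where "c = upper_const \<alpha>"
  define r where "r = jsr \<alpha>"
  have r: "r > 1" and c: "c > 1" using jsr_gt_1[OF \<alpha>] upper_const_bounds[OF \<alpha>] by (auto simp: r_def c_def)
  have "(\<lambda>M. 2 * c * (real M + 2) / r ^ M) \<longlonglongrightarrow> 0" using r by real_asymp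
  hence "eventually (\<lambda>M. 2 * c * (real M + 2) / r ^ M < 1) sequentially"
    by (rule order_tendstoD) simp
  hence "eventually (\<lambda>M. M \<ge> 1 \<and> 2 * c * (real M + 2) / r ^ M < 1) sequentially"
    using eventually_ge_at_top[of 1] by eventually_elim simp
  then obtain M where M: "M \<ge> 1" "2 * c * (real M + 2) / r ^ M < 1"
    by (auto simp: eventually_sequentially)
  hence M2: "2 * c * (real M + 2) \<le> r ^ M" using r by (simp add: field_simps)
  have "2 ^ t * mass \<alpha> w \<le> c * r ^ length w" if "disj_occ t (replicate M b) w" for b t w
    using that
  proof (induction t arbitrary: w)
    case 0
    thus ?case using mass_le_jsr[OF \<alpha>, of w] by (simp add: c_def r_def)
  next
    case (Suc t)
    then obtain g w' where w: "w = g @ replicate M b @ w'" "disj_occ t (replicate M b) w'" by auto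
    note nn = mass_nonneg[of \<alpha>]
    have rep: "mass \<alpha> (replicate M b) \<le> real M + 2"
      using \<alpha> by (auto simp: mass_replicate intro!: mult_left_le_one_le power_le_one)
    have "mass \<alpha> w \<le> mass \<alpha> g * (mass \<alpha> (replicate M b) * mass \<alpha> w')"
      unfolding w(1) using nn \<alpha> by (intro order_trans[OF mass_append_le] mult_left_mono) auto
    also have "\<dots> \<le> (c * r ^ length g) * ((real M + 2) * mass \<alpha> w')"
      using nn \<alpha> rep mass_le_jsr[OF \<alpha>, of g] c r
      by (intro mult_mono mult_nonneg_nonneg) (auto simp: c_def r_def)
    finally have "2 ^ Suc t * mass \<alpha> w \<le> 2 ^ Suc t * ((c * r ^ length g) * ((real M + 2) * mass \<alpha> w'))"
      by (intro mult_left_mono) auto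
    also have "\<dots> = (2 * c * (real M + 2)) * r ^ length g * (2 ^ t * mass \<alpha> w')" by (simp add: mult_ac)
    also have "\<dots> \<le> r ^ M * r ^ length g * (c * r ^ length w')"
      by (rule mult_mono[OF mult_mono[OF M2 order_refl] Suc.IH[OF w(2)]]) (use r nn[of w'] \<alpha> in auto)
    also have "\<dots> = c * r ^ length w" by (simp add: w(1) power_add mult_ac)
    finally show ?case .
  qed
  with M(1) show ?thesis unfolding c_def r_def by blast
qed

section \<open>Typical windows of nearly extremal words\<close>

definition near_extremal :: "real \<Rightarrow> real \<Rightarrow> fin_word \<Rightarrow> bool" where
  "near_extremal \<epsilon> \<alpha> w \<longleftrightarrow> exp (- \<epsilon> * real (length w)) * jsr \<alpha> ^ length w \<le> mass \<alpha> w"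

text \<open>The number \<open>t\<close> of disjoint conflicting pairs that contradicts near-extremality is a small
  proportion of the length.\<close>

lemma exponential_threshold:
  fixes q c \<epsilon> :: real
  assumes "q > 1" "c > 0" "\<epsilon> > 0"
  shows "\<exists>\<epsilon>'>0. \<exists>n0. \<forall>n\<ge>n0. \<exists>t. c < q ^ t * exp (- \<epsilon>' * real n) \<and> real t \<le> \<epsilon> * real n"
proof -
  define d where "d = \<epsilon> * ln q / 2"
  have d: "d > 0" using assms by (simp add: d_def)
  obtain n0 :: nat where n0: "real n0 > (ln c + ln q) / d" using reals_Archimedean2 by blast
  show ?thesis
  proof (rule exI[of _ d], rule conjI, rule d, rule exI[of _ n0], intro allI impI)
    fix n assume n: "n \<ge> n0"
    define t where "t = nat \<lfloor>\<epsilon> * real n\<rfloor>"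
    have t: "real t \<le> \<epsilon> * real n" "\<epsilon> * real n - 1 \<le> real t"
      using assms(3) by (auto simp: t_def)
    have "(ln c + ln q) / d < real n" using n n0 by linarith
    hence "ln c + ln q < d * real n" using d by (simp add: field_simps)
    also have "\<dots> = (\<epsilon> * real n) * ln q - d * real n" by (simp add: d_def algebra_simps)
    also have "\<dots> \<le> (real t + 1) * ln q - d * real n"
      using t assms(1) by (intro diff_right_mono mult_right_mono) auto
    finally have "ln c < real t * ln q - d * real n" by (simp add: algebra_simps)
    hence "c < exp (real t * ln q - d * real n)" using assms(2) by (metis exp_less_cancel_iff exp_ln)
    also have "\<dots> = q ^ t * exp (- d * real n)"
      using assms(1) by (simp add: exp_diff exp_minus field_simps exp_of_nat_mult)
    finally show "\<exists>t. c < q ^ t * exp (- d * real n) \<and> real t \<le> \<epsilon> * real n" using t(1) by blast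
  qed
qed

lemma card_words: "card {w :: bool list. length w = n} = 2 ^ n"
  using card_lists_length_eq[of "UNIV :: bool set" n] by simp

lemma not_mixed_replicate: "\<not> mixed c \<Longrightarrow> \<exists>b. c = replicate (length c) b"
  unfolding mixed_def by (metis (full_types) replicate_length_same)

definition mutually_balanced :: "fin_word set \<Rightarrow> bool" where
  "mutually_balanced G \<longleftrightarrow> (\<forall>g\<in>G. \<forall>h\<in>G. \<forall>u v. sublist u g \<and> sublist v h \<and> length u = length v \<longrightarrow>
     ones v \<le> ones u + 1)"

definition bad_windows :: "nat \<Rightarrow> fin_word set \<Rightarrow> fin_word \<Rightarrow> nat set" where
  "bad_windows L G w = {i. i + L \<le> length w \<and> take L (drop i w) \<notin> G}"

lemma finite_bad_windows [simp]: "finite (bad_windows L G w)"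
  by (rule finite_subset[of _ "{..length w}"]) (auto simp: bad_windows_def)

text \<open>Extend windows of length \<open>L\<close> by \<open>M\<close> letters on either side. A word of the extended length \<open>K\<close>
  is common if it has \<open>2 * t + 1\<close> disjoint occurrences in \<open>w\<close>. A common word has no run of length
  \<open>M\<close> at its ends, as runs are costly. Two common words do not conflict: cut \<open>w\<close> after \<open>t\<close>
  occurrences of the first, then \<open>t\<close> occurrences of the second lie on one side of the cut, and \<open>t\<close>
  occurrences of the first on the other. So the central parts of the common words are mutually
  balanced. There are at most \<open>2 ^ K\<close> words that are not common, each occurring at few positions.\<close>

lemma typical_windows:
  assumes \<alpha>: "\<alpha> \<in> {0<..1}" and \<epsilon>: "\<epsilon> > 0"
  shows "\<exists>\<epsilon>'>0. \<exists>n0. \<forall>w. n0 \<le> length w \<longrightarrow> near_extremal \<epsilon>' \<alpha> w \<longrightarrow>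
    (\<exists>G. (\<forall>g\<in>G. length g = L) \<and> mutually_balanced G \<and>
      real (card (bad_windows L G w)) \<le> \<epsilon> * real (length w))"
proof -
  define c where "c = upper_const \<alpha>"
  define \<rho> where "\<rho> = jsr \<alpha>"
  have \<rho>: "\<rho> > 1" and c: "c > 1" using jsr_gt_1[OF \<alpha>] upper_const_bounds[OF \<alpha>] by (auto simp: \<rho>_def c_def)
  obtain M where M: "M \<ge> 1" "\<And>b t w. disj_occ t (replicate M b) w \<Longrightarrow> 2 ^ t * mass \<alpha> w \<le> c * \<rho> ^ length w"
    using run_cost[OF \<alpha>] unfolding c_def \<rho>_def by blast
  define K where "K = L + 2 * M"
  \<comment> \<open>A lower bound for the gain of any pair of words of length \<open>K\<close>, also below the factor of runs.\<close>
  define q :: real where "q = 1 + 1 / (2 * 2 ^ K)\<^sup>2"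
  have q1: "q > 1" by (simp add: q_def)
  have "(1 :: real) \<le> 2 ^ K" by simp
  hence "(1 :: real) \<le> 2 * 2 ^ K" by linarith
  hence "(1 :: real) \<le> (2 * 2 ^ K)\<^sup>2" by (rule one_le_power)
  hence q2: "q \<le> 2" by (simp add: q_def)
  have q_gain: "q \<le> gain a b" if "length a = K" "length b = K" for a b
  proof -
    have "mass 1 a * mass 1 b \<le> (2 * 2 ^ K) * (2 * 2 ^ K)"
      using mass_one_le[of a] mass_one_le[of b] that mass_nonneg[of 1] by (intro mult_mono) auto
    thus ?thesis using mass_pos[of 1 a] mass_pos[of 1 b]
      by (simp add: q_def gain_def power2_eq_square frac_le)
  qed
  define \<epsilon>2 where "\<epsilon>2 = \<epsilon> / (4 * 2 ^ K * real K)"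
  have K: "K \<ge> 2" using M(1) by (simp add: K_def)
  hence \<epsilon>2: "\<epsilon>2 > 0" using \<epsilon> by (simp add: \<epsilon>2_def)
  have c0: "c > 0" using c by simp
  from exponential_threshold[OF q1 c0 \<epsilon>2] obtain \<epsilon>' n0 where \<epsilon>': "\<epsilon>' > 0"
    and n0: "\<And>n. n \<ge> n0 \<Longrightarrow> \<exists>t. c < q ^ t * exp (- \<epsilon>' * real n) \<and> real t \<le> \<epsilon>2 * real n"
    by blast
  obtain n1 :: nat where n1: "real n1 > (2 ^ K * real K + 2 * real M) / (\<epsilon> / 2)" using reals_Archimedean2 by blast
  have main: "\<exists>G. (\<forall>g\<in>G. length g = L) \<and> mutually_balanced G \<and>
      real (card (bad_windows L G w)) \<le> \<epsilon> * real (length w)"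
    if len: "max n0 n1 \<le> length w" and near: "near_extremal \<epsilon>' \<alpha> w" for w
  proof -
    define n where "n = length w"
    obtain t where t: "c < q ^ t * exp (- \<epsilon>' * real n)" "real t \<le> \<epsilon>2 * real n"
      using n0[of n] len by (auto simp: n_def)
    have too_big: False if "s \<ge> q" "s ^ t * mass \<alpha> w \<le> c * \<rho> ^ n" for s
    proof -
      have "q ^ t * (exp (- \<epsilon>' * real n) * \<rho> ^ n) \<le> s ^ t * mass \<alpha> w"
        using near that(1) q1 unfolding near_extremal_def \<rho>_def n_def
        by (intro mult_mono power_mono) (use \<rho> in \<open>auto simp: \<rho>_def\<close>)
      also note that(2)
      finally have "(q ^ t * exp (- \<epsilon>' * real n)) * \<rho> ^ n \<le> c * \<rho> ^ n" by (simp add: mult_ac)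
      hence "q ^ t * exp (- \<epsilon>' * real n) \<le> c" using \<rho> by simp
      with t(1) show False by linarith
    qed
    define common where "common = {a. length a = K \<and> disj_occ (t + t + 1) a w}"
    have mixed_ctx: "mixed c'" if c': "disj_occ (t + t + 1) c' w" "length c' = M" for c'
    proof (rule ccontr)
      assume "\<not> mixed c'"
      then obtain b where "c' = replicate M b" using not_mixed_replicate c'(2) by metis
      with c'(1) have "disj_occ t (replicate M b) w" by (auto intro: disj_occ_mono simp del: disj_occ.simps)
      from M(2)[OF this] too_big[OF q2] show False by (simp add: n_def)
    qed
    have common_ctx: "\<exists>c1 c2. mixed c1 \<and> mixed c2 \<and> a = c1 @ take L (drop M a) @ c2" if "a \<in> common" for a
    proof -
      have a: "a = take M a @ take L (drop M a) @ drop (M + L) a"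
        by (metis append_take_drop_id drop_drop add.commute)
      have "disj_occ (t + t + 1) a w" "length a = K" using that by (auto simp: common_def)
      have "disj_occ (t + t + 1) (take M a) w"
        by (rule disj_occ_infix[where x = "[]" and y = "drop M a"])
          (use \<open>disj_occ (t + t + 1) a w\<close> in \<open>simp del: disj_occ.simps\<close>)
      moreover have "disj_occ (t + t + 1) (drop (M + L) a) w"
        by (rule disj_occ_infix[where y = "[]" and x = "take (M + L) a"])
          (use \<open>disj_occ (t + t + 1) a w\<close> in \<open>simp del: disj_occ.simps\<close>)
      moreover have "length (take M a) = M" "length (drop (M + L) a) = M"
        using \<open>length a = K\<close> by (simp_all add: K_def)
      ultimately have "mixed (take M a)" "mixed (drop (M + L) a)" using mixed_ctx by blast+
      with a show ?thesis by blast
    qed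
    have no_conflict: "\<not> conflicting a b" if "a \<in> common" "b \<in> common" for a b
    proof
      assume conf: "conflicting a b"
      from that have *: "length a = K" "length b = K" "disj_occ (t + (t + 1)) a w" "disj_occ (t + t + 1) b w"
        by (auto simp: common_def simp del: disj_occ.simps)
      obtain w1 w2 where w: "w = w1 @ w2" "disj_occ t a w1" "disj_occ (t + 1) a w2"
        using disj_occ_split[OF *(3)] by blast
      have w2: "disj_occ t a w2" using w(3) by (rule disj_occ_mono) simp
      from disj_occ_cut[of t t b w1 w2] *(4) w(1) have "disj_occ t b w1 \<or> disj_occ t b w2" by blast
      thus False
      proof
        assume "disj_occ t b w1"
        from conflicting_cost[OF \<alpha> conflicting_sym[OF conf] this w2]
        show False using too_big[OF q_gain[OF *(2,1)]] by (simp add: w(1) n_def c_def \<rho>_def)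
      next
        assume "disj_occ t b w2"
        from conflicting_cost[OF \<alpha> conf w(2) this]
        show False using too_big[OF q_gain[OF *(1,2)]] by (simp add: w(1) n_def c_def \<rho>_def)
      qed
    qed
    define G where "G = (\<lambda>a. take L (drop M a)) ` common"
    have "\<forall>g\<in>G. length g = L" by (auto simp: G_def common_def K_def)
    moreover have "mutually_balanced G"
      unfolding mutually_balanced_def
    proof (intro ballI allI impI, elim conjE)
      fix g h u v assume gh: "g \<in> G" "h \<in> G" "sublist u g" "sublist v h" "length u = length v"
      show "ones v \<le> ones u + 1"
      proof (rule ccontr)
        assume "\<not> ones v \<le> ones u + 1"
        with unbalanced_palindrome[OF gh(5)] obtain p where p: "rev p = p"
          "sublist ([False] @ p @ [False]) u" "sublist ([True] @ p @ [True]) v" by auto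
        from gh(1,2) obtain a b where ab: "a \<in> common" "b \<in> common" "g = take L (drop M a)" "h = take L (drop M b)"
          by (auto simp: G_def)
        from common_ctx[OF ab(1)] ab(3) obtain c1 c2 where a: "mixed c1" "mixed c2" "a = c1 @ g @ c2" by blast
        from common_ctx[OF ab(2)] ab(4) obtain d1 d2 where b: "mixed d1" "mixed d2" "b = d1 @ h @ d2" by blast
        have "sublist ([False] @ p @ [False]) g" "sublist ([True] @ p @ [True]) h"
          using p(2,3) gh(3,4) sublist_order.order_trans by blast+
        then obtain x1 x2 y1 y2 where xy: "g = x1 @ ([False] @ p @ [False]) @ x2" "h = y1 @ ([True] @ p @ [True]) @ y2"
          unfolding sublist_def by blast
        have "conflicting a b" unfolding conflicting_def
          by (rule exI[of _ False], rule exI[of _ p], rule exI[of _ "c1 @ x1"], rule exI[of _ "x2 @ c2"],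
              rule exI[of _ "d1 @ y1"], rule exI[of _ "y2 @ d2"])
            (use a b xy p(1) in \<open>auto simp: mixed_def\<close>)
        with no_conflict ab(1,2) show False by blast
      qed
    qed
    moreover have "real (card (bad_windows L G w)) \<le> \<epsilon> * real n"
    proof -
      define rare where "rare = {a :: bool list. length a = K} - common"
      define Occ where "Occ a = {i. i + length a \<le> length w \<and> take (length a) (drop i w) = a}" for a
      have fin: "finite (Occ a)" for a by (rule finite_subset[of _ "{..length w}"]) (auto simp: Occ_def)
      \<comment> \<open>The first two sets contain the windows too close to the ends of \<open>w\<close> to be extended.\<close>
      have "bad_windows L G w \<subseteq> {..<M} \<union> {n - L - M<..<n - L - M + M + 1} \<union> (\<Union>a\<in>rare. (\<lambda>i. i + M) ` Occ a)"
      proof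
        fix i assume i: "i \<in> bad_windows L G w"
        hence iL: "i + L \<le> n" "take L (drop i w) \<notin> G" by (auto simp: bad_windows_def n_def)
        show "i \<in> {..<M} \<union> {n - L - M<..<n - L - M + M + 1} \<union> (\<Union>a\<in>rare. (\<lambda>i. i + M) ` Occ a)"
        proof (cases "i < M \<or> i + L + M > n")
          case False
          define a where "a = take K (drop (i - M) w)"
          have lenw: "i - M + K \<le> n" using False by (auto simp: K_def)
          hence len_a: "length a = K" by (auto simp: a_def n_def)
          have "drop M a = take (K - M) (drop i w)" using False by (simp add: a_def drop_take)
          hence "take L (drop M a) = take L (drop i w)" by (simp add: K_def min_def)
          hence "a \<notin> common" using iL(2) unfolding G_def by (metis image_eqI)
          hence "a \<in> rare" using len_a by (simp add: rare_def)
          moreover have "i - M \<in> Occ a" using lenw len_a by (simp add: Occ_def n_def) (simp add: a_def)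
          ultimately show ?thesis using False by (auto intro!: bexI[of _ a] image_eqI[of _ _ "i - M"])
        qed (use iL in auto)
      qed
      moreover have fin_rare: "finite rare" unfolding rare_def using finite_words by blast
      ultimately have "card (bad_windows L G w) \<le> card ({..<M} \<union> {n - L - M<..<n - L - M + M + 1} \<union> (\<Union>a\<in>rare. (\<lambda>i. i + M) ` Occ a))"
        using fin by (intro card_mono) auto
      also have "\<dots> \<le> M + M + (\<Sum>a\<in>rare. card ((\<lambda>i. i + M) ` Occ a))"
        using fin_rare
        by (intro order_trans[OF card_Un_le] add_mono card_UN_le) auto
      also have "(\<Sum>a\<in>rare. card ((\<lambda>i. i + M) ` Occ a)) \<le> (\<Sum>a\<in>rare. K * (t + t + 1))"
      proof (rule sum_mono)
        fix a assume a: "a \<in> rare"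
        hence len: "length a = K" "\<not> disj_occ (t + t + 1) a w" by (auto simp: rare_def common_def)
        have "a \<noteq> []" using len K by auto
        hence "\<not> length a * (t + t + 1) \<le> card (Occ a)"
          using disj_occ_of_card[of a "t + t + 1" w] len(2) unfolding Occ_def by blast
        moreover have "card ((\<lambda>i. i + M) ` Occ a) \<le> card (Occ a)" by (rule card_image_le[OF fin])
        ultimately show "card ((\<lambda>i. i + M) ` Occ a) \<le> K * (t + t + 1)" using len by simp
      qed
      also have "(\<Sum>a\<in>rare. K * (t + t + 1)) \<le> 2 ^ K * (K * (t + t + 1))"
      proof -
        have "card rare \<le> 2 ^ K" unfolding rare_def using card_mono[OF finite_words, of _ K] card_words[of K]
          by (metis Diff_subset)
        thus ?thesis by simp
      qed
      finally have "card (bad_windows L G w) \<le> M + M + 2 ^ K * (K * (t + t + 1))" by simp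
      hence "real (card (bad_windows L G w)) \<le> real (M + M + 2 ^ K * (K * (t + t + 1)))" by (rule of_nat_mono)
      also have "\<dots> = 2 * real M + 2 ^ K * real K + 2 ^ K * real K * 2 * real t" by (simp add: algebra_simps)
      also have "2 ^ K * real K * 2 * real t \<le> 2 ^ K * real K * 2 * (\<epsilon>2 * real n)"
        using t(2) by (intro mult_left_mono) auto
      also have "\<dots> = \<epsilon> / 2 * real n" using K by (simp add: \<epsilon>2_def)
      also have "2 * real M + 2 ^ K * real K \<le> \<epsilon> / 2 * real n"
      proof -
        have "(2 ^ K * real K + 2 * real M) / (\<epsilon> / 2) < real n" using n1 len by (simp add: n_def)
        thus ?thesis using \<epsilon> by (simp add: field_simps)
      qed
      finally show ?thesis by simp
    qed
    ultimately show ?thesis by (auto simp: n_def)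
  qed
  show ?thesis using \<epsilon>' main by (intro exI[of _ \<epsilon>'] conjI exI[of _ "max n0 n1"]) auto
qed

text \<open>If \<open>c\<close> counts the ones in prefixes, the left-hand side adds up the counts of \<open>N\<close> windows, and
  each summand on the right-hand side is the total count up to boundary terms.\<close>

lemma window_sum:
  fixes c :: "nat \<Rightarrow> real"
  shows "(\<Sum>i<N. c (i + L) - c i) = (\<Sum>k<L. c (N + k) - c k)"
proof (induction N)
  case (Suc N)
  have "(\<Sum>k<L. c (Suc N + k) - c (N + k)) = c (N + L) - c N"
    using sum_lessThan_telescope[of "\<lambda>k. c (N + k)" L] by simp
  hence "(\<Sum>k<L. c (Suc N + k) - c k) = (\<Sum>k<L. c (N + k) - c k) + (c (N + L) - c N)"
    by (simp add: sum_subtractf algebra_simps)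
  with Suc.IH show ?case by simp
qed simp

lemma ones_window: "i + L \<le> length w \<Longrightarrow>
  real (ones (take L (drop i w))) = real (ones (take (i + L) w)) - real (ones (take i w))"
  by (simp add: take_add)

lemma ones_take_le: "ones (take i w) \<le> ones w"
  using ones_simps(3)[of "take i w" "drop i w"] by simp

lemma ones_take_ge: "ones w \<le> ones (take i w) + (length w - i)"
  using ones_simps(3)[of "take i w" "drop i w"] ones_le_length[of "drop i w"] by simp

lemma window_count_bounds:
  assumes L: "1 \<le> L" "L \<le> length w"
  shows "real L * real (ones w) - 2 * (real L)\<^sup>2 \<le> (\<Sum>i<length w - L + 1. real (ones (take L (drop i w))))"
    and "(\<Sum>i<length w - L + 1. real (ones (take L (drop i w)))) \<le> real L * real (ones w)"
proof -
  define N where "N = length w - L + 1"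
  define c where "c i = real (ones (take i w))" for i
  have "(\<Sum>i<N. real (ones (take L (drop i w)))) = (\<Sum>i<N. c (i + L) - c i)"
    using L by (intro sum.cong refl) (simp add: c_def ones_window N_def)
  also have "\<dots> = (\<Sum>k<L. c (N + k) - c k)" by (rule window_sum)
  finally have eq: "(\<Sum>i<N. real (ones (take L (drop i w)))) = (\<Sum>k<L. c (N + k) - c k)" .
  have "(\<Sum>k<L. c (N + k) - c k) \<le> (\<Sum>k<L. real (ones w))"
  proof (rule sum_mono)
    fix k
    have "c (N + k) \<le> real (ones w)" "c k \<ge> 0" by (simp_all add: c_def ones_take_le)
    thus "c (N + k) - c k \<le> real (ones w)" by linarith
  qed
  thus "(\<Sum>i<length w - L + 1. real (ones (take L (drop i w)))) \<le> real L * real (ones w)"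
    using eq by (simp add: N_def)
  have "(\<Sum>k<L. real (ones w) - 2 * real L) \<le> (\<Sum>k<L. c (N + k) - c k)"
  proof (intro sum_mono)
    fix k assume "k \<in> {..<L}"
    hence "k \<le> L" by simp
    have "ones w \<le> ones (take (N + k) w) + L" using ones_take_ge[of w "N + k"] L by (simp add: N_def)
    moreover have "ones (take k w) \<le> L" using ones_le_length[of "take k w"] \<open>k \<le> L\<close> by simp
    ultimately show "real (ones w) - 2 * real L \<le> c (N + k) - c k" by (simp add: c_def)
  qed
  thus "real L * real (ones w) - 2 * (real L)\<^sup>2 \<le> (\<Sum>i<length w - L + 1. real (ones (take L (drop i w))))"
    using eq by (simp add: N_def algebra_simps power2_eq_square)
qed

text \<open>If almost all windows contain \<open>k\<close> or \<open>k + 1\<close> ones, then the whole word has ratio between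
  \<open>k / L\<close> and \<open>(k + 1) / L\<close>, up to small errors.\<close>

lemma ones_from_windows:
  assumes L: "1 \<le> L" "L \<le> length w" and G: "\<And>g. g \<in> G \<Longrightarrow> k \<le> ones g \<and> ones g \<le> k + 1" and "k \<le> L"
    and B: "real (card (bad_windows L G w)) \<le> B"
  shows "real k * real (length w) - (real L)\<^sup>2 - real L * B \<le> real L * real (ones w)"
    and "real L * real (ones w) \<le> (real k + 1) * real (length w) + real L * B + 2 * (real L)\<^sup>2"
proof -
  define N where "N = length w - L + 1"
  define e where "e i = (if i \<in> bad_windows L G w then real L else 0)" for i
  have sub: "bad_windows L G w \<subseteq> {..<N}" using L by (auto simp: bad_windows_def N_def)
  have sum_e: "(\<Sum>i<N. e i) = real L * real (card (bad_windows L G w))"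
    unfolding e_def using sub by (simp add: sum.If_cases Int_absorb1)
  also have "\<dots> \<le> real L * B" using B by (intro mult_left_mono) auto
  finally have sum_e: "(\<Sum>i<N. e i) \<le> real L * B" .
  have bounds: "real k - e i \<le> real (ones (take L (drop i w))) \<and> real (ones (take L (drop i w))) \<le> real k + 1 + e i"
    if "i < N" for i
  proof (cases "i \<in> bad_windows L G w")
    case True
    have "ones (take L (drop i w)) \<le> L" using ones_le_length[of "take L (drop i w)"] by simp
    thus ?thesis using True \<open>k \<le> L\<close> by (simp add: e_def)
  next
    case False
    hence "take L (drop i w) \<in> G" using that L by (auto simp: bad_windows_def N_def)
    from G[OF this] False show ?thesis by (simp add: e_def)
  qed
  have "real N * real k - (\<Sum>i<N. e i) \<le> (\<Sum>i<N. real (ones (take L (drop i w))))"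
    using sum_mono[of "{..<N}" "\<lambda>i. real k - e i"] bounds by (simp add: sum_subtractf)
  also have "\<dots> \<le> real L * real (ones w)" unfolding N_def by (rule window_count_bounds(2)[OF L])
  finally have "real N * real k - real L * B \<le> real L * real (ones w)" using sum_e by simp
  moreover have "real k * real (length w) - (real L)\<^sup>2 \<le> real N * real k"
  proof -
    have "real k * real L \<le> real L * real L" using \<open>k \<le> L\<close> by (intro mult_right_mono) auto
    moreover have "real N * real k = real k * real (length w) - real k * real L + real k"
      using L by (simp add: N_def of_nat_diff algebra_simps)
    ultimately show ?thesis by (simp only: power2_eq_square)
  qed
  ultimately show "real k * real (length w) - (real L)\<^sup>2 - real L * B \<le> real L * real (ones w)" by linarith
  have "real L * real (ones w) - 2 * (real L)\<^sup>2 \<le> (\<Sum>i<N. real (ones (take L (drop i w))))"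
    unfolding N_def by (rule window_count_bounds(1)[OF L])
  also have "\<dots> \<le> real N * (real k + 1) + (\<Sum>i<N. e i)"
    using sum_mono[of "{..<N}" _ "\<lambda>i. real k + 1 + e i"] bounds by (simp add: sum.distrib)
  finally have "real L * real (ones w) \<le> real N * (real k + 1) + real L * B + 2 * (real L)\<^sup>2" using sum_e by simp
  moreover have "real N * (real k + 1) \<le> (real k + 1) * real (length w)"
    using L by (subst mult.commute[of "real k + 1"], intro mult_right_mono) (auto simp: N_def)
  ultimately show "real L * real (ones w) \<le> (real k + 1) * real (length w) + real L * B + 2 * (real L)\<^sup>2"
    by linarith
qed

lemma mutually_balanced_ones:
  assumes "mutually_balanced G" "\<And>g. g \<in> G \<Longrightarrow> length g = L"
  obtains k where "k \<le> L" "\<And>g. g \<in> G \<Longrightarrow> k \<le> ones g \<and> ones g \<le> k + 1"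
proof (cases "G = {}")
  case False
  define k where "k = (LEAST k. \<exists>g\<in>G. ones g = k)"
  from False have "\<exists>k. \<exists>g\<in>G. ones g = k" by blast
  from LeastI_ex[OF this] obtain g0 where g0: "g0 \<in> G" "ones g0 = k" unfolding k_def by blast
  show ?thesis
  proof
    show "k \<le> L" using g0 assms(2) ones_le_length by metis
    fix g assume g: "g \<in> G"
    have "k \<le> ones g" unfolding k_def using g by (intro Least_le) blast
    moreover have "ones g \<le> ones g0 + 1"
      using assms g g0(1) unfolding mutually_balanced_def by (metis sublist_order.order_refl)
    ultimately show "k \<le> ones g \<and> ones g \<le> k + 1" using g0 by simp
  qed
qed (use that[of 0] in auto)

section \<open>The optimal ratio\<close>

lemma bad_windows_append:
  "card (bad_windows L G u) \<le> card (bad_windows L G (u @ v))"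
  "card (bad_windows L G v) \<le> card (bad_windows L G (u @ v))"
proof -
  have "bad_windows L G u \<subseteq> bad_windows L G (u @ v)" by (auto simp: bad_windows_def)
  thus "card (bad_windows L G u) \<le> card (bad_windows L G (u @ v))" by (intro card_mono) auto
  have "(\<lambda>i. length u + i) ` bad_windows L G v \<subseteq> bad_windows L G (u @ v)" by (auto simp: bad_windows_def)
  hence "card ((\<lambda>i. length u + i) ` bad_windows L G v) \<le> card (bad_windows L G (u @ v))"
    by (intro card_mono) auto
  thus "card (bad_windows L G v) \<le> card (bad_windows L G (u @ v))"
    by (subst (asm) card_image) (auto simp: inj_on_def)
qed

text \<open>Each repetition of \<open>u01\<close> loses the constant \<open>upper_const \<alpha>\<close>, which is at most another
  factor \<open>exp (\<epsilon> * length u)\<close> for long \<open>u\<close>.\<close>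

lemma near_extremal_bridge_power:
  assumes \<alpha>: "\<alpha> \<in> {0<..1}" and near: "near_extremal \<epsilon> \<alpha> u" and "\<epsilon> \<ge> 0"
    and big: "ln (upper_const \<alpha>) \<le> \<epsilon> * real (length u)"
  shows "exp (- 2 * \<epsilon> * real (m * (length u + 2))) * jsr \<alpha> ^ (m * (length u + 2)) * mass \<alpha> v
    \<le> mass \<alpha> (concat (replicate m (u @ [False, True])) @ v)"
proof -
  define n where "n = length u"
  have \<rho>: "jsr \<alpha> > 1" and c: "upper_const \<alpha> > 1" using jsr_gt_1[OF \<alpha>] upper_const_bounds[OF \<alpha>] by auto
  have "exp (- 2 * \<epsilon> * real (n + 2)) \<le> exp (- \<epsilon> * real n - ln (upper_const \<alpha>))"
  proof -
    have "- 2 * \<epsilon> * real (n + 2) \<le> - 2 * \<epsilon> * real n" using \<open>\<epsilon> \<ge> 0\<close> by (simp add: algebra_simps)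
    thus ?thesis using big by (simp add: n_def)
  qed
  also have "\<dots> = exp (- \<epsilon> * real n) / upper_const \<alpha>" using c by (simp add: exp_diff)
  finally have "exp (- 2 * \<epsilon> * real (n + 2)) * jsr \<alpha> ^ (n + 2) \<le> exp (- \<epsilon> * real n) / upper_const \<alpha> * jsr \<alpha> ^ (n + 2)"
    using \<rho> by (intro mult_right_mono) auto
  also have "\<dots> = \<alpha> * (exp (- \<epsilon> * real n) * jsr \<alpha> ^ n)"
    using \<alpha> \<rho> by (simp add: upper_const_def power_add field_simps power2_eq_square)
  also have "\<dots> \<le> \<alpha> * mass \<alpha> u" using near \<alpha> by (intro mult_left_mono) (auto simp: near_extremal_def n_def)
  finally have "(exp (- 2 * \<epsilon> * real (n + 2)) * jsr \<alpha> ^ (n + 2)) ^ m \<le> (\<alpha> * mass \<alpha> u) ^ m"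
    using \<rho> by (intro power_mono) auto
  moreover have "(exp (- 2 * \<epsilon> * real (n + 2)) * jsr \<alpha> ^ (n + 2)) ^ m
    = exp (- 2 * \<epsilon> * real (m * (n + 2))) * jsr \<alpha> ^ (m * (n + 2))"
    unfolding power_mult_distrib exp_of_nat_mult[symmetric] power_mult[symmetric]
    by (simp only: of_nat_mult mult_ac)
  ultimately have "exp (- 2 * \<epsilon> * real (m * (n + 2))) * jsr \<alpha> ^ (m * (n + 2)) * mass \<alpha> v \<le> (\<alpha> * mass \<alpha> u) ^ m * mass \<alpha> v"
    using mass_nonneg[of \<alpha> v] \<alpha> by (intro mult_right_mono) auto
  also have "\<dots> \<le> mass \<alpha> (concat (replicate m (u @ [False, True])) @ v)" using \<alpha> by (intro mass_power_bridge) auto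
  finally show ?thesis by (simp add: n_def)
qed

lemma ones_concat_replicate: "ones (concat (replicate m u)) = m * ones u"
  by (induction m) auto

lemma length_concat_replicate: "length (concat (replicate m u)) = m * length u"
  by (induction m) auto

lemma one_ratio_bounds: "0 \<le> one_ratio w" "one_ratio w \<le> 1"
proof -
  show "0 \<le> one_ratio w" by (simp add: one_ratio_def)
  show "one_ratio w \<le> 1" using ones_le_length[of w] by (cases "w = []") (auto simp: one_ratio_def field_simps)
qed

lemma one_ratio_bridge:
  assumes "length u > 0"
  shows "\<bar>real (ones u + 1) / real (length u + 2) - one_ratio u\<bar> \<le> 2 / real (length u + 2)"
proof -
  define n where "n = real (length u)"
  define k where "k = real (ones u)"
  have n: "n > 0" "0 \<le> k" "k \<le> n" using assms ones_le_length[of u] by (auto simp: n_def k_def)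
  have "(k + 1) / (n + 2) - k / n = (1 - 2 * (k / n)) / (n + 2)" using n by (simp add: field_simps)
  moreover have "0 \<le> k / n" "k / n \<le> 1" using n by auto
  hence "\<bar>1 - 2 * (k / n)\<bar> \<le> 2" by linarith
  ultimately have "\<bar>(k + 1) / (n + 2) - k / n\<bar> \<le> 2 / (n + 2)" using n by (simp add: abs_divide divide_right_mono)
  thus ?thesis by (simp add: n_def k_def one_ratio_def add.commute)
qed

text \<open>Take \<open>length v + 2\<close> copies of \<open>u01\<close> followed by \<open>length u + 2\<close> copies of \<open>v01\<close>. Both halves
  have the same length and their concatenation is again near-extremal. The window counts of the two
  halves are governed by the same pair \<open>k\<close>, \<open>k + 1\<close>, so the ratios differ by little more than
  \<open>1 / L\<close>.\<close>

lemma near_extremal_ratios_close: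
  assumes \<alpha>: "\<alpha> \<in> {0<..1}" and \<eta>: "\<eta> > 0"
  shows "\<exists>\<epsilon>>0. \<exists>n0. \<forall>u v. n0 \<le> length u \<longrightarrow> n0 \<le> length v \<longrightarrow> near_extremal \<epsilon> \<alpha> u \<longrightarrow>
    near_extremal \<epsilon> \<alpha> v \<longrightarrow> one_ratio v - one_ratio u \<le> \<eta>"
proof -
  obtain L0 :: nat where L0: "real L0 > 4 / \<eta>" using reals_Archimedean2 by blast
  define L where "L = Suc L0"
  have "4 / \<eta> < real L" using L0 by (simp add: L_def)
  hence L: "1 \<le> L" "1 / real L \<le> \<eta> / 4" using \<eta> by (auto simp: L_def field_simps simp del: of_nat_Suc)
  from typical_windows[OF \<alpha>, of "\<eta> / 16" L] \<eta>
  obtain \<epsilon>' n0 where \<epsilon>': "\<epsilon>' > 0"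
    and n0: "\<And>w. n0 \<le> length w \<Longrightarrow> near_extremal \<epsilon>' \<alpha> w \<Longrightarrow>
      (\<exists>G. (\<forall>g\<in>G. length g = L) \<and> mutually_balanced G \<and>
      real (card (bad_windows L G w)) \<le> \<eta> / 16 * real (length w))" by auto
  obtain n1 :: nat where n1: "real n1 > ln (upper_const \<alpha>) / (\<epsilon>' / 2)" using reals_Archimedean2 by blast
  obtain n2 :: nat where n2: "real n2 > 3 * real L / (\<eta> / 8)" using reals_Archimedean2 by blast
  obtain n3 :: nat where n3: "real n3 > 2 / (\<eta> / 16)" using reals_Archimedean2 by blast
  define N where "N = Max {n0, n1, n2, n3, L, 1}"
  have N: "n0 \<le> N" "n1 \<le> N" "n2 \<le> N" "n3 \<le> N" "L \<le> N" "1 \<le> N" by (auto simp: N_def)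
  have "one_ratio v - one_ratio u \<le> \<eta>"
    if uv: "N \<le> length u" "N \<le> length v" "near_extremal (\<epsilon>' / 2) \<alpha> u" "near_extremal (\<epsilon>' / 2) \<alpha> v" for u v
  proof -
    define n m where "n = length u + 2" and "m = length v + 2"
    define H where "H = m * n"
    define w1 w2 where "w1 = concat (replicate m (u @ [False, True]))" and "w2 = concat (replicate n (v @ [False, True]))"
    have big: "ln (upper_const \<alpha>) \<le> \<epsilon>' / 2 * real l" if "N \<le> l" for l
    proof -
      have "ln (upper_const \<alpha>) / (\<epsilon>' / 2) < real l" using n1 N(2) that by linarith
      thus ?thesis using \<epsilon>' by (simp add: field_simps)
    qed
    have len: "length w1 = H" "length w2 = H"
      by (simp_all add: w1_def w2_def length_concat_replicate H_def n_def m_def mult.commute)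
    have ones: "ones w1 = m * (ones u + 1)" "ones w2 = n * (ones v + 1)"
      by (simp_all add: w1_def w2_def ones_concat_replicate)
    have H: "N \<le> H" using uv(1) by (simp add: H_def n_def m_def)
    have near: "near_extremal \<epsilon>' \<alpha> (w1 @ w2)"
    proof -
      have \<rho>: "jsr \<alpha> > 1" using jsr_gt_1[OF \<alpha>] .
      have "exp (- 2 * (\<epsilon>' / 2) * real H) * jsr \<alpha> ^ H * 2 \<le> mass \<alpha> w2"
        using near_extremal_bridge_power[OF \<alpha> uv(4), of n "[]"] big[OF uv(2)] \<epsilon>'
        unfolding H_def m_def w2_def by (simp add: mult.commute[of n])
      hence w2: "exp (- 2 * (\<epsilon>' / 2) * real H) * jsr \<alpha> ^ H \<le> mass \<alpha> w2"
        using \<rho> by (smt (verit) exp_gt_zero mult_pos_pos zero_less_power)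
      have "exp (- 2 * (\<epsilon>' / 2) * real H) * jsr \<alpha> ^ H * mass \<alpha> w2 \<le> mass \<alpha> (w1 @ w2)"
        using near_extremal_bridge_power[OF \<alpha> uv(3), of m w2] big[OF uv(1)] \<epsilon>'
        unfolding H_def n_def w1_def by simp
      moreover have "exp (- 2 * (\<epsilon>' / 2) * real H) * jsr \<alpha> ^ H * (exp (- 2 * (\<epsilon>' / 2) * real H) * jsr \<alpha> ^ H)
        \<le> exp (- 2 * (\<epsilon>' / 2) * real H) * jsr \<alpha> ^ H * mass \<alpha> w2"
        using w2 \<rho> by (intro mult_left_mono) auto
      moreover have "exp (- 2 * (\<epsilon>' / 2) * real H) * jsr \<alpha> ^ H * (exp (- 2 * (\<epsilon>' / 2) * real H) * jsr \<alpha> ^ H)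
        = exp (- \<epsilon>' * real (H + H)) * jsr \<alpha> ^ (H + H)"
        by (simp add: power_add algebra_simps flip: exp_add)
      ultimately have "exp (- \<epsilon>' * real (H + H)) * jsr \<alpha> ^ (H + H) \<le> mass \<alpha> (w1 @ w2)" by linarith
      thus ?thesis by (simp add: near_extremal_def len)
    qed
    have "n0 \<le> length (w1 @ w2)" using H N(1) len by simp
    from n0[OF this near] obtain G where G: "\<And>g. g \<in> G \<Longrightarrow> length g = L" "mutually_balanced G"
      "real (card (bad_windows L G (w1 @ w2))) \<le> \<eta> / 16 * real (H + H)" using len by auto
    obtain k where k: "k \<le> L" "\<And>g. g \<in> G \<Longrightarrow> k \<le> ones g \<and> ones g \<le> k + 1"
      using mutually_balanced_ones[OF G(2,1)] by blast
    define B where "B = \<eta> / 8 * real H"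
    have B: "real (card (bad_windows L G w1)) \<le> B" "real (card (bad_windows L G w2)) \<le> B"
    proof -
      have "real (card (bad_windows L G w1)) \<le> real (card (bad_windows L G (w1 @ w2)))"
        "real (card (bad_windows L G w2)) \<le> real (card (bad_windows L G (w1 @ w2)))"
        using bad_windows_append by simp_all
      thus "real (card (bad_windows L G w1)) \<le> B" "real (card (bad_windows L G w2)) \<le> B"
        using G(3) by (simp_all add: B_def)
    qed
    have LH: "L \<le> H" using H N(5) by simp
    have lower: "real k * real H - (real L)\<^sup>2 - real L * B \<le> real L * real (ones w1)"
      using ones_from_windows(1)[OF L(1) _ k(2,1) B(1)] LH len by simp
    have upper: "real L * real (ones w2) \<le> (real k + 1) * real H + real L * B + 2 * (real L)\<^sup>2"
      using ones_from_windows(2)[OF L(1) _ k(2,1) B(2)] LH len by simp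
    have "real L * (real (ones w2) - real (ones w1)) \<le> real H + 2 * real L * B + 3 * (real L)\<^sup>2"
      using lower upper by (simp add: algebra_simps)
    hence diff: "real (ones w2) - real (ones w1) \<le> real H / real L + 2 * B + 3 * real L"
      using L by (simp add: field_simps power2_eq_square)
    have Hpos: "real H > 0" using H N(6) by simp
    have "(real (ones w2) - real (ones w1)) / real H \<le> (real H / real L + 2 * B + 3 * real L) / real H"
      using diff Hpos by (intro divide_right_mono) auto
    also have "\<dots> = 1 / real L + \<eta> / 4 + 3 * real L / real H"
      using Hpos L by (simp add: B_def add_divide_distrib)
    also have "3 * real L / real H \<le> \<eta> / 8"
    proof -
      have "3 * real L / (\<eta> / 8) < real H" using n2 N(3) H by linarith
      thus ?thesis using \<eta> Hpos by (simp add: field_simps)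
    qed
    finally have d: "(real (ones w2) - real (ones w1)) / real H \<le> 5 * \<eta> / 8" using L(2) by linarith
    have r1: "real (ones w1) / real H = real (ones u + 1) / real (length u + 2)"
      by (simp only: ones H_def n_def[symmetric] of_nat_mult) (simp add: m_def)
    have r2: "real (ones w2) / real H = real (ones v + 1) / real (length v + 2)"
      by (simp only: ones H_def m_def[symmetric] of_nat_mult) (simp add: n_def)
    have small: "2 / real (l + 2) \<le> \<eta> / 16" if "N \<le> l" for l
    proof -
      have "2 / (\<eta> / 16) < real (l + 2)" using n3 N(4) that by linarith
      thus ?thesis using \<eta> by (simp add: field_simps)
    qed
    have "\<bar>real (ones u + 1) / real (length u + 2) - one_ratio u\<bar> \<le> \<eta> / 16"
      using one_ratio_bridge[of u] small[OF uv(1)] uv(1) N(6) by linarith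
    moreover have "\<bar>real (ones v + 1) / real (length v + 2) - one_ratio v\<bar> \<le> \<eta> / 16"
      using one_ratio_bridge[of v] small[OF uv(2)] uv(2) N(6) by linarith
    ultimately show ?thesis using d \<eta> unfolding diff_divide_distrib r1 r2 by linarith
  qed
  thus ?thesis using \<epsilon>' by (intro exI[of _ "\<epsilon>' / 2"] conjI exI[of _ N]) auto
qed

text \<open>A formulation by finite words, which makes sense of the ratio without any limit word and is
  stable under small changes of the parameter.\<close>

definition is_optimal_ratio :: "real \<Rightarrow> real \<Rightarrow> bool" where
  "is_optimal_ratio \<alpha> r \<longleftrightarrow> r \<in> {0..1} \<and> (\<forall>\<eta>>0. \<exists>\<epsilon>>0. \<exists>n0. \<forall>u. n0 \<le> length u \<longrightarrow> near_extremal \<epsilon> \<alpha> u \<longrightarrow>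
    \<bar>one_ratio u - r\<bar> \<le> \<eta>)"

definition best_word :: "real \<Rightarrow> nat \<Rightarrow> fin_word" where
  "best_word \<alpha> n = (SOME w. length w = n \<and> jsr \<alpha> ^ n \<le> mass \<alpha> w)"

lemma best_word:
  assumes "\<alpha> \<in> {0..1}"
  shows "length (best_word \<alpha> n) = n" "jsr \<alpha> ^ n \<le> mass \<alpha> (best_word \<alpha> n)"
  using someI_ex[OF jsr_power_attained[OF assms, of n]] by (auto simp: best_word_def)

lemma best_word_near_extremal:
  assumes "\<alpha> \<in> {0..1}" "\<epsilon> \<ge> 0"
  shows "near_extremal \<epsilon> \<alpha> (best_word \<alpha> n)"
proof -
  have "exp (- \<epsilon> * real n) * jsr \<alpha> ^ n \<le> 1 * jsr \<alpha> ^ n"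
    using assms jsr_ge_1[of \<alpha>] by (intro mult_right_mono) auto
  thus ?thesis using best_word[OF assms(1), of n] by (simp add: near_extremal_def)
qed

lemma optimal_ratio_exists:
  assumes \<alpha>: "\<alpha> \<in> {0<..1}"
  shows "\<exists>r. is_optimal_ratio \<alpha> r"
proof -
  have \<alpha>': "\<alpha> \<in> {0..1}" using \<alpha> by auto
  define s where "s n = one_ratio (best_word \<alpha> n)" for n
  have close: "\<exists>\<epsilon>>0. \<exists>n0. \<forall>u. n0 \<le> length u \<longrightarrow> near_extremal \<epsilon> \<alpha> u \<longrightarrow> (\<forall>n\<ge>n0. \<bar>one_ratio u - s n\<bar> \<le> \<eta>)"
    if "\<eta> > 0" for \<eta>
  proof -
    from near_extremal_ratios_close[OF \<alpha> that] obtain \<epsilon> n0 where \<epsilon>: "\<epsilon> > 0"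
      and n0: "\<And>u v. n0 \<le> length u \<Longrightarrow> n0 \<le> length v \<Longrightarrow> near_extremal \<epsilon> \<alpha> u \<Longrightarrow> near_extremal \<epsilon> \<alpha> v \<Longrightarrow>
        one_ratio v - one_ratio u \<le> \<eta>" by blast
    have "\<bar>one_ratio u - s n\<bar> \<le> \<eta>" if "n0 \<le> length u" "near_extremal \<epsilon> \<alpha> u" "n \<ge> n0" for u n
      using n0[of u "best_word \<alpha> n"] n0[of "best_word \<alpha> n" u] that best_word[OF \<alpha>', of n]
        best_word_near_extremal[OF \<alpha>', of \<epsilon> n] \<epsilon> by (simp add: s_def abs_le_iff)
    with \<epsilon> show ?thesis by blast
  qed
  have "Cauchy s"
  proof (rule metric_CauchyI)
    fix e :: real assume "e > 0"
    then obtain \<epsilon> n0 where *: "\<epsilon> > 0" "\<And>u n. n0 \<le> length u \<Longrightarrow> near_extremal \<epsilon> \<alpha> u \<Longrightarrow> n \<ge> n0 \<Longrightarrow> \<bar>one_ratio u - s n\<bar> \<le> e / 2"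
      using close[of "e / 2"] by auto
    have "dist (s m) (s n) < e" if "m \<ge> n0" "n \<ge> n0" for m n
      using *(2)[of "best_word \<alpha> m" n] that best_word[OF \<alpha>', of m] best_word_near_extremal[OF \<alpha>', of \<epsilon> m] *(1) \<open>e > 0\<close>
      by (simp add: dist_real_def s_def)
    thus "\<exists>M. \<forall>m\<ge>M. \<forall>n\<ge>M. dist (s m) (s n) < e" by blast
  qed
  then obtain r where r: "s \<longlonglongrightarrow> r" using Cauchy_convergent convergent_def by blast
  have "r \<in> {0..1}"
    using LIMSEQ_le_const[OF r, of 0] LIMSEQ_le_const2[OF r, of 1] one_ratio_bounds by (auto simp: s_def)
  moreover have "\<exists>\<epsilon>>0. \<exists>n0. \<forall>u. n0 \<le> length u \<longrightarrow> near_extremal \<epsilon> \<alpha> u \<longrightarrow> \<bar>one_ratio u - r\<bar> \<le> \<eta>" if \<eta>: "\<eta> > 0" for \<eta>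
  proof -
    obtain \<epsilon> n0 where *: "\<epsilon> > 0" "\<And>u n. n0 \<le> length u \<Longrightarrow> near_extremal \<epsilon> \<alpha> u \<Longrightarrow> n \<ge> n0 \<Longrightarrow> \<bar>one_ratio u - s n\<bar> \<le> \<eta>"
      using close[OF \<eta>] by blast
    have "\<bar>one_ratio u - r\<bar> \<le> \<eta>" if u: "n0 \<le> length u" "near_extremal \<epsilon> \<alpha> u" for u
    proof (rule LIMSEQ_le_const2)
      show "(\<lambda>n. \<bar>one_ratio u - s n\<bar>) \<longlonglongrightarrow> \<bar>one_ratio u - r\<bar>" by (intro tendsto_intros r)
      show "\<exists>N. \<forall>n\<ge>N. \<bar>one_ratio u - s n\<bar> \<le> \<eta>" using *(2)[OF u] by blast
    qed
    with *(1) show ?thesis by blast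
  qed
  ultimately show ?thesis unfolding is_optimal_ratio_def by blast
qed

text \<open>At \<open>\<alpha> = 0\<close> every product that contains \<open>1\<close> vanishes.\<close>

definition opt_ratio :: "real \<Rightarrow> real" where
  "opt_ratio \<alpha> = (if \<alpha> = 0 then 0 else SOME r. is_optimal_ratio \<alpha> r)"

lemma opt_ratio:
  assumes "\<alpha> \<in> {0<..1}" shows "is_optimal_ratio \<alpha> (opt_ratio \<alpha>)"
  using someI_ex[OF optimal_ratio_exists[OF assms]] assms by (auto simp: opt_ratio_def)

lemma opt_ratio_range: "\<alpha> \<in> {0..1} \<Longrightarrow> opt_ratio \<alpha> \<in> {0..1}"
  using opt_ratio[of \<alpha>] by (cases "\<alpha> = 0") (auto simp: is_optimal_ratio_def opt_ratio_def)

lemma opt_ratio_limit: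
  assumes \<alpha>: "\<alpha> \<in> {0<..1}" and len: "\<And>n. length (w n) = n"
    and near: "\<And>\<epsilon>. \<epsilon> > 0 \<Longrightarrow> eventually (\<lambda>n. near_extremal \<epsilon> \<alpha> (w n)) sequentially"
  shows "(\<lambda>n. one_ratio (w n)) \<longlonglongrightarrow> opt_ratio \<alpha>"
proof (rule metric_LIMSEQ_I)
  fix e :: real assume "e > 0"
  hence "\<exists>\<epsilon>>0. \<exists>n0. \<forall>u. n0 \<le> length u \<longrightarrow> near_extremal \<epsilon> \<alpha> u \<longrightarrow> \<bar>one_ratio u - opt_ratio \<alpha>\<bar> \<le> e / 2"
    using opt_ratio[OF \<alpha>] unfolding is_optimal_ratio_def by (metis half_gt_zero)
  then obtain \<epsilon> n0 where *: "\<epsilon> > 0" "\<And>u. n0 \<le> length u \<Longrightarrow> near_extremal \<epsilon> \<alpha> u \<Longrightarrow> \<bar>one_ratio u - opt_ratio \<alpha>\<bar> \<le> e / 2" by blast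
  from near[OF *(1)] obtain n1 where n1: "\<And>n. n \<ge> n1 \<Longrightarrow> near_extremal \<epsilon> \<alpha> (w n)" by (auto simp: eventually_sequentially)
  have "dist (one_ratio (w n)) (opt_ratio \<alpha>) < e" if "n \<ge> max n0 n1" for n
    using *(2)[of "w n"] n1[of n] that len[of n] \<open>e > 0\<close> by (simp add: dist_real_def)
  thus "\<exists>no. \<forall>n\<ge>no. dist (one_ratio (w n)) (opt_ratio \<alpha>) < e" by blast
qed

lemma best_word_ratio:
  assumes "\<alpha> \<in> {0<..1}" shows "(\<lambda>n. one_ratio (best_word \<alpha> n)) \<longlonglongrightarrow> opt_ratio \<alpha>"
  using assms best_word[of \<alpha>] best_word_near_extremal[of \<alpha>] by (intro opt_ratio_limit) auto

section \<open>Dependence of the optimal ratio on the parameter\<close>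

text \<open>Passing from \<open>\<beta>\<close> to \<open>\<alpha>\<close> changes both the mass, per letter, and the joint spectral radius by
  at most the quotient of the parameters, and only one of the two changes acts unfavourably.\<close>

lemma best_word_near_extremal_nearby:
  assumes "\<alpha> \<in> {0<..1}" "\<beta> \<in> {0<..1}" "\<bar>ln \<beta> - ln \<alpha>\<bar> \<le> \<epsilon>"
  shows "near_extremal \<epsilon> \<alpha> (best_word \<beta> n)"
proof -
  let ?w = "best_word \<beta> n"
  have w: "length ?w = n" "jsr \<beta> ^ n \<le> mass \<beta> ?w" using best_word[of \<beta> n] assms by auto
  have e: "\<epsilon> \<ge> 0" using assms(3) by linarith
  have exp_pow: "exp (- \<epsilon> * real n) = exp (- \<epsilon>) ^ n" by (simp add: mult.commute flip: exp_of_nat_mult)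
  have \<rho>: "jsr \<alpha> > 1" "jsr \<beta> > 1" using jsr_gt_1 assms by auto
  have ratio: "exp (- \<epsilon>) \<le> x / y" if "x > 0" "y > 0" "ln y - ln x \<le> \<epsilon>" for x y :: real
  proof -
    have "exp (- \<epsilon>) \<le> exp (ln x - ln y)" using that(3) by simp
    thus ?thesis using that by (simp add: exp_diff)
  qed
  show ?thesis
  proof (cases "\<alpha> \<le> \<beta>")
    case True
    have "exp (- \<epsilon>) ^ n * jsr \<alpha> ^ n \<le> (\<alpha> / \<beta>) ^ n * jsr \<beta> ^ n"
      using assms ratio[of \<alpha> \<beta>] jsr_mono[of \<alpha> \<beta>] True \<rho> by (intro mult_mono power_mono) auto
    also have "\<dots> \<le> (\<alpha> / \<beta>) ^ n * mass \<beta> ?w" using w assms by (intro mult_left_mono) auto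
    also have "\<dots> \<le> mass \<alpha> ?w" using mass_change_parameter[of \<alpha> \<beta> ?w] True assms w(1) by simp
    finally show ?thesis by (simp only: near_extremal_def w(1) exp_pow)
  next
    case False
    have "exp (- \<epsilon>) * jsr \<alpha> \<le> \<beta> / \<alpha> * jsr \<alpha>"
      using ratio[of \<beta> \<alpha>] assms \<rho> by (intro mult_right_mono) auto
    also have "\<dots> \<le> jsr \<beta>" using jsr_change_parameter[of \<beta> \<alpha>] False assms by auto
    finally have "(exp (- \<epsilon>) * jsr \<alpha>) ^ n \<le> jsr \<beta> ^ n" using \<rho> by (intro power_mono) auto
    also have "\<dots> \<le> mass \<beta> ?w" by (rule w(2))
    also have "\<dots> \<le> mass \<alpha> ?w"
      unfolding mass_scale[of \<alpha>] mass_scale[of \<beta>] using assms mass_one_ge_2[of ?w] False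
      by (intro mult_right_mono power_mono) auto
    finally show ?thesis by (simp only: near_extremal_def w(1) exp_pow power_mult_distrib)
  qed
qed

lemma opt_ratio_continuous_pos:
  assumes \<alpha>: "\<alpha> \<in> {0<..1}" and "\<eta> > 0"
  shows "\<exists>\<delta>>0. \<forall>\<beta>\<in>{0<..1}. \<bar>\<beta> - \<alpha>\<bar> < \<delta> \<longrightarrow> \<bar>opt_ratio \<beta> - opt_ratio \<alpha>\<bar> \<le> \<eta>"
proof -
  from opt_ratio[OF \<alpha>] \<open>\<eta> > 0\<close> obtain \<epsilon> n0 where *: "\<epsilon> > 0"
    "\<And>u. n0 \<le> length u \<Longrightarrow> near_extremal \<epsilon> \<alpha> u \<Longrightarrow> \<bar>one_ratio u - opt_ratio \<alpha>\<bar> \<le> \<eta>"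
    unfolding is_optimal_ratio_def by blast
  have "isCont ln \<alpha>" using \<alpha> by (intro isCont_ln) auto
  with \<open>\<epsilon> > 0\<close> obtain \<delta> where \<delta>: "\<delta> > 0" "\<And>\<beta>. \<bar>\<beta> - \<alpha>\<bar> < \<delta> \<Longrightarrow> \<bar>ln \<beta> - ln \<alpha>\<bar> < \<epsilon>"
    unfolding continuous_at_eps_delta dist_real_def by meson
  have "\<bar>opt_ratio \<beta> - opt_ratio \<alpha>\<bar> \<le> \<eta>" if "\<beta> \<in> {0<..1}" "\<bar>\<beta> - \<alpha>\<bar> < \<delta>" for \<beta>
  proof (rule LIMSEQ_le_const2)
    show "(\<lambda>n. \<bar>one_ratio (best_word \<beta> n) - opt_ratio \<alpha>\<bar>) \<longlonglongrightarrow> \<bar>opt_ratio \<beta> - opt_ratio \<alpha>\<bar>"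
      by (intro tendsto_intros best_word_ratio that)
    have "\<bar>ln \<beta> - ln \<alpha>\<bar> \<le> \<epsilon>" using \<delta>(2)[OF that(2)] by simp
    thus "\<exists>N. \<forall>n\<ge>N. \<bar>one_ratio (best_word \<beta> n) - opt_ratio \<alpha>\<bar> \<le> \<eta>"
      using *(2) best_word_near_extremal_nearby[OF \<alpha> that(1)] best_word(1)[of \<beta>] that(1)
      by (intro exI[of _ n0]) auto
  qed
  with \<delta>(1) show ?thesis by blast
qed

text \<open>The mass of an optimal word is at least \<open>1\<close>, but \<open>k\<close> ones among \<open>n\<close> letters leave at most
  \<open>\<alpha> ^ k * 2 ^ (n + 1)\<close>. This gives continuity at \<open>0\<close>.\<close>

lemma opt_ratio_small:
  assumes \<alpha>: "\<alpha> \<in> {0<..<1}"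
  shows "opt_ratio \<alpha> * ln (1 / \<alpha>) \<le> ln 2"
proof -
  have \<alpha>': "\<alpha> \<in> {0<..1}" using \<alpha> by auto
  have ev: "eventually (\<lambda>n. one_ratio (best_word \<alpha> n) * ln (1 / \<alpha>) \<le> ln 2 + ln 2 / real n) sequentially"
    using eventually_gt_at_top[of 0]
  proof eventually_elim
    case (elim n)
    define w where "w = best_word \<alpha> n"
    have w: "length w = n" "jsr \<alpha> ^ n \<le> mass \<alpha> w" using best_word[of \<alpha> n] \<alpha> by (auto simp: w_def)
    have "1 \<le> jsr \<alpha> ^ n" using jsr_ge_1[of \<alpha>] \<alpha> by (intro one_le_power) auto
    also note w(2)
    also have "mass \<alpha> w \<le> \<alpha> ^ ones w * 2 ^ (n + 1)"
      unfolding mass_scale[of \<alpha>] using mass_one_le[of w] \<alpha> w(1) by (intro mult_left_mono) auto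
    finally have "ln 1 \<le> ln (\<alpha> ^ ones w * 2 ^ (n + 1))" using \<alpha> by (subst ln_le_cancel_iff) auto
    also have "\<dots> = real (ones w) * ln \<alpha> + real (n + 1) * ln 2" using \<alpha> by (simp add: ln_mult ln_realpow algebra_simps)
    finally have "real (ones w) * ln (1 / \<alpha>) \<le> real (n + 1) * ln 2" using \<alpha> by (simp add: ln_div)
    hence "real (ones w) * ln (1 / \<alpha>) / real n \<le> real (n + 1) * ln 2 / real n" by (intro divide_right_mono) auto
    thus ?case using elim by (simp add: w(1) one_ratio_def field_simps flip: w_def)
  qed
  have "(\<lambda>n. ln 2 / real n) \<longlonglongrightarrow> 0" by (rule lim_const_over_n)
  hence "(\<lambda>n. ln 2 + ln 2 / real n) \<longlonglongrightarrow> ln 2 + 0" by (intro tendsto_intros)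
  moreover have "(\<lambda>n. one_ratio (best_word \<alpha> n) * ln (1 / \<alpha>)) \<longlonglongrightarrow> opt_ratio \<alpha> * ln (1 / \<alpha>)"
    by (intro tendsto_intros best_word_ratio \<alpha>')
  ultimately show ?thesis using ev by (simp add: tendsto_le[OF sequentially_bot])
qed

lemma opt_ratio_continuous: "continuous_on {0..1} opt_ratio"
proof (unfold continuous_on_iff, intro ballI allI impI)
  fix \<alpha> e :: real assume \<alpha>: "\<alpha> \<in> {0..1}" and e: "e > 0"
  show "\<exists>d>0. \<forall>\<beta>\<in>{0..1}. dist \<beta> \<alpha> < d \<longrightarrow> dist (opt_ratio \<beta>) (opt_ratio \<alpha>) < e"
  proof (cases "\<alpha> = 0")
    case False
    with \<alpha> have \<alpha>': "\<alpha> \<in> {0<..1}" by auto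
    from opt_ratio_continuous_pos[OF \<alpha>', of "e / 2"] e obtain \<delta> where \<delta>: "\<delta> > 0"
      "\<And>\<beta>. \<beta> \<in> {0<..1} \<Longrightarrow> \<bar>\<beta> - \<alpha>\<bar> < \<delta> \<Longrightarrow> \<bar>opt_ratio \<beta> - opt_ratio \<alpha>\<bar> \<le> e / 2" by auto
    have "dist (opt_ratio \<beta>) (opt_ratio \<alpha>) < e" if "\<beta> \<in> {0..1}" "dist \<beta> \<alpha> < min \<delta> \<alpha>" for \<beta>
    proof -
      have "\<beta> > 0" using that(2) by (auto simp: dist_real_def abs_if split: if_splits)
      thus ?thesis using \<delta>(2)[of \<beta>] that e by (simp add: dist_real_def)
    qed
    thus ?thesis using \<delta>(1) \<alpha>' by (intro exI[of _ "min \<delta> \<alpha>"]) auto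
  next
    case True
    define d where "d = min 1 (exp (- (ln 2 / e)))"
    have "dist (opt_ratio \<beta>) (opt_ratio \<alpha>) < e" if "\<beta> \<in> {0..1}" "dist \<beta> \<alpha> < d" for \<beta>
    proof (cases "\<beta> = 0")
      case False
      with that True have \<beta>: "\<beta> \<in> {0<..<1}" "\<beta> < exp (- (ln 2 / e))" by (auto simp: d_def)
      hence "ln \<beta> < - (ln 2 / e)" by (metis exp_less_cancel_iff exp_ln greaterThanLessThan_iff)
      hence l: "ln 2 / e < ln (1 / \<beta>)" using \<beta> by (simp add: ln_div)
      have l0: "ln (1 / \<beta>) > 0" using \<beta>(1) by simp
      have "opt_ratio \<beta> * ln (1 / \<beta>) \<le> ln 2" by (rule opt_ratio_small[OF \<beta>(1)])
      also have "ln 2 < e * ln (1 / \<beta>)" using l e by (simp add: field_simps)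
      finally have "opt_ratio \<beta> < e" using l0 by simp
      thus ?thesis using True opt_ratio_range[OF that(1)] by (simp add: dist_real_def opt_ratio_def)
    qed (use True e in simp)
    thus ?thesis by (intro exI[of _ d]) (auto simp: d_def)
  qed
qed

text \<open>If \<open>u\<close> and \<open>v\<close> are optimal for \<open>\<alpha>\<close> and \<open>\<beta>\<close>, then neither beats the other for the wrong
  parameter by more than a constant factor. Multiplying the two inequalities cancels the masses at
  parameter one and leaves \<open>(\<beta> / \<alpha>) ^ (ones u - ones v)\<close> bounded.\<close>

lemma opt_ratio_mono_pos:
  assumes "0 < \<alpha>" "\<alpha> < \<beta>" "\<beta> \<le> 1"
  shows "opt_ratio \<alpha> \<le> opt_ratio \<beta>"
proof -
  have \<alpha>: "\<alpha> \<in> {0<..1}" and \<beta>: "\<beta> \<in> {0<..1}" using assms by auto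
  define C where "C = ln (upper_const \<alpha>) + ln (upper_const \<beta>)"
  define l where "l = ln \<beta> - ln \<alpha>"
  have l: "l > 0" using assms by (simp add: l_def)
  have ev: "eventually (\<lambda>n. (one_ratio (best_word \<alpha> n) - one_ratio (best_word \<beta> n)) * l \<le> C / real n) sequentially"
    using eventually_gt_at_top[of 0]
  proof eventually_elim
    case (elim n)
    define u v where "u = best_word \<alpha> n" and "v = best_word \<beta> n"
    have u: "length u = n" "jsr \<alpha> ^ n \<le> mass \<alpha> u" and v: "length v = n" "jsr \<beta> ^ n \<le> mass \<beta> v"
      using best_word \<alpha> \<beta> by (auto simp: u_def v_def)
    have cp: "upper_const \<alpha> > 0" "upper_const \<beta> > 0"
      using upper_const_bounds[OF \<alpha>] upper_const_bounds[OF \<beta>] by auto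
    have Mp: "mass 1 u > 0" "mass 1 v > 0" by (simp_all add: mass_pos)
    have "mass \<alpha> v \<le> upper_const \<alpha> * jsr \<alpha> ^ n" using mass_le_jsr[OF \<alpha>, of v] v(1) by simp
    also have "\<dots> \<le> upper_const \<alpha> * mass \<alpha> u" using u(2) cp by (intro mult_left_mono) auto
    finally have 1: "ln (mass \<alpha> v) \<le> ln (upper_const \<alpha> * mass \<alpha> u)"
      using mass_pos[of \<alpha>] \<alpha> cp by (subst ln_le_cancel_iff) auto
    have "mass \<beta> u \<le> upper_const \<beta> * jsr \<beta> ^ n" using mass_le_jsr[OF \<beta>, of u] u(1) by simp
    also have "\<dots> \<le> upper_const \<beta> * mass \<beta> v" using v(2) cp by (intro mult_left_mono) auto
    finally have 2: "ln (mass \<beta> u) \<le> ln (upper_const \<beta> * mass \<beta> v)"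
      using mass_pos[of \<beta>] \<beta> cp by (subst ln_le_cancel_iff) auto
    have ln_mass: "ln (mass x w) = real (ones w) * ln x + ln (mass 1 w)" if "x > 0" for x w
      using that mass_pos[of 1 w] by (subst mass_scale) (simp add: ln_mult ln_realpow)
    have "ln (upper_const \<alpha> * mass \<alpha> u) = ln (upper_const \<alpha>) + ln (mass \<alpha> u)"
      "ln (upper_const \<beta> * mass \<beta> v) = ln (upper_const \<beta>) + ln (mass \<beta> v)"
      using cp mass_pos[of \<alpha> u] mass_pos[of \<beta> v] \<alpha> \<beta> by (simp_all add: ln_mult)
    with 1 2 have "real (ones v) * ln \<alpha> + real (ones u) * ln \<beta> \<le> C + real (ones u) * ln \<alpha> + real (ones v) * ln \<beta>"
      using ln_mass[of \<alpha>] ln_mass[of \<beta>] assms by (simp add: C_def)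
    hence "(real (ones u) - real (ones v)) * l \<le> C" by (simp add: l_def algebra_simps)
    hence "(real (ones u) - real (ones v)) * l / real n \<le> C / real n" by (intro divide_right_mono) auto
    thus ?case by (simp add: one_ratio_def diff_divide_distrib left_diff_distrib u(1) v(1) flip: u_def v_def)
  qed
  have "(\<lambda>n. C / real n) \<longlonglongrightarrow> 0" by (rule lim_const_over_n)
  moreover have "(\<lambda>n. (one_ratio (best_word \<alpha> n) - one_ratio (best_word \<beta> n)) * l) \<longlonglongrightarrow> (opt_ratio \<alpha> - opt_ratio \<beta>) * l"
    by (intro tendsto_intros best_word_ratio \<alpha> \<beta>)
  ultimately have "(opt_ratio \<alpha> - opt_ratio \<beta>) * l \<le> 0" using ev by (simp add: tendsto_le[OF sequentially_bot])
  thus ?thesis using l by (simp add: mult_le_0_iff)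
qed

lemma opt_ratio_mono: "mono_on {0..1} opt_ratio"
proof (rule mono_onI)
  fix \<alpha> \<beta> :: real assume *: "\<alpha> \<in> {0..1}" "\<beta> \<in> {0..1}" "\<alpha> \<le> \<beta>"
  show "opt_ratio \<alpha> \<le> opt_ratio \<beta>"
  proof (cases "\<alpha> = 0")
    case True
    thus ?thesis using opt_ratio_range[OF *(2)] by (simp add: opt_ratio_def)
  next
    case False
    thus ?thesis using opt_ratio_mono_pos[of \<alpha> \<beta>] * by (cases "\<alpha> = \<beta>") auto
  qed
qed

text \<open>For \<open>\<alpha> = 1\<close> exchanging the letters preserves the mass.\<close>

lemma opt_ratio_one: "opt_ratio 1 = 1 / 2"
proof -
  have near: "near_extremal \<epsilon> 1 (map Not (best_word 1 n))" if "\<epsilon> > 0" for \<epsilon> n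
    using best_word_near_extremal[of 1 \<epsilon> n] that by (simp add: near_extremal_def mass_one_Not)
  have "(\<lambda>n. one_ratio (map Not (best_word 1 n))) \<longlonglongrightarrow> opt_ratio 1"
    using near best_word[of 1] by (intro opt_ratio_limit) auto
  moreover have compl: "one_ratio (map Not w) = 1 - one_ratio w" if "w \<noteq> []" for w
  proof -
    have "real (ones (map Not w)) = real (length w) - real (ones w)" using ones_map_Not[of w] by linarith
    thus ?thesis using that by (simp add: one_ratio_def diff_divide_distrib)
  qed
  have "eventually (\<lambda>n. one_ratio (map Not (best_word 1 n)) = 1 - one_ratio (best_word 1 n)) sequentially"
    using eventually_gt_at_top[of 0]
  proof eventually_elim
    case (elim n)
    have "length (best_word 1 n) = n" by (rule best_word(1)) simp
    with elim have "best_word 1 n \<noteq> []" by auto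
    thus ?case by (rule compl)
  qed
  hence "((\<lambda>n. one_ratio (map Not (best_word 1 n))) \<longlonglongrightarrow> opt_ratio 1)
    = ((\<lambda>n. 1 - one_ratio (best_word 1 n)) \<longlonglongrightarrow> opt_ratio 1)" by (rule tendsto_cong)
  ultimately have "(\<lambda>n. 1 - one_ratio (best_word 1 n)) \<longlonglongrightarrow> opt_ratio 1"
    by blast
  moreover have "(\<lambda>n. 1 - one_ratio (best_word 1 n)) \<longlonglongrightarrow> 1 - opt_ratio 1"
    by (intro tendsto_intros best_word_ratio) auto
  ultimately have "opt_ratio 1 = 1 - opt_ratio 1" by (rule LIMSEQ_unique)
  thus ?thesis by simp
qed

lemma opt_ratio_image: "opt_ratio ` {0..1} = {0..1/2}"
proof
  show "opt_ratio ` {0..1} \<subseteq> {0..1/2}"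
    using opt_ratio_range mono_onD[OF opt_ratio_mono, of _ 1] opt_ratio_one by fastforce
  show "{0..1/2} \<subseteq> opt_ratio ` {0..1}"
  proof
    fix y :: real assume "y \<in> {0..1/2}"
    moreover have "opt_ratio 0 = 0" by (simp add: opt_ratio_def)
    ultimately have "\<exists>x. 0 \<le> x \<and> x \<le> 1 \<and> opt_ratio x = y"
      using opt_ratio_one by (intro IVT' opt_ratio_continuous) auto
    thus "y \<in> opt_ratio ` {0..1}" by auto
  qed
qed

section \<open>Words of bounded discrepancy\<close>

definition window :: "inf_word \<Rightarrow> nat \<Rightarrow> nat \<Rightarrow> fin_word" where
  "window x i n = map x [i..<i + n]"

definition discrepancy :: "real \<Rightarrow> inf_word \<Rightarrow> nat \<Rightarrow> real" where
  "discrepancy \<gamma> x n = real (ones (word_prefix n x)) - \<gamma> * real n"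

text \<open>Strictness matters for rational \<open>\<gamma>\<close>: it excludes the balanced words that are not recurrent,
  which deviate by exactly one from the ratio on some window.\<close>

definition regular :: "real \<Rightarrow> inf_word \<Rightarrow> bool" where
  "regular \<gamma> x \<longleftrightarrow> (\<forall>i j. \<bar>discrepancy \<gamma> x (i + j) - discrepancy \<gamma> x i\<bar> < 1)"

lemma length_window [simp]: "length (window x i n) = n"
  by (simp add: window_def)

lemma length_word_prefix [simp]: "length (word_prefix n x) = n"
  by (simp add: word_prefix_def)

lemma word_prefix_eq_window: "word_prefix n x = window x 0 n"
  by (simp add: word_prefix_def window_def)

lemma window_append: "window x i (m + n) = window x i m @ window x (i + m) n"
  using upt_add_eq_append[of i "i + m" n] by (simp add: window_def add.assoc)

lemma take_drop_window: "i + j \<le> n \<Longrightarrow> take j (drop i (window x k n)) = window x (k + i) j"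
  by (simp add: window_def take_map drop_map)

lemma occurs_at_window: "occurs_at u x i \<longleftrightarrow> window x i (length u) = u"
  by (simp add: occurs_at_def window_def)

lemma window_in_subwords: "n > 0 \<Longrightarrow> window x i n \<in> subwords x"
proof -
  assume "n > 0"
  hence "length (window x i n) \<noteq> 0" by simp
  hence "window x i n \<noteq> []" by (metis list.size(3))
  moreover have "occurs_at (window x i n) x i" by (simp add: occurs_at_window)
  ultimately show ?thesis unfolding subwords_def by blast
qed

lemma ones_window_eq_prefix:
  "real (ones (window x i n)) = real (ones (word_prefix (i + n) x)) - real (ones (word_prefix i x))"
  by (simp add: word_prefix_eq_window window_append)

lemma discrepancy_window:
  "discrepancy \<gamma> x (i + n) - discrepancy \<gamma> x i = real (ones (window x i n)) - \<gamma> * real n"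
  by (simp add: discrepancy_def ones_window_eq_prefix algebra_simps)

lemma funpow_shift: "(shift ^^ k) x = (\<lambda>i. x (k + i))"
  by (induction k arbitrary: x) (simp_all add: shift_def funpow_swap1)

lemma window_shift: "window ((shift ^^ k) x) i n = window x (k + i) n"
  by (simp add: window_def funpow_shift list_eq_iff_nth_eq add.assoc)

lemma regular_iff_window:
  "regular \<gamma> x \<longleftrightarrow> (\<forall>i n. \<bar>real (ones (window x i n)) - \<gamma> * real n\<bar> < 1)"
  by (simp add: regular_def discrepancy_window)

lemma regular_shift: "regular \<gamma> x \<Longrightarrow> regular \<gamma> ((shift ^^ k) x)"
  by (simp add: regular_iff_window window_shift)

lemma regular_discrepancy:
  assumes "regular \<gamma> x" shows "\<bar>discrepancy \<gamma> x m - discrepancy \<gamma> x n\<bar> < 1"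
proof (cases "m \<le> n")
  case True
  thus ?thesis using assms unfolding regular_def by (metis abs_minus_commute le_add_diff_inverse)
next
  case False
  thus ?thesis using assms unfolding regular_def by (metis le_add_diff_inverse nat_le_linear)
qed

text \<open>Let \<open>p\<close> be a position in \<open>{..L}\<close> where the discrepancy of \<open>y\<close> is maximal, and let \<open>k\<close> be a
  position where the discrepancy of \<open>z\<close> is nearly maximal among its neighbours. Align \<open>p\<close> with
  \<open>k\<close>. The increments of the two discrepancies relative to \<open>p\<close> and \<open>k\<close> differ by an integer, and
  the upper bounds coming from the choice of \<open>p\<close> and \<open>k\<close> force it to be zero. The argument treats
  rational and irrational \<open>\<gamma>\<close> alike.\<close>

lemma window_occurs_in_regular:
  assumes y: "regular \<gamma> y" and z: "regular \<gamma> z"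
  shows "\<exists>m. window z m L = window y 0 L"
proof -
  define Dy Dz where "Dy = discrepancy \<gamma> y" and "Dz = discrepancy \<gamma> z"
  have Dz_lt: "\<bar>Dz m - Dz n\<bar> < 1" and Dy_lt: "\<bar>Dy m - Dy n\<bar> < 1" for m n
    using regular_discrepancy y z by (auto simp: Dy_def Dz_def)
  have ex_max: "\<exists>p\<in>{..L}. \<forall>n\<in>{..L}. f n \<le> f p" for f :: "nat \<Rightarrow> real"
    using Max_in[of "f ` {..L}"] Max_ge[of "f ` {..L}"] by fastforce
  obtain p where p: "p \<le> L" "\<And>n. n \<le> L \<Longrightarrow> Dy n \<le> Dy p" using ex_max[of Dy] by auto
  obtain q where q: "q \<le> L" "\<And>n. n \<le> L \<Longrightarrow> Dy q \<le> Dy n" using ex_max[of "\<lambda>n. - Dy n"] by auto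
  define h where "h = 1 - (Dy p - Dy q)"
  have h: "h > 0" using Dy_lt[of p q] by (simp add: h_def)
  \<comment> \<open>If no such position existed, the bounded discrepancy could be increased by \<open>h\<close> arbitrarily often.\<close>
  have "\<exists>k\<ge>L. \<forall>k'. k - L \<le> k' \<longrightarrow> Dz k' < Dz k + h"
  proof (rule ccontr)
    assume "\<not> ?thesis"
    hence step: "\<exists>k'\<ge>k - L. Dz k' \<ge> Dz k + h" if "k \<ge> L" for k using that by (meson not_less)
    have climb: "\<exists>k\<ge>M. Dz k \<ge> Dz 0 - 1 + real J * h" for J M
    proof (induction J arbitrary: M)
      case 0
      have "Dz M \<ge> Dz 0 - 1" using Dz_lt[of M 0] by linarith
      thus ?case by auto
    next
      case (Suc J)
      obtain k where k: "k \<ge> M + L" "Dz k \<ge> Dz 0 - 1 + real J * h" using Suc.IH by blast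
      obtain k' where "k' \<ge> k - L" "Dz k' \<ge> Dz k + h" using step[of k] k(1) by auto
      with k show ?case by (intro exI[of _ k']) (auto simp: algebra_simps)
    qed
    obtain J :: nat where "real J > 2 / h" using reals_Archimedean2 by blast
    hence "real J * h > 2" using h by (simp add: field_simps)
    moreover obtain k where "Dz k \<ge> Dz 0 - 1 + real J * h" using climb by blast
    moreover have "Dz k < Dz 0 + 1" using Dz_lt[of k 0] by linarith
    ultimately show False by linarith
  qed
  then obtain k where k: "k \<ge> L" "\<And>k'. k - L \<le> k' \<Longrightarrow> Dz k' < Dz k + h" by blast
  define m where "m = k - p"
  have km: "k = m + p" using k(1) p(1) by (simp add: m_def)
  define Sy Sz where "Sy n = int (ones (word_prefix n y))" and "Sz n = int (ones (word_prefix n z))" for n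
  have D: "Dy n = of_int (Sy n) - \<gamma> * real n" "Dz n = of_int (Sz n) - \<gamma> * real n" for n
    by (simp_all add: Dy_def Dz_def Sy_def Sz_def discrepancy_def)
  have eq: "Sz (m + n) - Sz k = Sy n - Sy p" if "n \<le> L" for n
  proof -
    define e f where "e = Dz (m + n) - Dz k" and "f = Dy n - Dy p"
    have "k - L \<le> m + n" using p(1) by (simp add: m_def)
    from k(2)[OF this] have "e < h" by (simp add: e_def)
    moreover have "f \<ge> h - 1" using q(2)[OF that] by (simp add: f_def h_def)
    moreover have "e > -1" using Dz_lt[of "m + n" k] by (simp add: e_def)
    moreover have "f \<le> 0" using p(2)[OF that] by (simp add: f_def)
    ultimately have "\<bar>e - f\<bar> < 1" by linarith
    moreover have "e - f = of_int ((Sz (m + n) - Sz k) - (Sy n - Sy p))"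
      unfolding e_def f_def D km by (simp add: algebra_simps)
    ultimately have "\<bar>(Sz (m + n) - Sz k) - (Sy n - Sy p)\<bar> < 1" by linarith
    thus ?thesis by linarith
  qed
  have "z (m + n) = y n" if "n < L" for n
  proof -
    have "Sz (m + Suc n) - Sz (m + n) = Sy (Suc n) - Sy n"
      using eq[of n] eq[of "Suc n"] that by simp
    thus ?thesis by (simp add: Sz_def Sy_def word_prefix_def split: if_splits)
  qed
  hence "window z m L = window y 0 L" by (simp add: window_def list_eq_iff_nth_eq)
  thus ?thesis by blast
qed

text \<open>If one increment over \<open>j\<close> steps exceeded one, then all increments over \<open>j\<close> steps would
  exceed a positive constant and \<open>E\<close> would grow linearly.\<close>

lemma sublinear_increment_le_1:
  fixes E :: "nat \<Rightarrow> real"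
  assumes bal: "\<And>i i' j. (E (i + j) - E i) - (E (i' + j) - E i') \<le> 1"
    and lim: "(\<lambda>n. E n / real n) \<longlonglongrightarrow> 0"
  shows "E (i + j) - E i \<le> 1"
proof (rule ccontr)
  assume large: "\<not> E (i + j) - E i \<le> 1"
  define \<epsilon> where "\<epsilon> = E (i + j) - E i - 1"
  have \<epsilon>: "\<epsilon> > 0" using large by (simp add: \<epsilon>_def)
  have j: "j > 0" using large by (cases j) auto
  have inc: "E (i' + j) - E i' \<ge> \<epsilon>" for i' using bal[of i j i'] by (simp add: \<epsilon>_def)
  have lower: "E (n * j) \<ge> E 0 + real n * \<epsilon>" for n
  proof (induction n)
    case (Suc n)
    have "E (Suc n * j) = E (n * j + j)" by (simp add: add.commute)
    with inc[of "n * j"] Suc.IH show ?case by (simp add: algebra_simps)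
  qed simp
  have "strict_mono (\<lambda>n. Suc n * j)" using j by (intro strict_monoI) simp
  from LIMSEQ_subseq_LIMSEQ[OF lim this] have "(\<lambda>n. E (Suc n * j) / real (Suc n * j)) \<longlonglongrightarrow> 0" by (simp add: o_def)
  moreover have "(\<lambda>n. (E 0 / real j) * inverse (real (Suc n)) + \<epsilon> / real j) \<longlonglongrightarrow> (E 0 / real j) * 0 + \<epsilon> / real j"
    by (intro tendsto_intros LIMSEQ_inverse_real_of_nat)
  moreover have "(E 0 / real j) * inverse (real (Suc n)) + \<epsilon> / real j \<le> E (Suc n * j) / real (Suc n * j)" for n
  proof -
    have "(E 0 / real j) * inverse (real (Suc n)) + \<epsilon> / real j = (E 0 + real (Suc n) * \<epsilon>) / real (Suc n * j)"
      unfolding of_nat_mult using j by (simp add: field_simps del: of_nat_Suc)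
    also have "\<dots> \<le> E (Suc n * j) / real (Suc n * j)" using lower[of "Suc n"] by (intro divide_right_mono) auto
    finally show ?thesis .
  qed
  ultimately have "(E 0 / real j) * 0 + \<epsilon> / real j \<le> 0" by (intro LIMSEQ_le) auto
  thus False using \<epsilon> j by (simp add: field_simps)
qed

text \<open>If an increment over \<open>j\<close> steps is one, then no increment over \<open>j\<close> steps is negative. Two
  positions in the same residue class modulo \<open>j\<close> with increment one would then add up to an
  increment of at least two.\<close>

lemma sublinear_increment_lt_1:
  fixes E :: "nat \<Rightarrow> real"
  assumes bal: "\<And>i i' j. (E (i + j) - E i) - (E (i' + j) - E i') \<le> 1"
    and lim: "(\<lambda>n. E n / real n) \<longlonglongrightarrow> 0"
    and inf: "infinite {i'. E (i' + j) - E i' = E (i + j) - E i}"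
  shows "E (i + j) - E i < 1"
proof (rule ccontr)
  assume "\<not> ?thesis"
  with sublinear_increment_le_1[OF bal lim, of i j] have 1: "E (i + j) - E i = 1" by linarith
  hence j: "j > 0" by (cases j) auto
  define I where "I = {i'. E (i' + j) - E i' = 1}"
  have "infinite I" using inf 1 by (simp add: I_def)
  moreover have "finite ((\<lambda>i. i mod j) ` I)"
    by (rule finite_subset[of _ "{..<j}"]) (use j in auto)
  ultimately obtain a where a: "infinite {b \<in> I. b mod j = a mod j}" using pigeonhole_infinite[of I "\<lambda>i. i mod j"] by blast
  hence "{b \<in> I. b mod j = a mod j} \<noteq> {}" by (rule infinite_imp_nonempty)
  then obtain b where b: "b \<in> I" "b mod j = a mod j" by blast
  from a obtain b' where b': "b' \<in> I" "b' mod j = a mod j" "b' > b"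
    unfolding infinite_nat_iff_unbounded by auto
  have "j dvd b' - b" using b(2) b'(2,3) by (metis less_imp_le_nat mod_eq_dvd_iff_nat)
  then obtain t where t: "b' - b = t * j" by (metis dvd_div_mult_self)
  hence t': "b' = b + t * j" "t > 0" using b'(3) by (cases "t = 0", auto)+
  have inc: "E (i' + j) - E i' \<ge> 0" for i' using bal[of i j i'] 1 by linarith
  have mono: "E (c + n * j) \<ge> E c" for c n
  proof (induction n)
    case (Suc n)
    have "c + Suc n * j = (c + n * j) + j" by simp
    with inc[of "c + n * j"] Suc.IH show ?case by (smt (verit))
  qed simp
  have "E (b + j) = E b + 1" "E (b' + j) = E b' + 1" using b(1) b'(1) by (auto simp: I_def)
  moreover have "E b' \<ge> E (b + j)"
  proof -
    have "b' = (b + j) + (t - 1) * j" using t' by (cases t) auto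
    thus ?thesis using mono[of "b + j" "t - 1"] by simp
  qed
  ultimately have "E (b' + j) - E b \<ge> 2" by linarith
  moreover have "b' + j = b + (t * j + j)" using t' by simp
  ultimately show False using sublinear_increment_le_1[OF bal lim, of b "t * j + j"] by simp
qed

text \<open>Recurrence of a regular word holds because its factors occur in each of its shifts, these being
  regular with the same ratio. For the converse, a balanced word with ratio \<open>\<gamma>\<close> has discrepancy
  increments of at most one; a window attaining this bound would by recurrence occur infinitely often.\<close>

lemma X_words_eq_regular: "X_words \<gamma> = {x. regular \<gamma> x}"
proof (intro equalityI subsetI)
  fix x assume "x \<in> X_words \<gamma>"
  hence rec: "recurrent x" and bal: "balanced x" and lim: "(\<lambda>n. one_ratio (word_prefix n x)) \<longlonglongrightarrow> \<gamma>"
    by (auto simp: X_words_def)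
  have eq: "discrepancy \<gamma> x n / real n = one_ratio (word_prefix n x) - \<gamma>" if "n > 0" for n
    using that by (simp add: discrepancy_def one_ratio_def diff_divide_distrib)
  have "(\<lambda>n. one_ratio (word_prefix n x) - \<gamma>) \<longlonglongrightarrow> \<gamma> - \<gamma>" by (intro tendsto_intros lim)
  moreover have "eventually (\<lambda>n. one_ratio (word_prefix n x) - \<gamma> = discrepancy \<gamma> x n / real n) sequentially"
    using eventually_gt_at_top[of 0] by eventually_elim (simp add: eq)
  ultimately have lim0: "(\<lambda>n. discrepancy \<gamma> x n / real n) \<longlonglongrightarrow> 0"
    by (auto elim: Lim_transform_eventually)
  have wb: "\<bar>real (ones (window x i n)) - real (ones (window x i' n))\<bar> \<le> 1" for i i' n
  proof (cases "n = 0")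
    case False
    have "\<bar>int (ones (window x i n)) - int (ones (window x i' n))\<bar> \<le> 1"
      using bal window_in_subwords[of n x i] window_in_subwords[of n x i'] False by (auto simp: balanced_def)
    thus ?thesis by linarith
  qed (simp add: window_def)
  have inf: "infinite {i'. window x i' n = window x i n}" if "n > 0" for i n
    using rec window_in_subwords[OF that, of x i] by (auto simp: recurrent_def occurs_at_window)
  have lt: "s * (discrepancy \<gamma> x (i + j) - discrepancy \<gamma> x i) < 1" if s: "s = 1 \<or> s = -1" for s i j
  proof (cases "j = 0")
    case False
    have "s * discrepancy \<gamma> x (i + j) - s * discrepancy \<gamma> x i < 1"
    proof (rule sublinear_increment_lt_1)
      show "(s * discrepancy \<gamma> x (i + j) - s * discrepancy \<gamma> x i)
        - (s * discrepancy \<gamma> x (i' + j) - s * discrepancy \<gamma> x i') \<le> 1" for i i' j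
        using wb[of i j i'] discrepancy_window[of \<gamma> x i j] discrepancy_window[of \<gamma> x i' j] s by auto
      show "(\<lambda>n. s * discrepancy \<gamma> x n / real n) \<longlonglongrightarrow> 0"
        using tendsto_mult[OF tendsto_const[of s] lim0] by simp
      have "{i'. window x i' j = window x i j} \<subseteq> {i'. s * discrepancy \<gamma> x (i' + j) - s * discrepancy \<gamma> x i' =
        s * discrepancy \<gamma> x (i + j) - s * discrepancy \<gamma> x i}"
        by (auto simp: discrepancy_window simp flip: right_diff_distrib)
      thus "infinite {i'. s * discrepancy \<gamma> x (i' + j) - s * discrepancy \<gamma> x i' =
        s * discrepancy \<gamma> x (i + j) - s * discrepancy \<gamma> x i}"
        using inf[of j i] False infinite_super by blast
    qed
    thus ?thesis by (simp add: right_diff_distrib)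
  qed simp
  have "\<bar>discrepancy \<gamma> x (i + j) - discrepancy \<gamma> x i\<bar> < 1" for i j
    using lt[of 1 i j] lt[of "-1" i j] by (simp add: abs_less_iff)
  thus "x \<in> {x. regular \<gamma> x}" by (simp add: regular_def)
next
  fix x assume "x \<in> {x. regular \<gamma> x}"
  hence reg: "regular \<gamma> x" by simp
  have "recurrent x" unfolding recurrent_def
  proof
    fix u assume "u \<in> subwords x"
    then obtain i where i: "window x i (length u) = u" by (auto simp: subwords_def occurs_at_window)
    have "\<exists>m\<ge>N. occurs_at u x m" for N
    proof -
      obtain m where "window ((shift ^^ N) x) m (length u) = window ((shift ^^ i) x) 0 (length u)"
        using window_occurs_in_regular[OF regular_shift[OF reg] regular_shift[OF reg]] by blast
      hence "occurs_at u x (N + m)" by (simp add: window_shift i occurs_at_window)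
      thus ?thesis by (metis le_add1)
    qed
    thus "infinite {i. occurs_at u x i}" unfolding infinite_nat_iff_unbounded_le by simp
  qed
  moreover have "balanced x" unfolding balanced_def
  proof (intro ballI impI)
    fix u v assume uv: "u \<in> subwords x" "v \<in> subwords x" "length u = length v"
    have one: "\<bar>real (ones w) - \<gamma> * real (length w)\<bar> < 1" if "w \<in> subwords x" for w
    proof -
      from that obtain i where "window x i (length w) = w" by (auto simp: subwords_def occurs_at_window)
      moreover have "\<bar>real (ones (window x i (length w))) - \<gamma> * real (length w)\<bar> < 1"
        using reg unfolding regular_iff_window by blast
      ultimately show ?thesis by simp
    qed
    have "\<bar>real (ones u) - \<gamma> * real (length u)\<bar> < 1" "\<bar>real (ones v) - \<gamma> * real (length u)\<bar> < 1"
      using one[OF uv(1)] one[OF uv(2)] uv(3) by simp_all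
    thus "\<bar>int (ones u) - int (ones v)\<bar> \<le> 1" by linarith
  qed
  moreover have "(\<lambda>n. one_ratio (word_prefix n x)) \<longlonglongrightarrow> \<gamma>"
  proof (rule LIMSEQ_I)
    fix e :: real assume e: "e > 0"
    obtain N :: nat where N: "real N > 1 / e" using reals_Archimedean2 by blast
    have "norm (one_ratio (word_prefix n x) - \<gamma>) < e" if "n \<ge> Suc N" for n
    proof -
      have n: "real n > 0" "1 / e < real n" using that N by auto
      have "\<bar>real (ones (word_prefix n x)) - \<gamma> * real n\<bar> < 1"
        using reg unfolding regular_iff_window word_prefix_eq_window by blast
      hence "\<bar>real (ones (word_prefix n x)) - \<gamma> * real n\<bar> / real n < 1 / real n" using n by (intro divide_strict_right_mono)
      moreover have "\<bar>real (ones (word_prefix n x)) - \<gamma> * real n\<bar> / real n = \<bar>one_ratio (word_prefix n x) - \<gamma>\<bar>"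
        using n by (simp add: one_ratio_def field_simps abs_if)
      moreover have "1 / real n < e" using n e by (simp add: field_simps)
      ultimately show ?thesis by simp
    qed
    thus "\<exists>no. \<forall>n\<ge>no. norm (one_ratio (word_prefix n x) - \<gamma>) < e" by blast
  qed
  ultimately show "x \<in> X_words \<gamma>" by (simp add: X_words_def)
qed

section \<open>Compactness\<close>

text \<open>Koenig's lemma for the binary tree.\<close>

lemma infinite_word_of_prefix_closed:
  assumes closed: "\<And>w n. P w \<Longrightarrow> P (take n w)" and long: "\<And>n. \<exists>w. length w = n \<and> P w"
  shows "\<exists>x. \<forall>n. P (word_prefix n x)"
proof -
  \<comment> \<open>\<open>E v\<close> says that \<open>v\<close> has arbitrarily long extensions satisfying \<open>P\<close>.\<close>
  define E where "E v \<longleftrightarrow> (\<forall>n. \<exists>w. n \<le> length w \<and> P w \<and> take (length v) w = v)" for v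
  have E_Nil: "E []" using long unfolding E_def by (metis length_0_conv order_refl take0 list.size(3))
  have E_step: "\<exists>b. E (v @ [b])" if v: "E v" for v
  proof (rule ccontr)
    assume "\<nexists>b. E (v @ [b])"
    then obtain n0 n1 where n: "\<And>w. n0 \<le> length w \<Longrightarrow> P w \<Longrightarrow> take (Suc (length v)) w \<noteq> v @ [False]"
      "\<And>w. n1 \<le> length w \<Longrightarrow> P w \<Longrightarrow> take (Suc (length v)) w \<noteq> v @ [True]"
      unfolding E_def by (metis length_append_singleton)
    obtain w where w: "max (Suc (length v)) (max n0 n1) \<le> length w" "P w" "take (length v) w = v"
      using v unfolding E_def by blast
    hence "take (Suc (length v)) w = v @ [w ! length v]" by (simp add: take_Suc_conv_app_nth)
    thus False using n[of w] w by (cases "w ! length v") auto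
  qed
  define next_word where "next_word v = v @ [SOME b. E (v @ [b])]" for v
  define V where "V n = (next_word ^^ n) []" for n
  have V_E: "E (V n)" for n
    by (induction n) (auto simp: V_def E_Nil next_word_def intro!: someI_ex[OF E_step])
  have V_Suc: "V (Suc n) = V n @ [last (V (Suc n))]" and V_len: "length (V n) = n" for n
    by (induction n) (auto simp: V_def next_word_def)
  define x where "x n = last (V (Suc n))" for n
  have "word_prefix n x = V n" for n
  proof (induction n)
    case (Suc n)
    have "word_prefix (Suc n) x = word_prefix n x @ [x n]" by (simp add: word_prefix_def)
    also have "\<dots> = V (Suc n)" unfolding Suc.IH x_def by (rule V_Suc[symmetric])
    finally show ?case .
  qed (simp add: word_prefix_def V_def)
  moreover have "P (V n)" for n using V_E[of n] closed unfolding E_def by (metis)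
  ultimately show ?thesis by (metis)
qed

definition regular_word :: "real \<Rightarrow> fin_word \<Rightarrow> bool" where
  "regular_word \<gamma> w \<longleftrightarrow> (\<forall>i j. i + j \<le> length w \<longrightarrow> \<bar>real (ones (take j (drop i w))) - \<gamma> * real j\<bar> < 1)"

lemma regular_word_take: "regular_word \<gamma> w \<Longrightarrow> regular_word \<gamma> (take n w)"
  unfolding regular_word_def by (auto simp: drop_take min_def)

lemma regular_of_prefixes:
  assumes "\<And>n. regular_word \<gamma> (word_prefix n x)" shows "regular \<gamma> x"
  unfolding regular_iff_window
proof (intro allI)
  fix i n
  have "take n (drop i (word_prefix (i + n) x)) = window x i n"
    using take_drop_window[of i n "i + n" x 0] by (simp add: word_prefix_eq_window)
  with assms[of "i + n"] show "\<bar>real (ones (window x i n)) - \<gamma> * real n\<bar> < 1"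
    unfolding regular_word_def by (metis length_word_prefix order_refl)
qed

text \<open>Otherwise there would be arbitrarily long regular words whose prefix of length \<open>l\<close> belongs to no
  regular infinite word, and a limit of them would be such an infinite word itself.\<close>

lemma regular_word_prefix_extends:
  "\<exists>L\<ge>l. \<forall>w. length w = L \<longrightarrow> regular_word \<gamma> w \<longrightarrow> (\<exists>y. regular \<gamma> y \<and> word_prefix l y = take l w)"
proof (rule ccontr)
  assume contra: "\<not> ?thesis"
  define P where "P w \<longleftrightarrow> regular_word \<gamma> w \<and> (l \<le> length w \<longrightarrow> \<not> (\<exists>y. regular \<gamma> y \<and> word_prefix l y = take l w))" for w
  have closed: "P (take n w)" if "P w" for w n
    using that by (auto simp: P_def regular_word_take min_def split: if_splits)
  have "\<exists>w. length w = n \<and> P w" for n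
  proof -
    obtain w where w: "length w = max n l" "regular_word \<gamma> w" "\<not> (\<exists>y. regular \<gamma> y \<and> word_prefix l y = take l w)"
      using contra by (metis max.cobounded2)
    hence "P w" by (simp add: P_def)
    hence "P (take n w)" by (rule closed)
    thus ?thesis using w(1) by (intro exI[of _ "take n w"]) simp
  qed
  from infinite_word_of_prefix_closed[OF closed this] obtain x where x: "\<And>n. P (word_prefix n x)" by blast
  hence "regular \<gamma> x" by (intro regular_of_prefixes) (simp add: P_def)
  moreover have "take l (word_prefix l x) = word_prefix l x" by simp
  ultimately show False using x[of l] unfolding P_def by (metis length_word_prefix order_refl)
qed

section \<open>Density of irregular windows\<close>

definition zero_density :: "nat set \<Rightarrow> bool" where
  "zero_density A \<longleftrightarrow> (\<lambda>n. real (card (A \<inter> {..<n})) / real n) \<longlonglongrightarrow> 0"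

lemma zero_densityI:
  assumes "\<And>e. e > 0 \<Longrightarrow> eventually (\<lambda>n. real (card (A \<inter> {..<n})) \<le> e * real n) sequentially"
  shows "zero_density A"
  unfolding zero_density_def
proof (rule tendstoI)
  fix e :: real assume e: "e > 0"
  have "eventually (\<lambda>n. real (card (A \<inter> {..<n})) \<le> e / 2 * real n) sequentially" using assms[of "e / 2"] e by simp
  thus "eventually (\<lambda>n. dist (real (card (A \<inter> {..<n})) / real n) 0 < e) sequentially"
    using eventually_gt_at_top[of 0]
  proof eventually_elim
    case (elim n)
    hence "real (card (A \<inter> {..<n})) / real n \<le> e / 2" by (simp add: field_simps)
    also have "\<dots> < e" using e by simp
    finally show ?case by simp
  qed
qed

lemma zero_density_subset: "zero_density B \<Longrightarrow> A \<subseteq> B \<Longrightarrow> zero_density A"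
  unfolding zero_density_def
  by (erule tendsto_sandwich[OF _ _ tendsto_const, rotated 2])
    (auto intro!: always_eventually divide_right_mono card_mono)

lemma zero_density_UN:
  assumes "finite I" "\<And>i. i \<in> I \<Longrightarrow> zero_density (A i)" shows "zero_density (\<Union>i\<in>I. A i)"
  unfolding zero_density_def
proof (rule tendsto_sandwich[OF _ _ tendsto_const])
  show "(\<lambda>n. \<Sum>i\<in>I. real (card (A i \<inter> {..<n})) / real n) \<longlonglongrightarrow> 0"
    using tendsto_sum[of I "\<lambda>i n. real (card (A i \<inter> {..<n})) / real n" "\<lambda>_. 0"] assms(2)
    by (simp add: zero_density_def)
  have "card ((\<Union>i\<in>I. A i) \<inter> {..<n}) \<le> (\<Sum>i\<in>I. card (A i \<inter> {..<n}))" for n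
    using card_UN_le[OF assms(1), of "\<lambda>i. A i \<inter> {..<n}"] by (simp add: Int_UN_distrib2)
  hence "real (card ((\<Union>i\<in>I. A i) \<inter> {..<n})) \<le> (\<Sum>i\<in>I. real (card (A i \<inter> {..<n})))" for n
    by (metis of_nat_mono of_nat_sum)
  thus "eventually (\<lambda>n. real (card ((\<Union>i\<in>I. A i) \<inter> {..<n})) / real n \<le> (\<Sum>i\<in>I. real (card (A i \<inter> {..<n})) / real n)) sequentially"
    by (auto intro!: always_eventually divide_right_mono simp flip: sum_divide_distrib)
qed simp

lemma zero_density_shift:
  assumes "zero_density A" shows "zero_density {k. k + i \<in> A}"
proof (rule zero_densityI)
  fix e :: real assume e: "e > 0"
  have "eventually (\<lambda>n. real (card (A \<inter> {..<n})) / real n < e / 2) sequentially"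
    by (rule order_tendstoD(2)[OF assms[unfolded zero_density_def]]) (use e in simp)
  hence "eventually (\<lambda>n. real (card (A \<inter> {..<n})) / real n < e / 2 \<and> n > 0) sequentially"
    using eventually_gt_at_top[of 0] by eventually_elim simp
  hence "eventually (\<lambda>n. real (card (A \<inter> {..<n + i})) / real (n + i) < e / 2 \<and> n + i > 0) sequentially"
    by (subst (asm) eventually_sequentially_seg[of _ i, symmetric]) simp
  thus "eventually (\<lambda>n. real (card ({k. k + i \<in> A} \<inter> {..<n})) \<le> e * real n) sequentially"
    using eventually_ge_at_top[of i]
  proof eventually_elim
    case (elim n)
    have "card ({k. k + i \<in> A} \<inter> {..<n}) = card ((\<lambda>k. k + i) ` ({k. k + i \<in> A} \<inter> {..<n}))"
      by (rule card_image[symmetric]) (auto simp: inj_on_def)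
    also have "\<dots> \<le> card (A \<inter> {..<n + i})" by (intro card_mono) auto
    finally have "real (card ({k. k + i \<in> A} \<inter> {..<n})) \<le> real (card (A \<inter> {..<n + i}))" by (rule of_nat_mono)
    also have "real (card (A \<inter> {..<n + i})) < e / 2 * real (n + i)"
    proof -
      have "0 < real (n + i)" using elim(1) of_nat_0_less_iff by blast
      thus ?thesis using elim(1) by (simp only: pos_divide_less_eq)
    qed
    also have "e / 2 * real (n + i) \<le> e / 2 * (2 * real n)" using elim(2) e by (intro mult_left_mono) auto
    finally show ?case by simp
  qed
qed

lemma not_zero_density_UNIV: "\<not> zero_density UNIV"
proof
  assume "zero_density UNIV"
  hence "(\<lambda>n. real n / real n) \<longlonglongrightarrow> 0" by (simp add: zero_density_def)
  moreover have "(\<lambda>n. real n / real n) \<longlonglongrightarrow> 1"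
    by (rule tendsto_eventually) (use eventually_gt_at_top[of 0] in \<open>eventually_elim, simp\<close>)
  ultimately show False using LIMSEQ_unique zero_neq_one by blast
qed

section \<open>Extremal words\<close>

lemma weakly_extremal_near:
  assumes \<alpha>: "\<alpha> \<in> {0<..1}" and weak: "weakly_extremal \<alpha> x" and \<epsilon>: "\<epsilon> > 0"
  shows "eventually (\<lambda>n. near_extremal \<epsilon> \<alpha> (word_prefix n x)) sequentially"
proof -
  have \<rho>: "jsr \<alpha> > 1" by (rule jsr_gt_1[OF \<alpha>])
  have "exp (- \<epsilon>) * jsr \<alpha> < jsr \<alpha>" using \<rho> \<epsilon> by simp
  hence "eventually (\<lambda>n. exp (- \<epsilon>) * jsr \<alpha> < root n (op_norm (cocycle \<alpha> x n))) sequentially"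
    using weak order_tendstoD(1) unfolding weakly_extremal_def by blast
  thus ?thesis using eventually_gt_at_top[of 0]
  proof eventually_elim
    case (elim n)
    have "exp (- \<epsilon> * real n) * jsr \<alpha> ^ n = (exp (- \<epsilon>) * jsr \<alpha>) ^ n"
      by (simp add: power_mult_distrib mult.commute flip: exp_of_nat_mult)
    also have "\<dots> \<le> root n (op_norm (cocycle \<alpha> x n)) ^ n"
      using elim(1) \<rho> by (intro power_mono) auto
    also have "\<dots> = op_norm (cocycle \<alpha> x n)" using elim(2) op_norm_nonneg by simp
    also have "\<dots> \<le> mass \<alpha> (word_prefix n x)" using mass_cocycle(2)[of \<alpha>] \<alpha> by auto
    finally show ?case by (simp add: near_extremal_def)
  qed
qed

lemma weakly_extremal_ratio:
  assumes \<alpha>: "\<alpha> \<in> {0<..1}" and weak: "weakly_extremal \<alpha> x"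
  shows "(\<lambda>n. one_ratio (word_prefix n x)) \<longlonglongrightarrow> opt_ratio \<alpha>"
  using weakly_extremal_near[OF assms] by (intro opt_ratio_limit[OF \<alpha>]) auto

lemma strongly_imp_weakly_extremal:
  assumes \<alpha>: "\<alpha> \<in> {0<..1}" and strong: "strongly_extremal \<alpha> x"
  shows "weakly_extremal \<alpha> x"
proof -
  define c \<rho> where "c = upper_const \<alpha>" and "\<rho> = jsr \<alpha>"
  have \<rho>: "\<rho> > 1" and c: "c > 1" using jsr_gt_1[OF \<alpha>] upper_const_bounds[OF \<alpha>] by (auto simp: \<rho>_def c_def)
  from strong obtain \<delta> where \<delta>: "\<delta> > 0" "\<And>n. n \<ge> 1 \<Longrightarrow> \<delta> * \<rho> ^ n \<le> op_norm (cocycle \<alpha> x n)"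
    unfolding strongly_extremal_def \<rho>_def by blast
  have root_lim: "(\<lambda>n. a powr (1 / real n) * \<rho>) \<longlonglongrightarrow> \<rho>" if "a > 0" for a
  proof -
    have "(\<lambda>n. 1 / real n) \<longlonglongrightarrow> 0" by (rule lim_1_over_n)
    hence "(\<lambda>n. a powr (1 / real n) * \<rho>) \<longlonglongrightarrow> a powr 0 * \<rho>" using that by (intro tendsto_intros) auto
    thus ?thesis using that by simp
  qed
  have root_eq: "root n (a * \<rho> ^ n) = a powr (1 / real n) * \<rho>" if "a > 0" "n > 0" for a n
  proof -
    have "root n (a * \<rho> ^ n) = root n a * root n (\<rho> ^ n)" by (rule real_root_mult)
    moreover have "root n (\<rho> ^ n) = \<rho>" using that \<rho> by (intro real_root_power_cancel) auto
    moreover have "root n a = a powr (1 / real n)" using that by (intro root_powr_inverse) auto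
    ultimately show ?thesis by simp
  qed
  have "(\<lambda>n. root n (op_norm (cocycle \<alpha> x n))) \<longlonglongrightarrow> \<rho>"
  proof (rule tendsto_sandwich[OF _ _ root_lim root_lim])
    show "eventually (\<lambda>n. \<delta> powr (1 / real n) * \<rho> \<le> root n (op_norm (cocycle \<alpha> x n))) sequentially"
      using eventually_gt_at_top[of 0]
      by eventually_elim (use \<delta> in \<open>simp flip: root_eq\<close>)
    show "eventually (\<lambda>n. root n (op_norm (cocycle \<alpha> x n)) \<le> c powr (1 / real n) * \<rho>) sequentially"
      using eventually_gt_at_top[of 0]
    proof eventually_elim
      case (elim n)
      have "op_norm (cocycle \<alpha> x n) \<le> c * \<rho> ^ n"
        using mass_cocycle(2)[of \<alpha> x n] mass_le_jsr[OF \<alpha>, of "word_prefix n x"] \<alpha> by (simp add: c_def \<rho>_def)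
      thus ?case using elim c by (simp flip: root_eq)
    qed
  qed (use \<delta> c in auto)
  thus ?thesis by (simp add: weakly_extremal_def \<rho>_def)
qed

text \<open>Outside \<open>B\<close> the deviations lie within one of each other. If one of them is at least one, then
  all are nonnegative there, so the number of large ones is bounded by their sum; likewise with the
  opposite sign.\<close>

lemma window_deviation_count:
  fixes e :: "nat \<Rightarrow> real"
  assumes "finite T" "B \<subseteq> T"
    and close: "\<And>i i'. i \<in> T - B \<Longrightarrow> i' \<in> T - B \<Longrightarrow> e i \<le> e i' + 1"
    and bnd: "\<And>i. i \<in> T \<Longrightarrow> \<bar>e i\<bar> \<le> K" and K: "K \<ge> 1"
  shows "real (card {i \<in> T. 1 \<le> \<bar>e i\<bar>}) \<le> \<bar>\<Sum>i\<in>T. e i\<bar> + 2 * K * real (card B)"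
proof -
  define D where "D = {i \<in> T - B. 1 \<le> \<bar>e i\<bar>}"
  have fin: "finite B" "finite D" using assms(1,2) finite_subset by (auto simp: D_def)
  have "{i \<in> T. 1 \<le> \<bar>e i\<bar>} \<subseteq> D \<union> B" by (auto simp: D_def)
  hence "card {i \<in> T. 1 \<le> \<bar>e i\<bar>} \<le> card (D \<union> B)" using fin by (intro card_mono) auto
  also have "\<dots> \<le> card D + card B" by (rule card_Un_le)
  finally have count: "real (card {i \<in> T. 1 \<le> \<bar>e i\<bar>}) \<le> real (card D) + real (card B)"
    by (metis of_nat_add of_nat_mono)
  have sumB: "\<bar>\<Sum>i\<in>B. e i\<bar> \<le> K * real (card B)"
  proof -
    have "\<bar>\<Sum>i\<in>B. e i\<bar> \<le> (\<Sum>i\<in>B. \<bar>e i\<bar>)" by (rule sum_abs)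
    also have "\<dots> \<le> (\<Sum>i\<in>B. K)" using bnd assms(2) by (intro sum_mono) auto
    finally show ?thesis by (simp add: mult.commute)
  qed
  have split: "(\<Sum>i\<in>T. e i) = (\<Sum>i\<in>T - B. e i) + (\<Sum>i\<in>B. e i)"
    using assms(1,2) by (simp add: sum.subset_diff)
  have sign: "real (card D) \<le> s * (\<Sum>i\<in>T - B. e i)"
    if s: "s = 1 \<or> s = -1" and i0: "i0 \<in> T - B" "s * e i0 \<ge> 1" for s i0
  proof -
    have nonneg: "s * e i \<ge> 0" if "i \<in> T - B" for i
      using close[OF i0(1) that] close[OF that i0(1)] i0(2) s by auto
    have "real (card D) = (\<Sum>i\<in>D. 1)" by simp
    also have "\<dots> \<le> (\<Sum>i\<in>D. s * e i)"
    proof (rule sum_mono)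
      fix i assume "i \<in> D"
      hence "i \<in> T - B" "1 \<le> \<bar>e i\<bar>" by (auto simp: D_def)
      with nonneg[of i] s show "1 \<le> s * e i" by auto
    qed
    also have "\<dots> \<le> (\<Sum>i\<in>T - B. s * e i)"
      using nonneg assms(1) by (intro sum_mono2) (auto simp: D_def)
    finally show ?thesis by (simp add: sum_distrib_left)
  qed
  have "real (card D) \<le> \<bar>\<Sum>i\<in>T - B. e i\<bar>"
  proof (cases "D = {}")
    case False
    then obtain i0 where "i0 \<in> T - B" "1 \<le> \<bar>e i0\<bar>" by (auto simp: D_def)
    thus ?thesis using sign[of 1 i0] sign[of "-1" i0] by (auto simp: abs_if split: if_splits)
  qed simp
  also have "\<dots> \<le> \<bar>\<Sum>i\<in>T. e i\<bar> + K * real (card B)" using split sumB by linarith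
  finally show ?thesis using count K mult_right_mono[of 1 K "real (card B)"] by simp
qed

text \<open>In a long prefix almost all windows of length \<open>j\<close> are mutually balanced, while the mean of
  their numbers of ones is close to \<open>opt_ratio \<alpha> * j\<close>.\<close>

lemma irregular_windows_zero_density_fixed_length:
  assumes \<alpha>: "\<alpha> \<in> {0<..1}" and weak: "weakly_extremal \<alpha> x"
  shows "zero_density {i. 1 \<le> \<bar>real (ones (window x i j)) - opt_ratio \<alpha> * real j\<bar>}"
proof (cases "j = 0")
  case True
  thus ?thesis by (simp add: window_def zero_density_def)
next
  case False
  define r where "r = opt_ratio \<alpha>"
  have r: "0 \<le> r" "r \<le> 1" using opt_ratio_range[of \<alpha>] \<alpha> by (auto simp: r_def)
  define e where "e i = real (ones (window x i j)) - r * real j" for i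
  have j: "real j \<ge> 1" using False by simp
  show ?thesis
  proof (rule zero_densityI)
    fix \<eta> :: real assume \<eta>: "\<eta> > 0"
    define \<epsilon> where "\<epsilon> = \<eta> / (6 * real j)"
    have \<epsilon>: "\<epsilon> > 0" using \<eta> j by (simp add: \<epsilon>_def)
    from typical_windows[OF \<alpha> \<epsilon>, of j] obtain \<epsilon>' n0 where \<epsilon>': "\<epsilon>' > 0"
      and windows: "\<And>w. n0 \<le> length w \<Longrightarrow> near_extremal \<epsilon>' \<alpha> w \<Longrightarrow>
        (\<exists>G. (\<forall>g\<in>G. length g = j) \<and> mutually_balanced G \<and>
        real (card (bad_windows j G w)) \<le> \<epsilon> * real (length w))" by blast
    have ev_ratio: "eventually (\<lambda>n. dist (one_ratio (word_prefix n x)) r < \<epsilon>) sequentially"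
      unfolding r_def by (rule tendstoD[OF weakly_extremal_ratio[OF \<alpha> weak] \<epsilon>])
    obtain n1 :: nat where n1: "real n1 > (4 * (real j)\<^sup>2 + real j) / (\<eta> / 2)" using reals_Archimedean2 by blast
    from weakly_extremal_near[OF \<alpha> weak \<epsilon>'] ev_ratio eventually_ge_at_top[of n0] eventually_ge_at_top[of n1]
      eventually_ge_at_top[of j] eventually_gt_at_top[of 0]
    show "eventually (\<lambda>n. real (card ({i. 1 \<le> \<bar>real (ones (window x i j)) - opt_ratio \<alpha> * real j\<bar>} \<inter> {..<n})) \<le> \<eta> * real n) sequentially"
    proof eventually_elim
      case (elim n)
      define w where "w = word_prefix n x"
      have lenw: "length w = n" by (simp add: w_def)
      obtain G where G: "\<And>g. g \<in> G \<Longrightarrow> length g = j" "mutually_balanced G"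
        "real (card (bad_windows j G w)) \<le> \<epsilon> * real n"
        using windows[of w] elim(1,3) by (auto simp: w_def)
      define N where "N = n - j + 1"
      have N: "N \<le> n" "n \<le> N + j" "real N = real n - real j + 1" using elim(5) False by (auto simp: N_def of_nat_diff)
      have win: "take j (drop i w) = window x i j" if "i < N" for i
        using take_drop_window[of i j n x 0] that elim(5) by (simp add: w_def word_prefix_eq_window N_def)
      have bad: "bad_windows j G w = {i. i < N \<and> window x i j \<notin> G}"
        using win elim(5) by (auto simp: bad_windows_def lenw N_def)
      have "real (card {i \<in> {..<N}. 1 \<le> \<bar>e i\<bar>}) \<le> \<bar>\<Sum>i\<in>{..<N}. e i\<bar> + 2 * real j * real (card (bad_windows j G w))"
      proof (rule window_deviation_count)
        show "bad_windows j G w \<subseteq> {..<N}" by (auto simp: bad)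
        fix i i' assume "i \<in> {..<N} - bad_windows j G w" "i' \<in> {..<N} - bad_windows j G w"
        hence "window x i j \<in> G" "window x i' j \<in> G" by (auto simp: bad)
        hence "ones (window x i j) \<le> ones (window x i' j) + 1"
          using G(2) unfolding mutually_balanced_def by (metis length_window sublist_order.order_refl)
        thus "e i \<le> e i' + 1" by (simp add: e_def)
      next
        fix i
        have "real (ones (window x i j)) \<le> real j" using ones_le_length[of "window x i j"] by simp
        moreover have "r * real j \<le> 1 * real j" by (rule mult_right_mono) (use r in auto)
        moreover have "0 \<le> r * real j" using r by simp
        ultimately show "\<bar>e i\<bar> \<le> real j" by (simp add: e_def)
      qed (use j in auto)
      also have "2 * real j * real (card (bad_windows j G w)) \<le> 2 * real j * (\<epsilon> * real n)"
        using G(3) by (intro mult_left_mono) auto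
      also have "\<bar>\<Sum>i\<in>{..<N}. e i\<bar> \<le> real j * (\<epsilon> * real n) + 4 * (real j)\<^sup>2"
      proof -
        define S where "S = (\<Sum>i<N. real (ones (window x i j)))"
        have "S = (\<Sum>i<N. real (ones (take j (drop i w))))" unfolding S_def using win by (intro sum.cong) auto
        hence S: "real j * real (ones w) - 2 * (real j)\<^sup>2 \<le> S" "S \<le> real j * real (ones w)"
          using window_count_bounds[of j w] elim(5) False by (simp_all add: lenw N_def)
        have "(\<Sum>i\<in>{..<N}. e i) = S - r * real j * real N" by (simp add: e_def S_def sum_subtractf)
        moreover have "\<bar>real (ones w) - r * real n\<bar> \<le> \<epsilon> * real n"
        proof -
          have "\<bar>real (ones w) / real n - r\<bar> \<le> \<epsilon>" using elim(2) by (simp add: dist_real_def one_ratio_def lenw flip: w_def)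
          hence "\<bar>real (ones w) / real n - r\<bar> * real n \<le> \<epsilon> * real n" by (intro mult_right_mono) auto
          moreover have "\<bar>real (ones w) / real n - r\<bar> * real n = \<bar>(real (ones w) / real n - r) * real n\<bar>" by (simp add: abs_mult)
          ultimately show ?thesis using elim(6) by (simp add: left_diff_distrib)
        qed
        hence "real j * \<bar>real (ones w) - r * real n\<bar> \<le> real j * (\<epsilon> * real n)" by (intro mult_left_mono) auto
        then have "\<bar>real j * real (ones w) - r * real j * real n\<bar> \<le> real j * (\<epsilon> * real n)"
        proof -
          have "real j * real (ones w) - r * real j * real n = real j * (real (ones w) - r * real n)"
            by (simp add: algebra_simps)
          hence "\<bar>real j * real (ones w) - r * real j * real n\<bar> = real j * \<bar>real (ones w) - r * real n\<bar>"
            by (simp add: abs_mult)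
          thus ?thesis using \<open>real j * \<bar>real (ones w) - r * real n\<bar> \<le> real j * (\<epsilon> * real n)\<close> by linarith
        qed
        moreover have "\<bar>r * real j * real n - r * real j * real N\<bar> \<le> (real j)\<^sup>2"
        proof -
          have "r * real j * real n - r * real j * real N = r * real j * (real j - 1)"
            unfolding N(3) by (simp add: algebra_simps)
          moreover have "0 \<le> r * real j * (real j - 1)" using r j by (intro mult_nonneg_nonneg) auto
          moreover have "r * real j * (real j - 1) \<le> 1 * real j * real j" using r j by (intro mult_mono) auto
          ultimately show ?thesis by (simp add: power2_eq_square)
        qed
        ultimately show ?thesis using S zero_le_power2[of "real j"] by linarith
      qed
      finally have "real (card {i \<in> {..<N}. 1 \<le> \<bar>e i\<bar>}) \<le> 3 * real j * \<epsilon> * real n + 4 * (real j)\<^sup>2"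
        by (simp add: mult_ac)
      moreover have "3 * real j * \<epsilon> = \<eta> / 2" using j by (simp add: \<epsilon>_def)
      moreover have "card ({i. 1 \<le> \<bar>e i\<bar>} \<inter> {..<n}) \<le> card {i \<in> {..<N}. 1 \<le> \<bar>e i\<bar>} + j"
      proof -
        have "{i. 1 \<le> \<bar>e i\<bar>} \<inter> {..<n} \<subseteq> {i \<in> {..<N}. 1 \<le> \<bar>e i\<bar>} \<union> {N..<N + j}" using N(2) by auto
        hence "card ({i. 1 \<le> \<bar>e i\<bar>} \<inter> {..<n}) \<le> card ({i \<in> {..<N}. 1 \<le> \<bar>e i\<bar>} \<union> {N..<N + j})"
          by (intro card_mono) auto
        also have "\<dots> \<le> card {i \<in> {..<N}. 1 \<le> \<bar>e i\<bar>} + card {N..<N + j}" by (rule card_Un_le)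
        finally show ?thesis by simp
      qed
      moreover have "4 * (real j)\<^sup>2 + real j \<le> \<eta> / 2 * real n"
      proof -
        have "(4 * (real j)\<^sup>2 + real j) / (\<eta> / 2) < real n" using n1 elim(4) by linarith
        thus ?thesis using \<eta> by (simp add: field_simps)
      qed
      ultimately have "real (card ({i. 1 \<le> \<bar>e i\<bar>} \<inter> {..<n})) \<le> \<eta> * real n" by simp
      thus ?case by (simp add: e_def r_def)
    qed
  qed
qed

lemma irregular_windows_zero_density:
  assumes \<alpha>: "\<alpha> \<in> {0<..1}" and weak: "weakly_extremal \<alpha> x"
  shows "zero_density {k. \<not> regular_word (opt_ratio \<alpha>) (window x k L)}"
proof (rule zero_density_subset)
  define Bad where "Bad j = {i. 1 \<le> \<bar>real (ones (window x i j)) - opt_ratio \<alpha> * real j\<bar>}" for j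
  show "zero_density (\<Union>i\<in>{..L}. \<Union>j\<in>{..L}. {k. k + i \<in> Bad j})"
    unfolding Bad_def
    by (intro zero_density_UN zero_density_shift irregular_windows_zero_density_fixed_length assms finite_atMost)
  show "{k. \<not> regular_word (opt_ratio \<alpha>) (window x k L)} \<subseteq> (\<Union>i\<in>{..L}. \<Union>j\<in>{..L}. {k. k + i \<in> Bad j})"
  proof
    fix k assume "k \<in> {k. \<not> regular_word (opt_ratio \<alpha>) (window x k L)}"
    then obtain i j where ij: "i + j \<le> L"
      "\<not> \<bar>real (ones (take j (drop i (window x k L)))) - opt_ratio \<alpha> * real j\<bar> < 1"
      by (auto simp: regular_word_def)
    hence "k + i \<in> Bad j" by (simp add: Bad_def take_drop_window not_less)
    moreover have "i \<le> L" "j \<le> L" using ij(1) by auto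
    ultimately show "k \<in> (\<Union>i\<in>{..L}. \<Union>j\<in>{..L}. {k. k + i \<in> Bad j})" by blast
  qed
qed

text \<open>The constant is the loss incurred by cutting a factor out of an optimal word, namely
  \<open>upper_const \<alpha>\<close> for each of the two remaining pieces.\<close>

definition thick :: "real \<Rightarrow> fin_word \<Rightarrow> bool" where
  "thick \<alpha> w \<longleftrightarrow> (\<forall>v. sublist v w \<longrightarrow> jsr \<alpha> ^ length v \<le> (upper_const \<alpha>)\<^sup>2 * mass \<alpha> v)"

lemma thick_sublist: "thick \<alpha> w \<Longrightarrow> sublist v w \<Longrightarrow> thick \<alpha> v"
  unfolding thick_def using sublist_order.order_trans by blast

lemma best_word_thick:
  assumes \<alpha>: "\<alpha> \<in> {0<..1}" shows "thick \<alpha> (best_word \<alpha> n)"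
  unfolding thick_def
proof (intro allI impI)
  fix v assume "sublist v (best_word \<alpha> n)"
  then obtain a b where w: "best_word \<alpha> n = a @ v @ b" by (auto simp: sublist_def)
  define c \<rho> where "c = upper_const \<alpha>" and "\<rho> = jsr \<alpha>"
  have \<rho>: "\<rho> > 1" and c: "c > 1" using jsr_gt_1[OF \<alpha>] upper_const_bounds[OF \<alpha>] by (auto simp: \<rho>_def c_def)
  note nn = mass_nonneg[of \<alpha>]
  have "length (best_word \<alpha> n) = n" "\<rho> ^ n \<le> mass \<alpha> (best_word \<alpha> n)"
    using best_word[of \<alpha> n] \<alpha> by (auto simp: \<rho>_def)
  hence "\<rho> ^ (length a + length v + length b) \<le> mass \<alpha> (a @ v @ b)" by (auto simp: w add.assoc)
  also have "\<dots> \<le> mass \<alpha> a * (mass \<alpha> v * mass \<alpha> b)"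
    using nn \<alpha> by (intro order_trans[OF mass_append_le] mult_left_mono) auto
  also have "\<dots> \<le> (c * \<rho> ^ length a) * (mass \<alpha> v * (c * \<rho> ^ length b))"
    using mass_le_jsr[OF \<alpha>] nn \<alpha> c \<rho> unfolding c_def \<rho>_def by (intro mult_mono mult_left_mono mult_nonneg_nonneg) auto
  finally have "\<rho> ^ length v * (\<rho> ^ length a * \<rho> ^ length b) \<le> (c\<^sup>2 * mass \<alpha> v) * (\<rho> ^ length a * \<rho> ^ length b)"
    by (simp add: power_add power2_eq_square mult_ac)
  thus "jsr \<alpha> ^ length v \<le> (upper_const \<alpha>)\<^sup>2 * mass \<alpha> v"
    using \<rho> by (simp add: c_def \<rho>_def)
qed

lemma sublist_window: "i + j \<le> n \<Longrightarrow> sublist (window x (k + i) j) (window x k n)"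
  using take_drop_window[of i j n x k] by (metis sublist_order.order_trans sublist_drop sublist_take)

lemma thick_word_strongly_extremal:
  assumes \<alpha>: "\<alpha> \<in> {0<..1}" and thick: "\<And>n. thick \<alpha> (word_prefix n x)"
  shows "strongly_extremal \<alpha> x"
proof -
  have c: "upper_const \<alpha> > 1" using upper_const_bounds[OF \<alpha>] by auto
  have *: "jsr \<alpha> ^ n \<le> 4 * (upper_const \<alpha>)\<^sup>2 * op_norm (cocycle \<alpha> x n)" for n
  proof -
    have "jsr \<alpha> ^ n \<le> (upper_const \<alpha>)\<^sup>2 * mass \<alpha> (word_prefix n x)"
      using thick[of n] unfolding thick_def by (metis length_word_prefix sublist_order.order_refl)
    also have "\<dots> \<le> (upper_const \<alpha>)\<^sup>2 * (4 * op_norm (cocycle \<alpha> x n))"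
      using mass_cocycle(1)[of \<alpha> n x] \<alpha> by (intro mult_left_mono) auto
    finally show ?thesis by simp
  qed
  show "strongly_extremal \<alpha> x" unfolding strongly_extremal_def
    using * c by (intro exI[of _ "1 / (4 * (upper_const \<alpha>)\<^sup>2)"]) (auto simp: field_simps)
qed

text \<open>A limit of optimal words is thick, hence weakly extremal, hence has regular windows of any
  length. These windows are thick as well, and a limit of them is regular and thick.\<close>

lemma regular_thick_word_exists:
  assumes \<alpha>: "\<alpha> \<in> {0<..1}"
  shows "\<exists>z. regular (opt_ratio \<alpha>) z \<and> (\<forall>n. thick \<alpha> (word_prefix n z))"
proof -
  have take_thick: "thick \<alpha> (take n w)" if "thick \<alpha> w" for w n
    using that thick_sublist sublist_take by blast
  have "\<exists>w. length w = n \<and> thick \<alpha> w" for n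
    using best_word_thick[OF \<alpha>] best_word(1)[of \<alpha>] \<alpha> by (metis greaterThanAtMost_iff atLeastAtMost_iff less_imp_le)
  from infinite_word_of_prefix_closed[of "thick \<alpha>", OF take_thick this]
  obtain x where x: "\<And>n. thick \<alpha> (word_prefix n x)" by blast
  have weak: "weakly_extremal \<alpha> x"
    using strongly_imp_weakly_extremal[OF \<alpha>] thick_word_strongly_extremal[OF \<alpha> x] by blast
  have "\<exists>w. length w = L \<and> regular_word (opt_ratio \<alpha>) w \<and> thick \<alpha> w" for L
  proof -
    have "{k. \<not> regular_word (opt_ratio \<alpha>) (window x k L)} \<noteq> UNIV"
      using irregular_windows_zero_density[OF \<alpha> weak, of L] not_zero_density_UNIV by metis
    then obtain k where "regular_word (opt_ratio \<alpha>) (window x k L)" by blast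
    moreover have "thick \<alpha> (window x k L)"
      using thick_sublist[OF x[of "k + L"]] sublist_window[of k L "k + L" x 0] by (simp add: word_prefix_eq_window)
    ultimately show ?thesis by (intro exI[of _ "window x k L"]) simp
  qed
  then obtain z where "\<And>n. regular_word (opt_ratio \<alpha>) (word_prefix n z) \<and> thick \<alpha> (word_prefix n z)"
    using infinite_word_of_prefix_closed[of "\<lambda>w. regular_word (opt_ratio \<alpha>) w \<and> thick \<alpha> w"]
      regular_word_take take_thick by blast
  thus ?thesis using regular_of_prefixes by blast
qed

lemma regular_imp_thick:
  assumes \<alpha>: "\<alpha> \<in> {0<..1}" and y: "regular (opt_ratio \<alpha>) y"
  shows "thick \<alpha> (word_prefix n y)"
proof -
  obtain z where z: "regular (opt_ratio \<alpha>) z" "\<And>n. thick \<alpha> (word_prefix n z)"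
    using regular_thick_word_exists[OF \<alpha>] by blast
  obtain m where m: "window z m n = window y 0 n" using window_occurs_in_regular[OF y z(1)] by blast
  have "thick \<alpha> (window z m n)"
    using thick_sublist[OF z(2)[of "m + n"]] sublist_window[of m n "m + n" z 0] by (simp add: word_prefix_eq_window)
  thus ?thesis by (simp add: m word_prefix_eq_window)
qed

text \<open>For large \<open>N\<close> a thick word contains no run of length \<open>N\<close>. If it is long, its first and last
  \<open>N\<close> letters are therefore mixed, so that the diagonal entries of its product dominate the mass of
  the middle part. Short words are controlled by the diagonal entries being at least one at
  parameter one.\<close>

lemma thick_spec_rad:
  assumes \<alpha>: "\<alpha> \<in> {0<..1}" and thick: "thick \<alpha> w"
    and N: "(upper_const \<alpha>)\<^sup>2 * (real N + 2) < jsr \<alpha> ^ N"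
  shows "\<alpha> ^ (2 * N) * jsr \<alpha> ^ length w
    \<le> (upper_const \<alpha>)\<^sup>2 * jsr \<alpha> ^ (2 * N) * spec_rad (word_prod \<alpha> w)"
proof -
  define c \<rho> where "c = upper_const \<alpha>" and "\<rho> = jsr \<alpha>"
  have \<rho>: "\<rho> > 1" and c: "c > 1" using jsr_gt_1[OF \<alpha>] upper_const_bounds[OF \<alpha>] by (auto simp: \<rho>_def c_def)
  have c2: "c\<^sup>2 \<ge> 1" using c by (intro one_le_power) auto
  let ?tr = "word_prod \<alpha> w $1$1 + word_prod \<alpha> w $2$2"
  have tr_scale: "?tr = \<alpha> ^ ones w * (word_prod 1 w $1$1 + word_prod 1 w $2$2)"
    by (subst (1 2) word_prod_scale) (simp add: algebra_simps)
  have "\<alpha> ^ (2 * N) * \<rho> ^ length w \<le> c\<^sup>2 * \<rho> ^ (2 * N) * (?tr / 2)"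
  proof (cases "length w \<le> 2 * N")
    case True
    have "\<alpha> ^ (2 * N) \<le> \<alpha> ^ ones w" using \<alpha> True ones_le_length[of w] by (intro power_decreasing) auto
    also have "\<dots> \<le> \<alpha> ^ ones w * ((word_prod 1 w $1$1 + word_prod 1 w $2$2) / 2)"
      using word_prod_one_entries(1,2)[of w] \<alpha> by (intro mult_right_le_one_le[THEN order_trans] mult_le_cancel_left1[THEN iffD2]) auto
    finally have tr: "\<alpha> ^ (2 * N) \<le> ?tr / 2" unfolding tr_scale by simp
    have "\<alpha> ^ (2 * N) * \<rho> ^ length w \<le> (?tr / 2) * \<rho> ^ (2 * N)"
      by (rule mult_mono[OF tr power_increasing]) (use True \<alpha> \<rho> order_trans[OF _ tr, of 0] in auto)
    also have "\<dots> \<le> c\<^sup>2 * ((?tr / 2) * \<rho> ^ (2 * N))"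
    proof -
      have "0 \<le> (?tr / 2) * \<rho> ^ (2 * N)"
        using order_trans[OF _ tr, of 0] \<alpha> \<rho> by (intro mult_nonneg_nonneg) auto
      thus ?thesis using mult_right_mono[OF c2] by fastforce
    qed
    finally show ?thesis by (simp add: mult_ac)
  next
    case False
    define u v t where "u = take N w" and "v = take (length w - 2 * N) (drop N w)" and "t = drop (length w - N) w"
    have w: "w = u @ v @ t"
    proof -
      have "drop N w = v @ drop (length w - 2 * N) (drop N w)"
        unfolding v_def by (rule append_take_drop_id[symmetric])
      also have "drop (length w - 2 * N) (drop N w) = t" using False by (simp add: t_def)
      finally show ?thesis by (metis append_take_drop_id u_def)
    qed
    have len: "length u = N" "length t = N" "length v = length w - 2 * N" using False by (auto simp: u_def v_def t_def)
    have mixed: "mixed s" if s: "length s = N" "sublist s w" for s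
    proof (rule ccontr)
      assume "\<not> mixed s"
      then obtain b where b: "s = replicate N b" using not_mixed_replicate s(1) by metis
      have "\<rho> ^ N \<le> c\<^sup>2 * mass \<alpha> s" using thick s unfolding thick_def c_def \<rho>_def by blast
      also have "mass \<alpha> s \<le> real N + 2"
        unfolding b mass_replicate using \<alpha> by (auto intro!: mult_left_le_one_le power_le_one)
      hence "c\<^sup>2 * mass \<alpha> s \<le> c\<^sup>2 * (real N + 2)" by (intro mult_left_mono) auto
      finally show False using N c2 by (simp add: c_def \<rho>_def)
    qed
    have mu: "mixed u" and mt: "mixed t"
      using mixed[OF len(1)] mixed[OF len(2)] unfolding u_def t_def by (simp_all add: sublist_take sublist_drop)
    have sv: "sublist v w" unfolding w by (metis sublist_appendI)
    let ?B = "word_prod 1"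
    have "2 * mass 1 v \<le> ?B w $1$1 + ?B w $2$2"
    proof -
      have gen: "mass 1 v \<le> (?B u ** ?B v ** ?B t) $ i $ i" if "i = 1 \<or> i = 2" for i
      proof -
        note U = mixed_entries[OF mu] and T = mixed_entries[OF mt] and V = word_prod_one_entries[of v]
        have "(?B u ** ?B v ** ?B t) $ i $ i = ?B v $1$1 * (?B u $ i $1 * ?B t $1 $ i)
          + ?B v $1$2 * (?B u $ i $1 * ?B t $2 $ i) + ?B v $2$1 * (?B u $ i $2 * ?B t $1 $ i)
          + ?B v $2$2 * (?B u $ i $2 * ?B t $2 $ i)"
          using that by (auto simp: mat2_mult_entries algebra_simps)
        also have "\<dots> \<ge> ?B v $1$1 * (1 * 1) + ?B v $1$2 * (1 * 1) + ?B v $2$1 * (1 * 1) + ?B v $2$2 * (1 * 1)"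
          using that U T V by (intro add_mono mult_mono) auto
        finally show ?thesis by (simp add: mass_def entry_sum_def)
      qed
      have "?B w = ?B u ** ?B v ** ?B t" by (simp add: w word_prod_append matrix_mul_assoc)
      thus ?thesis using gen[of 1] gen[of 2] by simp
    qed
    hence "\<alpha> ^ ones w * (2 * mass 1 v) \<le> ?tr" unfolding tr_scale using \<alpha> by (intro mult_left_mono) auto
    moreover have "\<alpha> ^ (2 * N) * mass \<alpha> v \<le> \<alpha> ^ ones w * mass 1 v"
    proof -
      have "ones u \<le> N" "ones t \<le> N" using ones_le_length[of u] ones_le_length[of t] len by auto
      hence "ones w \<le> 2 * N + ones v" by (simp add: w)
      hence "\<alpha> ^ (2 * N + ones v) \<le> \<alpha> ^ ones w" using \<alpha> by (intro power_decreasing) auto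
      hence "\<alpha> ^ (2 * N + ones v) * mass 1 v \<le> \<alpha> ^ ones w * mass 1 v" using mass_nonneg[of 1 v] by (intro mult_right_mono) auto
      thus ?thesis by (subst mass_scale) (simp add: power_add mult_ac)
    qed
    ultimately have tr: "\<alpha> ^ (2 * N) * mass \<alpha> v \<le> ?tr / 2" by simp
    have "\<rho> ^ length w = \<rho> ^ (2 * N) * \<rho> ^ length v" using False len(3) by (simp flip: power_add)
    also have "\<dots> \<le> \<rho> ^ (2 * N) * (c\<^sup>2 * mass \<alpha> v)"
      using thick sv \<rho> unfolding thick_def c_def \<rho>_def by (intro mult_left_mono) auto
    finally have "\<alpha> ^ (2 * N) * \<rho> ^ length w \<le> \<alpha> ^ (2 * N) * (\<rho> ^ (2 * N) * (c\<^sup>2 * mass \<alpha> v))"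
      using \<alpha> by (intro mult_left_mono) auto
    also have "\<dots> = c\<^sup>2 * \<rho> ^ (2 * N) * (\<alpha> ^ (2 * N) * mass \<alpha> v)" by (simp add: mult_ac)
    also have "\<dots> \<le> c\<^sup>2 * \<rho> ^ (2 * N) * (?tr / 2)" using tr \<rho> by (intro mult_left_mono) auto
    finally show ?thesis .
  qed
  also have "\<dots> \<le> c\<^sup>2 * \<rho> ^ (2 * N) * spec_rad (word_prod \<alpha> w)"
    using trace_le_spec_rad[OF word_prod_nonneg[of \<alpha> w]] \<alpha> \<rho> by (intro mult_left_mono) auto
  finally show ?thesis by (simp add: c_def \<rho>_def)
qed

section \<open>Recurrent strongly extremal words\<close>

lemma subwords_window: "u \<in> subwords x \<longleftrightarrow> u \<noteq> [] \<and> (\<exists>i. window x i (length u) = u)"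
  by (auto simp: subwords_def occurs_at_window)

lemma subwords_sublist:
  assumes "v \<in> subwords x" "sublist u v" "u \<noteq> []" shows "u \<in> subwords x"
proof -
  from assms(1) obtain i where i: "window x i (length v) = v" by (auto simp: subwords_window)
  from assms(2) obtain a b where v: "v = a @ u @ b" by (auto simp: sublist_def)
  have "take (length u) (drop (length a) (window x i (length v))) = window x (i + length a) (length u)"
    by (rule take_drop_window) (simp add: v)
  hence "window x (i + length a) (length u) = u" unfolding i by (simp add: v)
  thus ?thesis using assms(3) by (auto simp: subwords_window)
qed

lemma recurrent_occurs_later:
  assumes "recurrent x" "u \<in> subwords x" shows "\<exists>i\<ge>s. window x i (length u) = u"
proof -
  have "infinite {i. window x i (length u) = u}" using assms by (auto simp: recurrent_def occurs_at_window)
  thus ?thesis by (auto simp: infinite_nat_iff_unbounded_le)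
qed

lemma recurrent_disj_occ:
  assumes "recurrent x" "a \<in> subwords x" shows "\<exists>n. disj_occ t a (window x s n)"
proof (induction t arbitrary: s)
  case (Suc t)
  obtain i where i: "i \<ge> s" "window x i (length a) = a" using recurrent_occurs_later[OF assms] by blast
  obtain n where n: "disj_occ t a (window x (i + length a) n)" using Suc.IH by blast
  have "window x s ((i - s) + (length a + n)) = window x s (i - s) @ a @ window x (i + length a) n"
    unfolding window_append using i by simp
  with n have "disj_occ (Suc t) a (window x s ((i - s) + (length a + n)))" by auto
  thus ?case by blast
qed simp

lemma recurrent_mixed_window:
  assumes "recurrent x" "[True] \<in> subwords x" "[False] \<in> subwords x"
  shows "\<exists>n. mixed (window x s n)"
proof -
  obtain i where i: "i \<ge> s" "x i" using recurrent_occurs_later[OF assms(1,2)] by (auto simp: window_def)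
  obtain j where j: "j \<ge> s" "\<not> x j" using recurrent_occurs_later[OF assms(1,3)] by (auto simp: window_def)
  define n where "n = max i j + 1 - s"
  have "i \<in> {s..<s + n}" "j \<in> {s..<s + n}" using i j by (auto simp: n_def)
  hence "x i \<in> set (window x s n)" "x j \<in> set (window x s n)" by (auto simp: window_def)
  thus ?thesis using i j by (auto simp: mixed_def)
qed

lemma recurrent_mixed_context:
  assumes rec: "recurrent x" and u: "u \<in> subwords x" and letters: "[True] \<in> subwords x" "[False] \<in> subwords x"
  shows "\<exists>c d. mixed c \<and> mixed d \<and> c @ u @ d \<in> subwords x"
proof -
  obtain n where n: "mixed (window x 0 n)" using recurrent_mixed_window[OF rec letters] by blast
  obtain i where i: "i \<ge> n" "window x i (length u) = u" using recurrent_occurs_later[OF rec u] by blast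
  obtain m where m: "mixed (window x (i + length u) m)" using recurrent_mixed_window[OF rec letters] by blast
  have "window x 0 i = window x 0 n @ window x n (i - n)" using window_append[of x 0 n "i - n"] i(1) by simp
  hence "mixed (window x 0 i)" using n by (auto simp: mixed_def)
  moreover have "window x 0 (i + (length u + m)) = window x 0 i @ u @ window x (i + length u) m"
    unfolding window_append using i(2) by simp
  moreover have "window x 0 (i + (length u + m)) \<in> subwords x"
    using u by (intro window_in_subwords) (auto simp: subwords_window)
  ultimately show ?thesis using m by metis
qed

text \<open>An unbalanced recurrent word contains a conflicting pair of factors, each of which occurs
  infinitely often. So prefixes lose an unbounded factor against \<open>jsr \<alpha> ^ n\<close>.\<close>

lemma recurrent_strongly_extremal_balanced:
  assumes \<alpha>: "\<alpha> \<in> {0<..1}" and rec: "recurrent x" and strong: "strongly_extremal \<alpha> x"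
  shows "balanced x"
proof (rule ccontr)
  assume "\<not> balanced x"
  then obtain u v where uv: "u \<in> subwords x" "v \<in> subwords x" "length u = length v" "ones u + 2 \<le> ones v"
  proof -
    from \<open>\<not> balanced x\<close> obtain u v where uv: "u \<in> subwords x" "v \<in> subwords x" "length u = length v"
      "\<bar>int (ones u) - int (ones v)\<bar> > 1" unfolding balanced_def by auto
    show ?thesis
    proof (cases "ones u \<le> ones v")
      case True
      thus ?thesis using uv by (intro that[of u v]) auto
    next
      case False
      thus ?thesis using uv by (intro that[of v u]) auto
    qed
  qed
  obtain p where p: "rev p = p" "sublist ([False] @ p @ [False]) u" "sublist ([True] @ p @ [True]) v"
    using unbalanced_palindrome[OF uv(3,4)] by blast
  have sub: "[False] @ p @ [False] \<in> subwords x" "[True] @ p @ [True] \<in> subwords x"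
    using p subwords_sublist uv(1,2) by blast+
  have letters: "[True] \<in> subwords x" "[False] \<in> subwords x"
    using subwords_sublist[OF sub(2), of "[True]"] subwords_sublist[OF sub(1), of "[False]"]
    by (simp_all add: sublist_Cons_right)
  obtain c1 c2 where a: "mixed c1" "mixed c2" "c1 @ ([False] @ p @ [False]) @ c2 \<in> subwords x"
    using recurrent_mixed_context[OF rec sub(1) letters] by blast
  obtain d1 d2 where b: "mixed d1" "mixed d2" "d1 @ ([True] @ p @ [True]) @ d2 \<in> subwords x"
    using recurrent_mixed_context[OF rec sub(2) letters] by blast
  define a' b' where "a' = c1 @ ([False] @ p @ [False]) @ c2" and "b' = d1 @ ([True] @ p @ [True]) @ d2"
  have conf: "conflicting a' b'" unfolding conflicting_def a'_def b'_def
    by (rule exI[of _ False], rule exI[of _ p], rule exI[of _ c1], rule exI[of _ c2], rule exI[of _ d1], rule exI[of _ d2])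
      (use a b p in simp)
  define c \<rho> where "c = upper_const \<alpha>" and "\<rho> = jsr \<alpha>"
  have \<rho>: "\<rho> > 1" using jsr_gt_1[OF \<alpha>] by (simp add: \<rho>_def)
  from strong obtain \<delta> where \<delta>: "\<delta> > 0" "\<And>n. n \<ge> 1 \<Longrightarrow> \<delta> * \<rho> ^ n \<le> op_norm (cocycle \<alpha> x n)"
    unfolding strongly_extremal_def \<rho>_def by blast
  define \<delta>' where "\<delta>' = min \<delta> 1"
  have \<delta>': "\<delta>' > 0" using \<delta>(1) by (simp add: \<delta>'_def)
  have lower: "\<delta>' * \<rho> ^ n \<le> mass \<alpha> (word_prefix n x)" for n
  proof (cases "n = 0")
    case True
    thus ?thesis by (simp add: word_prefix_def \<delta>'_def)
  next
    case False
    have "\<delta>' * \<rho> ^ n \<le> \<delta> * \<rho> ^ n" using \<rho> by (intro mult_right_mono) (auto simp: \<delta>'_def)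
    also have "\<dots> \<le> op_norm (cocycle \<alpha> x n)" using \<delta>(2) False by simp
    also have "\<dots> \<le> mass \<alpha> (word_prefix n x)" using mass_cocycle(2)[of \<alpha>] \<alpha> by auto
    finally show ?thesis .
  qed
  have bounded: "gain a' b' ^ t \<le> c / \<delta>'" for t
  proof -
    obtain n where n: "disj_occ t a' (window x 0 n)" using recurrent_disj_occ[OF rec a(3)] unfolding a'_def by blast
    obtain m where m: "disj_occ t b' (window x n m)" using recurrent_disj_occ[OF rec b(3)] unfolding b'_def by blast
    have pre: "window x 0 n @ window x n m = word_prefix (n + m) x"
      using window_append[of x 0 n m] by (simp add: word_prefix_eq_window)
    have "gain a' b' ^ t * (\<delta>' * \<rho> ^ (n + m)) \<le> gain a' b' ^ t * mass \<alpha> (word_prefix (n + m) x)"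
      using lower gain_gt_1[of a' b'] by (intro mult_left_mono) auto
    also have "\<dots> \<le> c * \<rho> ^ (n + m)"
      using conflicting_cost[OF \<alpha> conf n m] unfolding pre by (simp add: c_def \<rho>_def)
    finally have "(gain a' b' ^ t * \<delta>') * \<rho> ^ (n + m) \<le> c * \<rho> ^ (n + m)" by (simp add: mult_ac)
    hence "gain a' b' ^ t * \<delta>' \<le> c" using \<rho> by simp
    thus ?thesis using \<delta>' by (simp add: field_simps)
  qed
  obtain t where "c / \<delta>' < gain a' b' ^ t" using real_arch_pow[OF gain_gt_1] by blast
  with bounded[of t] show False by linarith
qed

section \<open>Mean distance to the optimal words\<close>

lemma word_dist_le:
  assumes "word_prefix l x = word_prefix l y" shows "word_dist x y \<le> (1/2) ^ Suc l"
proof (cases "x = y")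
  case False
  define i where "i = (LEAST i. x i \<noteq> y i)"
  from False obtain j where "x j \<noteq> y j" unfolding fun_eq_iff by blast
  hence "x i \<noteq> y i" unfolding i_def by (rule LeastI)
  moreover have "x k = y k" if "k < l" for k
    using assms that by (auto simp: word_prefix_def list_eq_iff_nth_eq)
  ultimately have "l \<le> i" by (metis not_less)
  have "word_dist x y = (1/2) ^ Suc i" unfolding word_dist_def i_def using False by (rule if_not_P)
  also have "\<dots> \<le> (1/2) ^ Suc l" using \<open>l \<le> i\<close> by (intro power_decreasing) auto
  finally show ?thesis .
qed (simp add: word_dist_def)

lemma word_dist_range: "0 \<le> word_dist x y" "word_dist x y \<le> 1"
  using word_dist_le[of 0 x y] by (simp_all add: word_dist_def word_prefix_def)

lemma word_setdist_le: "y \<in> Y \<Longrightarrow> word_setdist x Y \<le> word_dist x y"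
  unfolding word_setdist_def by (rule cINF_lower) (auto intro!: bdd_belowI[of _ 0] word_dist_range)

lemma word_setdist_nonneg: "Y \<noteq> {} \<Longrightarrow> 0 \<le> word_setdist x Y"
  unfolding word_setdist_def by (rule cINF_greatest) (auto intro: word_dist_range)

text \<open>At a position whose window of length \<open>L\<close> is regular, the shifted word agrees with an optimal
  word on \<open>l\<close> letters. All other positions have density zero.\<close>

lemma weakly_extremal_mean_distance:
  assumes \<alpha>: "\<alpha> \<in> {0<..1}" and weak: "weakly_extremal \<alpha> x"
  shows "(\<lambda>n. 1 / real n * (\<Sum>k<n. word_setdist ((shift ^^ k) x) (X_words (opt_ratio \<alpha>)))) \<longlonglongrightarrow> 0"
proof (rule tendstoI)
  fix e :: real assume e: "e > 0"
  define r where "r = opt_ratio \<alpha>"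
  define f where "f k = word_setdist ((shift ^^ k) x) (X_words r)" for k
  obtain z where z: "z \<in> X_words r"
    using regular_thick_word_exists[OF \<alpha>] unfolding X_words_eq_regular r_def by blast
  have f0: "0 \<le> f k" for k
    unfolding f_def by (rule word_setdist_nonneg) (use z in blast)
  have f1: "f k \<le> 1" for k
    unfolding f_def by (rule order_trans[OF word_setdist_le[OF z] word_dist_range(2)])
  obtain l where l: "(1/2) ^ l < e" using real_arch_pow_inv[of e "1/2"] e by auto
  obtain L where L: "L \<ge> l" "\<And>w. length w = L \<Longrightarrow> regular_word r w \<Longrightarrow> \<exists>y. regular r y \<and> word_prefix l y = take l w"
    using regular_word_prefix_extends[of l r] by blast
  define Bad where "Bad = {k. \<not> regular_word r (window x k L)}"
  have close: "f k \<le> e / 2" if k: "k \<notin> Bad" for k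
  proof -
    obtain y where y: "regular r y" "word_prefix l y = take l (window x k L)"
      using L(2)[of "window x k L"] k by (auto simp: Bad_def)
    have "take l (drop 0 (window x k L)) = window x (k + 0) l" using L(1) by (intro take_drop_window) simp
    hence "word_prefix l ((shift ^^ k) x) = word_prefix l y"
      using y(2) window_shift[of k x 0 l] by (simp add: word_prefix_eq_window)
    from word_dist_le[OF this] have "word_dist ((shift ^^ k) x) y \<le> (1/2) ^ Suc l" .
    moreover have "f k \<le> word_dist ((shift ^^ k) x) y"
      unfolding f_def by (rule word_setdist_le) (simp add: X_words_eq_regular y(1))
    ultimately show ?thesis using l by simp
  qed
  have "zero_density Bad" unfolding Bad_def r_def by (rule irregular_windows_zero_density[OF assms])
  hence "eventually (\<lambda>n. real (card (Bad \<inter> {..<n})) / real n < e / 2) sequentially"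
    unfolding zero_density_def by (rule order_tendstoD) (use e in simp)
  thus "eventually (\<lambda>n. dist (1 / real n * (\<Sum>k<n. word_setdist ((shift ^^ k) x) (X_words (opt_ratio \<alpha>)))) 0 < e) sequentially"
    using eventually_gt_at_top[of 0]
  proof eventually_elim
    case (elim n)
    have "(\<Sum>k<n. f k) \<le> (\<Sum>k<n. (if k \<in> Bad then 1 else 0) + e / 2)"
    proof (rule sum_mono)
      fix k
      show "f k \<le> (if k \<in> Bad then 1 else 0) + e / 2" using close[of k] f1[of k] e by auto
    qed
    also have "\<dots> = real (card (Bad \<inter> {..<n})) + real n * (e / 2)"
      by (simp add: sum.distrib sum.If_cases Int_commute)
    finally have "(\<Sum>k<n. f k) / real n \<le> (real (card (Bad \<inter> {..<n})) + real n * (e / 2)) / real n"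
      by (rule divide_right_mono) simp
    also have "\<dots> = real (card (Bad \<inter> {..<n})) / real n + e / 2" using elim(2) by (simp add: add_divide_distrib)
    also have "\<dots> < e" using elim(1) by linarith
    finally have "1 / real n * (\<Sum>k<n. f k) < e" by simp
    moreover have "0 \<le> 1 / real n * (\<Sum>k<n. f k)" using f0 by (intro mult_nonneg_nonneg sum_nonneg) auto
    ultimately show ?case by (simp add: f_def r_def dist_real_def)
  qed
qed

section \<open>Uniform bounds\<close>

lemma thick_rev: "thick \<alpha> w \<Longrightarrow> thick \<alpha> (rev w)"
  unfolding thick_def
proof (intro allI impI)
  fix v assume *: "\<forall>v. sublist v w \<longrightarrow> jsr \<alpha> ^ length v \<le> (upper_const \<alpha>)\<^sup>2 * mass \<alpha> v" "sublist v (rev w)"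
  hence "sublist (rev v) w" by (metis rev_rev_ident sublist_rev)
  with *(1) have "jsr \<alpha> ^ length (rev v) \<le> (upper_const \<alpha>)\<^sup>2 * mass \<alpha> (rev v)" by blast
  thus "jsr \<alpha> ^ length v \<le> (upper_const \<alpha>)\<^sup>2 * mass \<alpha> v" by (simp add: mass_rev)
qed

text \<open>All constants are controlled by the least element \<open>a\<close> of \<open>K\<close>: it bounds \<open>upper_const\<close> from
  above and, as \<open>jsr\<close> is increasing, \<open>jsr\<close> from below by a number larger than one.\<close>

lemma uniform_bounds:
  assumes K: "compact K" "K \<subseteq> {0<..1}"
  shows "\<exists>C>1. \<forall>\<alpha>\<in>K. \<forall>x\<in>X_words (opt_ratio \<alpha>). \<forall>n\<ge>1.
        inverse C \<le> spec_rad (cocycle \<alpha> x n) / jsr \<alpha> ^ n \<and>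
        spec_rad (cocycle \<alpha> x n) / jsr \<alpha> ^ n \<le> op_norm (cocycle \<alpha> x n) / jsr \<alpha> ^ n \<and>
        op_norm (cocycle \<alpha> x n) / jsr \<alpha> ^ n \<le> C"
proof (cases "K = {}")
  case True
  thus ?thesis by (intro exI[of _ 2]) auto
next
  case False
  then obtain a where a: "a \<in> K" "\<And>\<alpha>. \<alpha> \<in> K \<Longrightarrow> a \<le> \<alpha>" using compact_attains_inf[OF K(1)] by blast
  with K(2) have a01: "a \<in> {0<..1}" by auto
  define c0 \<rho>0 where "c0 = 9 / a" and "\<rho>0 = jsr a"
  have \<rho>0: "\<rho>0 > 1" and c0: "c0 \<ge> 9" using jsr_gt_1[OF a01] a01 by (auto simp: \<rho>0_def c0_def field_simps)
  have "(\<lambda>N. c0\<^sup>2 * (real N + 2) / \<rho>0 ^ N) \<longlonglongrightarrow> 0" using \<rho>0 by real_asymp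
  hence "eventually (\<lambda>N. c0\<^sup>2 * (real N + 2) / \<rho>0 ^ N < 1) sequentially" by (rule order_tendstoD) simp
  then obtain N where "c0\<^sup>2 * (real N + 2) / \<rho>0 ^ N < 1" by (auto simp: eventually_sequentially)
  hence N: "c0\<^sup>2 * (real N + 2) < \<rho>0 ^ N" using \<rho>0 by (simp add: field_simps)
  define C1 where "C1 = c0\<^sup>2 * 3 ^ (2 * N) / a ^ (2 * N)"
  have C1: "C1 > 0" using c0 a01 by (simp add: C1_def)
  define C where "C = C1 + c0"
  have C: "C > 1" "C \<ge> c0" "C \<ge> C1" using C1 c0 by (auto simp: C_def)
  have "inverse C \<le> spec_rad (cocycle \<alpha> x n) / jsr \<alpha> ^ n \<and>
        spec_rad (cocycle \<alpha> x n) / jsr \<alpha> ^ n \<le> op_norm (cocycle \<alpha> x n) / jsr \<alpha> ^ n \<and>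
        op_norm (cocycle \<alpha> x n) / jsr \<alpha> ^ n \<le> C"
    if "\<alpha> \<in> K" "x \<in> X_words (opt_ratio \<alpha>)" for \<alpha> x n
  proof -
    have \<alpha>: "\<alpha> \<in> {0<..1}" and a\<alpha>: "a \<le> \<alpha>" using that(1) K(2) a(2) by auto
    define c \<rho> where "c = upper_const \<alpha>" and "\<rho> = jsr \<alpha>"
    have \<rho>: "1 < \<rho>" "\<rho>0 \<le> \<rho>" "\<rho> \<le> 3"
      using jsr_gt_1[OF \<alpha>] jsr_mono[of a \<alpha>] jsr_le_3[of \<alpha>] \<alpha> a01 a\<alpha> by (auto simp: \<rho>_def \<rho>0_def)
    have "9 / \<alpha> \<le> 9 / a" using a\<alpha> a01 \<alpha> by (intro divide_left_mono) auto
    hence c: "1 < c" "c \<le> c0" using upper_const_bounds[OF \<alpha>] by (auto simp: c_def c0_def)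
    hence c2: "c\<^sup>2 \<le> c0\<^sup>2" by (intro power_mono) auto
    define w where "w = rev (word_prefix n x)"
    have thick: "thick \<alpha> w"
      using regular_imp_thick[OF \<alpha>, of x n] that(2) by (simp add: X_words_eq_regular w_def thick_rev)
    have "c\<^sup>2 * (real N + 2) \<le> c0\<^sup>2 * (real N + 2)" using c2 by (intro mult_right_mono) auto
    also have "\<dots> < \<rho>0 ^ N" by (rule N)
    also have "\<dots> \<le> \<rho> ^ N" using \<rho> \<rho>0 by (intro power_mono) auto
    finally have N': "(upper_const \<alpha>)\<^sup>2 * (real N + 2) < jsr \<alpha> ^ N" by (simp add: c_def \<rho>_def)
    define s where "s = spec_rad (cocycle \<alpha> x n)"
    have "\<alpha> ^ (2 * N) * \<rho> ^ n \<le> c\<^sup>2 * \<rho> ^ (2 * N) * s"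
      using thick_spec_rad[OF \<alpha> thick N'] by (simp add: c_def \<rho>_def s_def w_def cocycle_eq_word_prod)
    moreover have "a ^ (2 * N) * \<rho> ^ n \<le> \<alpha> ^ (2 * N) * \<rho> ^ n"
      using a01 a\<alpha> \<rho> by (intro mult_right_mono power_mono) auto
    ultimately have 1: "a ^ (2 * N) * \<rho> ^ n \<le> c\<^sup>2 * \<rho> ^ (2 * N) * s" by linarith
    have "0 < a ^ (2 * N) * \<rho> ^ n" using a01 \<rho> by simp
    hence "0 < c\<^sup>2 * \<rho> ^ (2 * N) * s" using 1 by linarith
    hence s0: "s > 0" using c \<rho> by (elim zero_less_mult_pos) simp
    have "c\<^sup>2 * \<rho> ^ (2 * N) * s \<le> c0\<^sup>2 * 3 ^ (2 * N) * s"
      using \<rho> s0 by (intro mult_right_mono mult_mono[OF c2] power_mono) auto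
    with 1 have "a ^ (2 * N) * \<rho> ^ n \<le> c0\<^sup>2 * 3 ^ (2 * N) * s" by linarith
    hence "\<rho> ^ n \<le> C1 * s" using a01 by (simp add: C1_def field_simps)
    also have "\<dots> \<le> C * s" using C s0 by (intro mult_right_mono) auto
    finally have "inverse C \<le> s / \<rho> ^ n" using C \<rho> by (simp add: field_simps)
    moreover have "s / \<rho> ^ n \<le> op_norm (cocycle \<alpha> x n) / \<rho> ^ n"
      unfolding s_def using \<rho> by (intro divide_right_mono spec_rad_le_op_norm) auto
    moreover have "op_norm (cocycle \<alpha> x n) / \<rho> ^ n \<le> C"
    proof -
      have "op_norm (cocycle \<alpha> x n) \<le> c * \<rho> ^ n"
        using mass_cocycle(2)[of \<alpha> x n] mass_le_jsr[OF \<alpha>, of "word_prefix n x"] \<alpha> by (simp add: c_def \<rho>_def)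
      also have "\<dots> \<le> C * \<rho> ^ n" using c C \<rho> by (intro mult_right_mono) auto
      finally show ?thesis using \<rho> by (simp add: field_simps)
    qed
    ultimately show ?thesis by (simp add: s_def \<rho>_def)
  qed
  thus ?thesis using C(1) by blast
qed

section \<open>The degenerate parameter\<close>

lemma X_words_zero: "X_words 0 = {\<lambda>_. False}"
proof -
  have "regular 0 x \<longleftrightarrow> x = (\<lambda>_. False)" for x
  proof
    assume r: "regular 0 x"
    have "\<not> x i" for i
    proof
      assume "x i"
      hence "ones (window x i 1) = 1" by (simp add: window_def)
      moreover have "\<bar>real (ones (window x i 1)) - 0 * real 1\<bar> < 1" using r unfolding regular_iff_window by blast
      ultimately show False by simp
    qed
    thus "x = (\<lambda>_. False)" by auto
  next
    assume "x = (\<lambda>_. False)"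
    thus "regular 0 x" by (simp add: regular_iff_window window_def map_replicate_const)
  qed
  thus ?thesis by (auto simp: X_words_eq_regular)
qed

lemma mass_zero: "mass 0 w = (if True \<in> set w then 0 else real (length w) + 2)"
proof (cases "True \<in> set w")
  case True
  hence "ones w \<noteq> 0" by (simp add: ones_def count_list_0_iff)
  thus ?thesis using True by (subst mass_scale) simp
next
  case False
  hence "w = replicate (length w) False" by (metis (full_types) replicate_length_same)
  hence "mass 0 w = mass 0 (replicate (length w) False)" by simp
  thus ?thesis using False by (simp add: mass_replicate)
qed

lemma jsr_zero: "jsr 0 = 1"
proof (rule antisym)
  show "jsr 0 \<le> 1"
  proof (rule ccontr)
    assume "\<not> jsr 0 \<le> 1"
    hence \<rho>: "jsr 0 > 1" by simp
    hence "(\<lambda>n. (real n + 2) / jsr 0 ^ n) \<longlonglongrightarrow> 0" by real_asymp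
    hence "eventually (\<lambda>n. (real n + 2) / jsr 0 ^ n < 1) sequentially" by (rule order_tendstoD) simp
    then obtain n where "(real n + 2) / jsr 0 ^ n < 1" by (auto simp: eventually_sequentially)
    hence "real n + 2 < jsr 0 ^ n" using \<rho> by (simp add: field_simps)
    moreover obtain w where "length w = n" "jsr 0 ^ n \<le> mass 0 w" using jsr_power_attained[of 0 n] by auto
    ultimately show False by (auto simp: mass_zero split: if_splits)
  qed
qed (simp add: jsr_ge_1)

lemma op_norm_cocycle_zero:
  assumes "x k" "k < n" shows "op_norm (cocycle 0 x n) = 0"
proof -
  have "True \<in> set (word_prefix n x)" using assms by (auto simp: word_prefix_def image_iff)
  thus ?thesis using mass_cocycle(2)[of 0 x n] op_norm_nonneg[of "cocycle 0 x n"] by (simp add: mass_zero)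
qed

lemma extremal_zero:
  shows "weakly_extremal 0 x \<Longrightarrow> x = (\<lambda>_. False)" and "strongly_extremal 0 x \<Longrightarrow> x = (\<lambda>_. False)"
proof -
  show "x = (\<lambda>_. False)" if "weakly_extremal 0 x"
  proof (rule ext, rule ccontr)
    fix k assume "x k \<noteq> False"
    hence "eventually (\<lambda>n. root n (op_norm (cocycle 0 x n)) = 0) sequentially"
      using op_norm_cocycle_zero[of x k] by (auto intro: eventually_mono[OF eventually_gt_at_top[of k]])
    hence "(\<lambda>n. root n (op_norm (cocycle 0 x n))) \<longlonglongrightarrow> 0" by (rule tendsto_eventually)
    thus False using that LIMSEQ_unique unfolding weakly_extremal_def jsr_zero by fastforce
  qed
  show "x = (\<lambda>_. False)" if strong: "strongly_extremal 0 x"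
  proof (rule ext, rule ccontr)
    fix k assume "x k \<noteq> False"
    hence "op_norm (cocycle 0 x (Suc k)) = 0" by (intro op_norm_cocycle_zero[of x k]) simp_all
    moreover obtain \<delta> where "\<delta> > 0" "\<And>n. n \<ge> 1 \<Longrightarrow> \<delta> * 1 ^ n \<le> op_norm (cocycle 0 x n)"
      using strong unfolding strongly_extremal_def jsr_zero by blast
    from this(1) this(2)[of "Suc k"] have "op_norm (cocycle 0 x (Suc k)) > 0" by simp
    ultimately show False by simp
  qed
qed

lemma strongly_extremal_zero: "strongly_extremal 0 (\<lambda>_. False)"
proof -
  have "op_norm (cocycle 0 (\<lambda>_. False) n) \<ge> 1 / 4 * jsr 0 ^ n" for n
    using mass_cocycle(1)[of 0 n "\<lambda>_. False"] by (auto simp: mass_zero word_prefix_def jsr_zero)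
  thus ?thesis unfolding strongly_extremal_def by (intro exI[of _ "1 / 4"]) auto
qed

theorem theorem2p3:
  shows "\<exists>\<rr> :: real \<Rightarrow> real.
    continuous_on {0..1} \<rr> \<and> mono_on {0..1} \<rr> \<and> \<rr> ` {0..1} = {0..1/2} \<and>
    (\<forall>\<alpha>\<in>{0..1}. unique_optimal_one_ratio \<alpha> (\<rr> \<alpha>)) \<and>
    (\<forall>\<alpha>\<in>{0..1}. \<forall>x\<in>X_words (\<rr> \<alpha>). strongly_extremal \<alpha> x) \<and>
    (\<forall>K. compact K \<and> K \<subseteq> {0<..1} \<longrightarrow>
      (\<exists>C>1. \<forall>\<alpha>\<in>K. \<forall>x\<in>X_words (\<rr> \<alpha>). \<forall>n\<ge>1.
        inverse C \<le> spec_rad (cocycle \<alpha> x n) / jsr \<alpha> ^ n \<and>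
        spec_rad (cocycle \<alpha> x n) / jsr \<alpha> ^ n \<le> op_norm (cocycle \<alpha> x n) / jsr \<alpha> ^ n \<and>
        op_norm (cocycle \<alpha> x n) / jsr \<alpha> ^ n \<le> C)) \<and>
    (\<forall>\<alpha>\<in>{0..1}. \<forall>x. recurrent x \<and> strongly_extremal \<alpha> x \<longrightarrow> x \<in> X_words (\<rr> \<alpha>)) \<and>
    (\<forall>\<alpha>\<in>{0..1}. \<forall>x. weakly_extremal \<alpha> x \<longrightarrow>
      (\<lambda>n. 1 / real n * (\<Sum>k<n. word_setdist ((shift ^^ k) x) (X_words (\<rr> \<alpha>)))) \<longlonglongrightarrow> 0)"
proof -
  have zero: "opt_ratio 0 = 0" by (simp add: opt_ratio_def)
  have cases: "\<alpha> = 0 \<or> \<alpha> \<in> {0<..1}" if "\<alpha> \<in> {0..1}" for \<alpha> :: real using that by auto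
  have unique: "unique_optimal_one_ratio \<alpha> (opt_ratio \<alpha>)" if \<alpha>: "\<alpha> \<in> {0..1}" for \<alpha>
    unfolding unique_optimal_one_ratio_def
  proof (intro conjI allI impI)
    show "opt_ratio \<alpha> \<in> {0..1}" by (rule opt_ratio_range[OF \<alpha>])
    fix x assume weak: "weakly_extremal \<alpha> x"
    from cases[OF \<alpha>] show "(\<lambda>n. one_ratio (word_prefix n x)) \<longlonglongrightarrow> opt_ratio \<alpha>"
    proof
      assume "\<alpha> = 0"
      hence "x \<in> X_words (opt_ratio \<alpha>)" using extremal_zero(1) weak by (simp add: zero X_words_zero)
      thus ?thesis by (simp add: X_words_def)
    qed (rule weakly_extremal_ratio[OF _ weak])
  qed
  have strong: "strongly_extremal \<alpha> x" if \<alpha>: "\<alpha> \<in> {0..1}" and x: "x \<in> X_words (opt_ratio \<alpha>)" for \<alpha> x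
    using cases[OF \<alpha>]
  proof
    assume "\<alpha> = 0"
    thus ?thesis using x strongly_extremal_zero by (simp add: zero X_words_zero)
  next
    assume "\<alpha> \<in> {0<..1}"
    thus ?thesis using x regular_imp_thick thick_word_strongly_extremal by (simp add: X_words_eq_regular)
  qed
  have optimal: "x \<in> X_words (opt_ratio \<alpha>)" if \<alpha>: "\<alpha> \<in> {0..1}" and x: "recurrent x" "strongly_extremal \<alpha> x" for \<alpha> x
    using cases[OF \<alpha>]
  proof
    assume "\<alpha> = 0"
    thus ?thesis using x(2) extremal_zero(2) by (simp add: zero X_words_zero)
  next
    assume \<alpha>': "\<alpha> \<in> {0<..1}"
    show ?thesis
      using recurrent_strongly_extremal_balanced[OF \<alpha>' x] x(1)
        weakly_extremal_ratio[OF \<alpha>' strongly_imp_weakly_extremal[OF \<alpha>' x(2)]] by (simp add: X_words_def)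
  qed
  have mean: "(\<lambda>n. 1 / real n * (\<Sum>k<n. word_setdist ((shift ^^ k) x) (X_words (opt_ratio \<alpha>)))) \<longlonglongrightarrow> 0"
    if \<alpha>: "\<alpha> \<in> {0..1}" and weak: "weakly_extremal \<alpha> x" for \<alpha> x
    using cases[OF \<alpha>]
  proof
    assume "\<alpha> = 0"
    hence "x = (\<lambda>_. False)" using extremal_zero(1) weak by simp
    thus ?thesis using \<open>\<alpha> = 0\<close>
      by (simp add: zero X_words_zero funpow_shift word_setdist_def word_dist_def)
  qed (rule weakly_extremal_mean_distance[OF _ weak])
  show ?thesis
  proof (rule exI[of _ opt_ratio], intro conjI)
    show "\<forall>\<alpha>\<in>{0..1}. unique_optimal_one_ratio \<alpha> (opt_ratio \<alpha>)" using unique by blast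
    show "\<forall>\<alpha>\<in>{0..1}. \<forall>x\<in>X_words (opt_ratio \<alpha>). strongly_extremal \<alpha> x" using strong by blast
    show "\<forall>\<alpha>\<in>{0..1}. \<forall>x. recurrent x \<and> strongly_extremal \<alpha> x \<longrightarrow> x \<in> X_words (opt_ratio \<alpha>)"
      using optimal by blast
    show "\<forall>\<alpha>\<in>{0..1}. \<forall>x. weakly_extremal \<alpha> x \<longrightarrow>
      (\<lambda>n. 1 / real n * (\<Sum>k<n. word_setdist ((shift ^^ k) x) (X_words (opt_ratio \<alpha>)))) \<longlonglongrightarrow> 0"
      using mean by blast
    show "\<forall>K. compact K \<and> K \<subseteq> {0<..1} \<longrightarrow>
      (\<exists>C>1. \<forall>\<alpha>\<in>K. \<forall>x\<in>X_words (opt_ratio \<alpha>). \<forall>n\<ge>1.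
        inverse C \<le> spec_rad (cocycle \<alpha> x n) / jsr \<alpha> ^ n \<and>
        spec_rad (cocycle \<alpha> x n) / jsr \<alpha> ^ n \<le> op_norm (cocycle \<alpha> x n) / jsr \<alpha> ^ n \<and>
        op_norm (cocycle \<alpha> x n) / jsr \<alpha> ^ n \<le> C)"
      by (intro allI impI, elim conjE, rule uniform_bounds)
  qed (rule opt_ratio_continuous opt_ratio_mono opt_ratio_image)+
qed

end
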